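(* If $0 \le k \le 2$, then, as operators on $\mathbb{H}_X'$, $$\mathfrak{G}_k(t_1,t_2) = t_2^k\, t_1^{\delta(\cdot)}\, \overline{\mathfrak{B}}_k^{(\alpha)}\big|_{\alpha=-t_1/t_2},$$ where $t_1^{\delta(\cdot)}\mathfrak{a}_\lambda = t_1^{\delta(\lambda)}\mathfrak{a}_\lambda = t_1^{\ell(\lambda^-)-\ell(\lambda^+)}\mathfrak{a}_\lambda$ for a generalized partition $\lambda$, and $\lambda^+$ and $\lambda^-$ are the positive and negative parts of $\lambda$ respectively.
   Context: Setting. $X=\mathbb{C}^2$ with standard coordinate functions $u,v$; $\mathbb{T}=(\mathbb{C}^* )^2$ acts by $(a,b)\cdot(u,v)=(a^{-1}u,b^{-1}v)$. $H^*_{\mathbb{T}}(\mathrm{pt})=\mathbb{C}[t_1,t_2]$ and $H^*_{\mathbb{T}}(\cdot)'=H^*_{\mathbb{T}}(\cdot)\otimes_{\mathbb{C}[t_1,t_2]}\mathbb{C}(t_1,t_2)$. $X^{[n]}$ is the Hilbert scheme of $n$ points on $X$ and $\mathbb{H}_X'=\bigoplus_{n\ge0}H^*_{\mathbb{T}}(X^{[n]})'$. The $\mathbb{T}$-fixed points of $X^{[n]}$ are $\xi_\lambda$, $\lambda=(\lambda_1\ge\cdots\ge\lambda_k>0)\vdash n$, with ideal $I_{\xi_\lambda}=\langle u^{\lambda_1},u^{\lambda_2}v,\ldots,u^{\lambda_k}v^{k-1},v^k\rangle$. The classes $[\xi_\lambda]$ (push-forwards of $1_{\xi_\lambda}$)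 form a $\mathbb{C}(t_1,t_2)$-basis of $\mathbb{H}_X'$. For a cell $\square$ of the Young diagram $D_\lambda$ (rows of lengths $\lambda_1,\lambda_2,\ldots$ from north to south), the arm colength $a'(\square)$ and leg colength $\ell'(\square)$ are the numbers of cells of $D_\lambda$ strictly to the west, respectively strictly to the north, of $\square$. For $k\ge0$ the $k$-th equivariant Chern character operator $\mathfrak{G}_k(t_1,t_2)\in\mathrm{End}(\mathbb{H}_X')$ is defined by $$\mathfrak{G}_k(t_1,t_2)[\xi_\lambda]=\mathrm{ch}_k^{\mathbb{T}}(\mathcal{O}_X^{[|\lambda|]})\cup[\xi_\lambda]=\sum_{\square\in D_\lambda}\frac{(-1)^k}{k!}\big(a'(\square)t_1+\ell'(\square)t_2\big)^k[\xi_\lambda],$$ where $\mathcal{O}_X^{[n]}$ is the tautological rank-$n$ bundle on $X^{[n]}$, and $\mathfrak{G}_k(t_1,t_2)=0$ on $H^*_{\mathbb{T}}(X^{[0]})'$. Fock space. $\mathfrak{F}$ is freely generated over $\mathbb{C}$ by commuting creation operators $\mathfrak{a}_{-k}$ ($k>0$) acting on the vacuum $|0\rangle$; the annihilation operators $\mathfrak{a}_k$ ($k>0$) satisfy $\mathfrak{a}_k|0\rangle=0$ and $[\mathfrak{a}_k,\mathfrak{a}_\ell]=k\,\delta_{k,-\ell}\,\mathrm{Id}$. $\mathbb{H}_X'$ is identified with $\mathfrak{F}\otimes_{\mathbb{C}}\mathbb{C}(t_1,t_2)$ by the linear isomorphism sending, for each partition $\lambda=(1^{m_1}2^{m_2}\cdots)$,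 the element $\frac{1}{\prod_i m_i!}\prod_i\mathfrak{a}_{-\lambda_i}|0\rangle$ to the equivariant class of the closed subvariety of $X^{[|\lambda|]}$ whose generic elements are unions of closed subschemes of lengths $\lambda_1,\ldots,\lambda_{\ell(\lambda)}$ supported at $\ell(\lambda)$ distinct points of $X$. $\mathfrak{F}$ is also identified with the ring $\Lambda_{\mathbb{C}}$ of symmetric functions via $\prod_i\mathfrak{a}_{-\lambda_i}|0\rangle\leftrightarrow p_\lambda$ (power sums). Under these identifications $[\xi_\lambda]$ corresponds to $t_2^{|\lambda|}t_1^{\ell(\cdot)}J_\lambda^{(\alpha)}|_{\alpha=-t_1/t_2}$, where $J_\lambda^{(\alpha)}$ is the integral form of the Jack symmetric function (Macdonald's normalization) and $t_1^{\ell(\cdot)}p_\mu=t_1^{\ell(\mu)}p_\mu$. Generalized partitions. A generalized partition $\lambda=(\cdots(-2)^{m_{-2}}(-1)^{m_{-1}}1^{m_1}2^{m_2}\cdots)$ has part $i\in\mathbb{Z}\setminus\{0\}$ with multiplicity $m_i\ge0$, only finitely many nonzero; $\ell(\lambda)=\sum_im_i$, $|\lambda|=\sum_iim_i$, $\lambda^+=(1^{m_1}2^{m_2}\cdots)$, $\lambda^-=(\cdots(-2)^{m_{-2}}(-1)^{m_{-1}})$, $\delta(\lambda)=\ell(\lambda^-)-\ell(\lambda^+)$. $\mathfrak{a}_\lambda=\cdots\mathfrak{a}_{-2}^{m_{-2}}\mathfrak{a}_{-1}^{m_{-1}}\mathfrak{a}_1^{m_1}\mathfrak{a}_2^{m_2}\cdots$.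 The operation $t_1^{\delta(\cdot)}$ is extended linearly to (infinite) linear combinations of the $\mathfrak{a}_\lambda$. Vertex operators. $$V(z;q,t,\tilde q,\tilde t)=\exp\Big(\sum_{k\ge1}(q^k-\tilde q^k)\tfrac{z^k}{k}\mathfrak{a}_{-k}\Big)\exp\Big(\sum_{k\ge1}(\tilde t^k-t^k)\tfrac{z^{-k}}{k}\mathfrak{a}_k\Big),$$ $V_0$ denotes its coefficient of $z^0$, and $$\overline{\mathfrak{B}}(q,t^{-1})=\frac{1}{(1-q)(1-t^{-1})}\big(1-V_0(z;t,t^{-1},1,qt^{-1})\big).$$ Putting $q=e^{\alpha t_0}$ ($\alpha$ a formal parameter) and $t=e^{t_0}$, $\overline{\mathfrak{B}}_k^{(\alpha)}$ is the coefficient of $t_0^k$ in $\overline{\mathfrak{B}}(q,t^{-1})$. *)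

theory Defs
  imports
    "HOL-Library.Multiset"
    "HOL-Library.Poly_Mapping"
    "HOL-Computational_Algebra.Computational_Algebra"
begin

section \<open>The field of rational functions in two variables\<close>

instance fract :: ("{idom, ring_char_0}") field_char_0
proof
  show "inj (of_nat :: nat \<Rightarrow> 'a fract)"
  proof (rule injI)
    fix m n :: nat
    assume "(of_nat m :: 'a fract) = of_nat n"
    then show "m = n"
      by (simp add: of_nat_fract eq_fract)
  qed
qed

type_synonym ratfun = "complex poly poly fract"

definition t1 :: ratfun where "t1 = Fract [:[:0, 1:]:] 1"
definition t2 :: ratfun where "t2 = Fract [:0, 1:] 1"


section \<open>Partitions\<close>

typedef posnat = "{k::nat. 0 < k}"
  morphisms nat_of_pos pos_of_nat
  by auto

type_synonym partition = "posnat multiset"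

definition parts :: "partition \<Rightarrow> nat list" where
  "parts lam = rev (sorted_list_of_multiset (image_mset nat_of_pos lam))"

definition weight :: "partition \<Rightarrow> nat" where
  "weight lam = sum_list (parts lam)"

definition dominates :: "partition \<Rightarrow> partition \<Rightarrow> bool" where
  "dominates lam mu \<longleftrightarrow> weight mu = weight lam \<and>
     (\<forall>i. sum_list (take i (parts mu)) \<le> sum_list (take i (parts lam)))"

text \<open>The cell \<open>(i, j)\<close> lies in row \<open>i\<close> (counted from the north) and column \<open>j\<close>
  (counted from the west), both starting at 0.\<close>

definition diagram :: "partition \<Rightarrow> (nat \<times> nat) set" where
  "diagram lam = {(i, j). i < length (parts lam) \<and> j < parts lam ! i}"

definition arm :: "partition \<Rightarrow> nat \<times> nat \<Rightarrow> nat" where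
  "arm lam s = card {(i, j) \<in> diagram lam. i = fst s \<and> snd s < j}"

definition leg :: "partition \<Rightarrow> nat \<times> nat \<Rightarrow> nat" where
  "leg lam s = card {(i, j) \<in> diagram lam. j = snd s \<and> fst s < i}"

definition coarm :: "partition \<Rightarrow> nat \<times> nat \<Rightarrow> nat" where
  "coarm lam s = card {(i, j) \<in> diagram lam. i = fst s \<and> j < snd s}"

definition coleg :: "partition \<Rightarrow> nat \<times> nat \<Rightarrow> nat" where
  "coleg lam s = card {(i, j) \<in> diagram lam. j = snd s \<and> i < fst s}"


section \<open>Formal power series in infinitely many commuting variables\<close>

text \<open>A monomial in variables indexed by \<open>'v\<close> is a multiset over \<open>'v\<close>; a formal power
  series is the family of its coefficients.\<close>

type_synonym ('v, 'r) mseries = "'v multiset \<Rightarrow> 'r"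

definition mseries_one :: "('v, 'r::zero_neq_one) mseries" where
  "mseries_one M = (if M = {#} then 1 else 0)"

definition mseries_mult ::
  "('v, 'r::comm_semiring_1) mseries \<Rightarrow> ('v, 'r) mseries \<Rightarrow> ('v, 'r) mseries" where
  "mseries_mult f g M = (\<Sum>(A, B) | A + B = M. f A * g B)"

primrec mseries_power ::
  "('v, 'r::comm_semiring_1) mseries \<Rightarrow> nat \<Rightarrow> ('v, 'r) mseries" where
  "mseries_power f 0 = mseries_one"
| "mseries_power f (Suc n) = mseries_mult f (mseries_power f n)"

text \<open>Exponential of a series without constant term: \<open>f ^ n\<close> then has no monomials of
  degree less than \<open>n\<close>, so the exponential series is finite at each monomial.\<close>

definition mseries_exp :: "('v, 'r::field) mseries \<Rightarrow> ('v, 'r) mseries" where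
  "mseries_exp f M = (\<Sum>n\<le>size M. mseries_power f n M / of_nat (fact n))"

text \<open>The linear series with coefficient \<open>c i\<close> at the variable \<open>i\<close>.\<close>

definition mseries_linear :: "('v \<Rightarrow> 'r::comm_monoid_add) \<Rightarrow> ('v, 'r) mseries" where
  "mseries_linear c M = (\<Sum>i | M = {#i#}. c i)"


section \<open>Fock space and symmetric functions\<close>

text \<open>The Fock space with coefficients in \<open>'a\<close> is the polynomial ring in the creation
  operators; the monomial \<open>Poly_Mapping.single lam 1\<close> is at the same time the vector
  obtained by applying the creation operators of the parts of \<open>lam\<close> to the vacuum and the
  power sum symmetric function of \<open>lam\<close>. The vacuum is \<open>1\<close>.\<close>

type_synonym 'a fock = "partition \<Rightarrow>\<^sub>0 'a"

definition scale :: "'a::comm_ring_1 \<Rightarrow> 'a fock \<Rightarrow> 'a fock" where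
  "scale c v = Poly_Mapping.single {#} c * v"

definition creation :: "posnat \<Rightarrow> 'a::comm_ring_1 fock \<Rightarrow> 'a fock" where
  "creation k v = Poly_Mapping.single {#k#} 1 * v"

text \<open>Annihilation by \<open>k\<close> is \<open>k\<close> times the derivative in the variable \<open>k\<close>.\<close>

definition annihilation :: "posnat \<Rightarrow> 'a::comm_ring_1 fock \<Rightarrow> 'a fock" where
  "annihilation k v =
     (\<Sum>mu\<in>Poly_Mapping.keys v. Poly_Mapping.single (mu - {#k#})
        (of_nat (nat_of_pos k * count mu k) * Poly_Mapping.lookup v mu))"

text \<open>The Heisenberg operators; the value at \<open>0\<close> is a dummy.\<close>

definition heisenberg :: "int \<Rightarrow> 'a::comm_ring_1 fock \<Rightarrow> 'a fock" where
  "heisenberg i v =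
     (if i < 0 then creation (pos_of_nat (nat (- i))) v
      else if i > 0 then annihilation (pos_of_nat (nat i)) v
      else 0)"

lemma lookup_creation:
  "Poly_Mapping.lookup (creation k v) mu =
     (if k \<in># mu then Poly_Mapping.lookup v (mu - {#k#}) else 0)"
proof -
  have "Poly_Mapping.lookup (creation k v) mu =
      (\<Sum>q. Poly_Mapping.lookup v q when mu = {#k#} + q)"
    by (simp add: creation_def lookup_mult lookup_single when_mult Sum_any_left_distrib
      Sum_any_when_equal cong: Sum_any.cong)
  also have "\<dots> = (if k \<in># mu then Poly_Mapping.lookup v (mu - {#k#}) else 0)"
  proof (cases "k \<in># mu")
    case True
    then have "(mu = {#k#} + q) = (q = mu - {#k#})" for q
      by auto
    then show ?thesis using True by simp
  next
    case False
    then have "(mu = {#k#} + q) = False" for q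
      by auto
    then show ?thesis using False by simp
  qed
  finally show ?thesis .
qed

lemma lookup_annihilation:
  "Poly_Mapping.lookup (annihilation k v) mu =
     of_nat (nat_of_pos k * Suc (count mu k)) * Poly_Mapping.lookup v (add_mset k mu)"
proof -
  have eq: "(of_nat (nat_of_pos k * count nu k) * Poly_Mapping.lookup v nu when nu - {#k#} = mu) =
      (if nu = add_mset k mu
       then of_nat (nat_of_pos k * Suc (count mu k)) * Poly_Mapping.lookup v (add_mset k mu)
       else 0)" for nu
  proof (cases "k \<in># nu")
    case True
    then obtain rho where "nu = add_mset k rho"
      by (meson mset_add)
    then show ?thesis by (auto simp: when_def)
  next
    case False
    then show ?thesis by (auto simp: when_def not_in_iff)
  qed
  have "Poly_Mapping.lookup (annihilation k v) mu = (\<Sum>nu\<in>Poly_Mapping.keys v.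
      (of_nat (nat_of_pos k * count nu k) * Poly_Mapping.lookup v nu when nu - {#k#} = mu))"
    by (simp add: annihilation_def lookup_sum lookup_single)
  also have "\<dots> = of_nat (nat_of_pos k * Suc (count mu k)) * Poly_Mapping.lookup v (add_mset k mu)"
    unfolding eq by (simp add: sum.delta in_keys_iff)
  finally show ?thesis .
qed

lemma heisenberg_vacuum: "i > 0 \<Longrightarrow> heisenberg i 1 = 0"
  by (rule poly_mapping_eqI) (simp add: heisenberg_def lookup_annihilation lookup_one when_def)

lemma lookup_scale: "Poly_Mapping.lookup (scale c v) mu = c * Poly_Mapping.lookup v mu"
  by (simp add: scale_def lookup_mult lookup_single when_mult Sum_any_left_distrib
    Sum_any_when_equal mult_when cong: Sum_any.cong)

lemma creation_commute: "creation k (creation l v) = creation l (creation k v)"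
  by (simp add: creation_def mult.left_commute)

lemma annihilation_commute: "annihilation k (annihilation l v) = annihilation l (annihilation k v)"
  by (rule poly_mapping_eqI)
    (cases "k = l", auto simp: lookup_annihilation add_mset_commute mult_ac)

lemma annihilation_creation:
  "annihilation k (creation l v) - creation l (annihilation k v) =
     (if k = l then scale (of_nat (nat_of_pos k)) v else 0)"
proof (rule poly_mapping_eqI)
  fix mu
  show "Poly_Mapping.lookup (annihilation k (creation l v) - creation l (annihilation k v)) mu =
    Poly_Mapping.lookup (if k = l then scale (of_nat (nat_of_pos k)) v else 0) mu"
  proof (cases "l \<in># mu")
    case True
    then obtain nu where "mu = add_mset l nu"
      by (meson mset_add)
    then show ?thesis
      by (auto simp: lookup_minus lookup_annihilation lookup_creation lookup_scale algebra_simps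
        add_mset_commute)
  next
    case False
    then have "count mu l = 0"
      by (simp add: count_eq_zero_iff)
    with False show ?thesis
      by (auto simp: lookup_minus lookup_annihilation lookup_creation lookup_scale)
  qed
qed

lemma heisenberg_commutator:
  assumes "i \<noteq> 0" "j \<noteq> 0"
  shows "heisenberg i (heisenberg j v) - heisenberg j (heisenberg i v) =
    (if i = - j then scale (of_int i) v else 0)"
proof -
  have inj: "pos_of_nat (nat a) = pos_of_nat (nat b) \<longleftrightarrow> a = b" if "a > 0" "b > 0" for a b :: int
    using that by (subst pos_of_nat_inject) auto
  have nat_of: "nat_of_pos (pos_of_nat (nat a)) = nat a" if "a > 0" for a :: int
    using that by (subst pos_of_nat_inverse) auto
  have neg: "scale (- c) v = - scale c v" for c
    by (simp add: scale_def single_uminus)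
  consider "i < 0" "j < 0" | "i > 0" "j > 0" | "i > 0" "j < 0" | "i < 0" "j > 0"
    using assms by linarith
  then show ?thesis
  proof cases
    case 1
    then show ?thesis by (auto simp: heisenberg_def creation_commute)
  next
    case 2
    then show ?thesis by (auto simp: heisenberg_def annihilation_commute)
  next
    case 3
    then show ?thesis
      using annihilation_creation[of "pos_of_nat (nat i)" "pos_of_nat (nat (- j))" v]
      by (auto simp: heisenberg_def inj nat_of split: if_splits)
  next
    case 4
    have "heisenberg i (heisenberg j v) - heisenberg j (heisenberg i v) =
        - (annihilation (pos_of_nat (nat j)) (creation (pos_of_nat (nat (- i))) v) -
           creation (pos_of_nat (nat (- i))) (annihilation (pos_of_nat (nat j)) v))"
      using 4 by (simp add: heisenberg_def)
    also have "\<dots> = (if i = - j then scale (of_int i) v else 0)"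
      unfolding annihilation_creation using 4 by (auto simp: inj nat_of neg)
    finally show ?thesis .
  qed
qed

text \<open>\<open>z_lam\<close> is the order of the centraliser of a permutation of cycle type \<open>lam\<close>.\<close>

definition z_partition :: "partition \<Rightarrow> nat" where
  "z_partition lam = (\<Prod>i\<in>set_mset lam. nat_of_pos i ^ count lam i * fact (count lam i))"

definition jack_inner :: "'a::field_char_0 \<Rightarrow> 'a fock \<Rightarrow> 'a fock \<Rightarrow> 'a" where
  "jack_inner \<alpha> v w = (\<Sum>mu\<in>Poly_Mapping.keys v.
     Poly_Mapping.lookup v mu * Poly_Mapping.lookup w mu * of_nat (z_partition mu) * \<alpha> ^ size mu)"

text \<open>Expansion in variables \<open>x_0, x_1, \<dots>\<close>: the power sum \<open>p_k\<close> is the sum of all \<open>x_i ^ k\<close>,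
  and the monomial symmetric function of \<open>lam\<close> is the sum of all monomials whose nonzero
  exponents are the parts of \<open>lam\<close>.\<close>

definition power_sum :: "nat \<Rightarrow> (nat, 'a::comm_semiring_1) mseries" where
  "power_sum k M = (if \<exists>i. M = replicate_mset k i then 1 else 0)"

definition power_sum_partition :: "partition \<Rightarrow> (nat, 'a::comm_semiring_1) mseries" where
  "power_sum_partition lam = foldr mseries_mult (map power_sum (parts lam)) mseries_one"

definition monomial_sym :: "partition \<Rightarrow> (nat, 'a::comm_semiring_1) mseries" where
  "monomial_sym lam M =
     (if image_mset (count M) (mset_set (set_mset M)) = image_mset nat_of_pos lam then 1 else 0)"

definition expand :: "'a::comm_ring_1 fock \<Rightarrow> (nat, 'a) mseries" where
  "expand v M = (\<Sum>mu\<in>Poly_Mapping.keys v. Poly_Mapping.lookup v mu * power_sum_partition mu M)"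


section \<open>Jack symmetric functions\<close>

text \<open>Macdonald's characterisation of the family of monic Jack functions: unitriangular in
  the monomial symmetric functions for the dominance order, and pairwise orthogonal.\<close>

definition is_jack_P :: "'a::field_char_0 \<Rightarrow> (partition \<Rightarrow> 'a fock) \<Rightarrow> bool" where
  "is_jack_P \<alpha> P \<longleftrightarrow>
     (\<forall>lam. \<exists>u. \<forall>M. expand (P lam) M =
        monomial_sym lam M + (\<Sum>mu | dominates lam mu \<and> mu \<noteq> lam. u mu * monomial_sym mu M)) \<and>
     (\<forall>lam mu. lam \<noteq> mu \<longrightarrow> jack_inner \<alpha> (P lam) (P mu) = 0)"

text \<open>Macdonald's integral form: the coefficient of the product of \<open>n\<close> distinct variables is
  \<open>n!\<close>, where \<open>n\<close> is the weight.\<close>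

definition jack_J ::
  "'a::field_char_0 \<Rightarrow> (partition \<Rightarrow> 'a fock) \<Rightarrow> partition \<Rightarrow> 'a fock" where
  "jack_J \<alpha> P lam =
     scale (\<Prod>s\<in>diagram lam. \<alpha> * of_nat (arm lam s) + of_nat (leg lam s) + 1) (P lam)"


section \<open>Generalized partitions and formal combinations of Heisenberg monomials\<close>

text \<open>A generalized partition is a multiset of nonzero integers. Multisets containing \<open>0\<close> are
  not excluded by the type, but all series below vanish on them.

  A formal (infinite) linear combination of the normally ordered monomials indexed by the
  generalized partitions is the family of its coefficients. For a series in creation operators
  only and a series in annihilation operators only, in this order, \<^const>\<open>mseries_mult\<close> is
  the product of operators.\<close>

type_synonym 'r opseries = "(int, 'r) mseries"

definition genpart_pos :: "int multiset \<Rightarrow> int multiset" where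
  "genpart_pos lam = filter_mset (\<lambda>i. i > 0) lam"

definition genpart_neg :: "int multiset \<Rightarrow> int multiset" where
  "genpart_neg lam = filter_mset (\<lambda>i. i < 0) lam"

definition genpart_delta :: "int multiset \<Rightarrow> int" where
  "genpart_delta lam = int (size (genpart_neg lam)) - int (size (genpart_pos lam))"

text \<open>The monomial operator of a generalized partition: indices increase from left to right,
  so annihilation operators act first.\<close>

definition heisenberg_monomial :: "int multiset \<Rightarrow> 'a::comm_ring_1 fock \<Rightarrow> 'a fock" where
  "heisenberg_monomial lam v = foldr heisenberg (sorted_list_of_multiset lam) v"

text \<open>The operator given by a formal combination. The sum has finitely many nonzero terms
  if the coefficients vanish unless the entries of the generalized partition sum to \<open>0\<close>, as
  is the case for the coefficient of \<open>z\<close> to the power \<open>0\<close> of a vertex operator.\<close>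

definition op_of_series :: "'a::comm_ring_1 opseries \<Rightarrow> 'a fock \<Rightarrow> 'a fock" where
  "op_of_series c v = (\<Sum>lam | scale (c lam) (heisenberg_monomial lam v) \<noteq> 0.
     scale (c lam) (heisenberg_monomial lam v))"

definition scale_series :: "'a::comm_ring_1 \<Rightarrow> 'a opseries \<Rightarrow> 'a opseries" where
  "scale_series c f lam = c * f lam"

definition twist_delta :: "'a::field \<Rightarrow> 'a opseries \<Rightarrow> 'a opseries" where
  "twist_delta s f lam = s powi genpart_delta lam * f lam"


section \<open>Vertex operators\<close>

text \<open>The coefficients are Laurent series in \<open>z\<close> over the field \<open>'b\<close>.\<close>

definition vertex_creation :: "'b::field \<Rightarrow> 'b \<Rightarrow> 'b fls opseries" where
  "vertex_creation q q' = mseries_exp (mseries_linear (\<lambda>i.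
     if i < 0 then let k = nat (- i) in
       fls_const ((q ^ k - q' ^ k) / of_nat k) * fls_X_intpow (int k)
     else 0))"

definition vertex_annihilation :: "'b::field \<Rightarrow> 'b \<Rightarrow> 'b fls opseries" where
  "vertex_annihilation t t' = mseries_exp (mseries_linear (\<lambda>i.
     if i > 0 then let k = nat i in
       fls_const ((t' ^ k - t ^ k) / of_nat k) * fls_X_intpow (- int k)
     else 0))"

definition vertex :: "'b::field \<Rightarrow> 'b \<Rightarrow> 'b \<Rightarrow> 'b \<Rightarrow> 'b fls opseries" where
  "vertex q t q' t' = mseries_mult (vertex_creation q q') (vertex_annihilation t t')"

definition vertex0 :: "'b::field \<Rightarrow> 'b \<Rightarrow> 'b \<Rightarrow> 'b \<Rightarrow> 'b opseries" where
  "vertex0 q t q' t' lam = fls_nth (vertex q t q' t' lam) 0"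

text \<open>\<open>Bbar q t\<close> is the operator of the pair \<open>(q, 1 / t)\<close>.\<close>

definition Bbar :: "'b::field \<Rightarrow> 'b \<Rightarrow> 'b opseries" where
  "Bbar q t lam =
     1 / ((1 - q) * (1 - inverse t)) * (mseries_one lam - vertex0 t (inverse t) 1 (q * inverse t) lam)"

text \<open>Here \<open>q = exp (\<alpha> X)\<close> and \<open>t = exp X\<close> in the field of Laurent series in \<open>X\<close>. The
  coefficients of \<open>Bbar q t\<close> are power series in \<open>X\<close> whose coefficients are polynomials in
  \<open>\<alpha>\<close>, so the nonzero element \<open>\<alpha>\<close> may be inserted from the start.\<close>

definition Bbar_coeff :: "nat \<Rightarrow> 'a::field_char_0 \<Rightarrow> 'a opseries" where
  "Bbar_coeff k \<alpha> lam =
     fls_nth (Bbar (fps_to_fls (fps_exp \<alpha>)) (fps_to_fls (fps_exp 1)) lam) (int k)"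


section \<open>Localized equivariant cohomology of the Hilbert schemes\<close>

text \<open>The direct sum over \<open>n\<close> of the localized equivariant cohomology spaces of the Hilbert
  schemes of \<open>n\<close> points, in coordinates: \<open>Poly_Mapping.single lam 1\<close> is the class of the
  fixed point indexed by \<open>lam\<close>.\<close>

type_synonym hilb = "partition \<Rightarrow>\<^sub>0 ratfun"

definition chern_eigenvalue :: "nat \<Rightarrow> partition \<Rightarrow> ratfun" where
  "chern_eigenvalue k lam = (\<Sum>s\<in>diagram lam.
     (- 1) ^ k / fact k * (of_nat (coarm lam s) * t1 + of_nat (coleg lam s) * t2) ^ k)"

definition chern_operator :: "nat \<Rightarrow> hilb \<Rightarrow> hilb" where
  "chern_operator k x = (\<Sum>lam\<in>Poly_Mapping.keys x.
     Poly_Mapping.single lam (chern_eigenvalue k lam * Poly_Mapping.lookup x lam))"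

definition twist_length :: "'a::comm_ring_1 \<Rightarrow> 'a fock \<Rightarrow> 'a fock" where
  "twist_length s v = (\<Sum>mu\<in>Poly_Mapping.keys v.
     Poly_Mapping.single mu (s ^ size mu * Poly_Mapping.lookup v mu))"

text \<open>The identification with the Fock space sends the class of the fixed point \<open>lam\<close> to
  \<open>fixed_point_class P lam\<close>, where \<open>P\<close> is the family of monic Jack functions for the
  parameter \<open>- t1 / t2\<close>.\<close>

definition fixed_point_class :: "(partition \<Rightarrow> ratfun fock) \<Rightarrow> partition \<Rightarrow> ratfun fock" where
  "fixed_point_class P lam =
     scale (t2 ^ weight lam) (twist_length t1 (jack_J (- t1 / t2) P lam))"

definition hilb_to_fock :: "(partition \<Rightarrow> ratfun fock) \<Rightarrow> hilb \<Rightarrow> ratfun fock" where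
  "hilb_to_fock P x = (\<Sum>lam\<in>Poly_Mapping.keys x.
     scale (Poly_Mapping.lookup x lam) (fixed_point_class P lam))"

end

theory Submission
  imports Defs
begin

text \<open>
  The classes of the fixed points are, up to nonzero scalars and the rescaling of each creation
  operator by \<open>t1\<close>, the Jack functions for \<open>\<alpha> = - t1 / t2\<close>, and the rescaling turns
  \<^const>\<open>twist_delta\<close> of a series into the series itself. So the theorem says that the \<open>k\<close>-th
  coefficient of \<^const>\<open>Bbar\<close>, for \<open>k \<le> 2\<close>, multiplies the Jack function of a partition by
  the sum of \<open>c ^ k / k!\<close> over the contents \<open>c = \<alpha> a' - l'\<close> of its cells.

  The proof compares these coefficients, called \<open>B0\<close>, \<open>B1\<close>, \<open>B2\<close> below, with a family of
  operators whose eigenvalues on Jack functions are computable. Single out one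
  variable \<open>x\<close>. The Heckman operator \<open>Y\<close> of \<open>x\<close> is \<open>\<alpha> x \<partial>/\<partial>x\<close> plus the sum of
  \<open>x / (x - x') (1 - s)\<close> over the other variables \<open>x'\<close>, where \<open>s\<close> exchanges \<open>x\<close> and \<open>x'\<close>, suitably
  normalized for infinitely many variables. For symmetric \<open>f\<close>, the sum over all variables
  \<open>x\<close> of \<open>Y ^ j (x \<partial>f/\<partial>x)\<close> is again symmetric; call it \<open>H j f\<close>.

    \<^item> A function that is symmetric in the variables other than \<open>x\<close> is a sum of terms \<open>x ^ n * g n\<close> with
      symmetric \<open>g n\<close>. On the sequence of the \<open>g n\<close> the operator \<open>Y\<close> becomes a matrix with
      Heisenberg operators as entries, the Lax matrix (lemma \<open>mark_lax\<close>). Hence \<open>H j\<close> is a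
      polynomial in Heisenberg operators.
    \<^item> The Lax matrix is symmetric for the Jack scalar product, so \<open>H j\<close> is self-adjoint
      (lemma \<open>jack_inner_ham\<close>).
    \<^item> In the exponents of two variables, \<open>Y\<close> never increases the sum of squares, and modulo
      terms with a smaller sum of squares a monomial goes to a combination of its permutations. So \<open>H j\<close> is triangular on
      monomial symmetric functions, with explicit diagonal (lemma \<open>expand_ham_top\<close>). A triangular
      self-adjoint operator has the Jack functions as eigenvectors (lemma \<open>ham_jack\<close>).

  Expanding the vertex operator to order four in \<open>X\<close> and normally ordering \<open>H 1\<close> and \<open>H 2\<close> gives
  (lemmas \<open>op_Bbar_0\<close>, \<open>op_Bbar_1\<close>, \<open>op_Bbar_2\<close>)

    \<^item> \<open>B0 = H 0\<close>,
    \<^item> \<open>2 B1 = H 1 - (\<alpha> - 1) H 0\<close>,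
    \<^item> \<open>6 B2 = H 2 + \<alpha>/2 (H 0)^2 - 3/2 (\<alpha> - 1) H 1 + (\<alpha>^2 - 3 \<alpha> + 1)/2 H 0\<close>,

  and the same combinations of the diagonal entries are the power sums of the contents
  (lemmas \<open>content_sum_1\<close>, \<open>content_sum_2\<close>).
\<close>

section \<open>Linear algebra on the Fock space\<close>

lemma nat_of_pos_gt_0 [simp]: "0 < nat_of_pos k"
  using nat_of_pos[of k] by simp

lemma nat_of_pos_neq_0 [simp]: "nat_of_pos k \<noteq> 0"
  using nat_of_pos_gt_0[of k] by linarith

lemma nat_of_pos_of_nat [simp]: "n > 0 \<Longrightarrow> nat_of_pos (pos_of_nat n) = n"
  by (simp add: pos_of_nat_inverse)

lemma weight_eq_sum: "weight lam = (\<Sum>k\<in>#lam. nat_of_pos k)"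
proof -
  have "sum_list (rev xs) = sum_mset (mset xs)" for xs :: "nat list"
    by (metis mset_rev sum_mset_sum_list)
  then show ?thesis by (simp add: weight_def parts_def)
qed

lemma weight_add_mset [simp]: "weight (add_mset k lam) = nat_of_pos k + weight lam"
  by (simp add: weight_eq_sum)

lemma weight_empty [simp]: "weight {#} = 0"
  by (simp add: weight_eq_sum)

lemma scale_add_right: "scale c (v + w) = scale c v + scale c w"
  by (simp add: scale_def algebra_simps)

lemma scale_add_left: "scale (c + d) v = scale c v + scale d v"
  by (simp add: scale_def single_add algebra_simps)

lemma scale_scale: "scale c (scale d v) = scale (c * d) v"
  by (rule poly_mapping_eqI) (simp add: lookup_scale mult.assoc)

lemma scale_one [simp]: "scale 1 v = v"
  by (rule poly_mapping_eqI) (simp add: lookup_scale)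

lemma scale_zero_left [simp]: "scale 0 v = 0"
  by (rule poly_mapping_eqI) (simp add: lookup_scale)

lemma scale_zero_right [simp]: "scale c 0 = 0"
  by (rule poly_mapping_eqI) (simp add: lookup_scale)

lemma scale_sum: "scale c (sum f A) = (\<Sum>x\<in>A. scale c (f x))"
  by (simp add: scale_def sum_distrib_left)

lemma scale_eq_0_iff: "scale c v = 0 \<longleftrightarrow> c = 0 \<or> v = 0" for c :: "'a::field"
  by (metis lookup_scale lookup_zero mult_eq_0_iff poly_mapping_eqI scale_zero_left scale_zero_right)

text \<open>The power sum products span; the basis for proving linear statements from their values on
  monomials.\<close>

lemma fock_eq_sum: "v = (\<Sum>mu\<in>Poly_Mapping.keys v. scale (Poly_Mapping.lookup v mu) (Poly_Mapping.single mu 1))"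
  for v :: "'a::comm_ring_1 fock"
proof (rule poly_mapping_eqI)
  fix nu
  have "(\<Sum>mu\<in>Poly_Mapping.keys v. Poly_Mapping.lookup v mu * (1 when mu = nu)) =
     (\<Sum>mu\<in>Poly_Mapping.keys v. if mu = nu then Poly_Mapping.lookup v nu else 0)"
    by (intro sum.cong) (auto simp: when_def)
  also have "\<dots> = Poly_Mapping.lookup v nu"
    by (simp add: in_keys_iff)
  finally show "Poly_Mapping.lookup v nu = Poly_Mapping.lookup (\<Sum>mu\<in>Poly_Mapping.keys v. scale (Poly_Mapping.lookup v mu) (Poly_Mapping.single mu 1)) nu"
    by (simp add: lookup_sum lookup_scale lookup_single)
qed

text \<open>Creation and annihilation operators indexed by natural numbers; only positive indices are
  meaningful. In terms of power sums, \<open>cr n\<close> is multiplication by \<open>p_n\<close> and \<open>an n\<close> is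
  \<open>n \<partial>/\<partial>p_n\<close>.\<close>

definition cr :: "nat \<Rightarrow> 'a::comm_ring_1 fock \<Rightarrow> 'a fock" where
  "cr n = creation (pos_of_nat n)"

definition an :: "nat \<Rightarrow> 'a::comm_ring_1 fock \<Rightarrow> 'a fock" where
  "an n = annihilation (pos_of_nat n)"

lemma cr_add: "cr n (v + w) = cr n v + cr n w"
  by (simp add: cr_def creation_def algebra_simps)

lemma cr_zero [simp]: "cr n 0 = 0"
  by (simp add: cr_def creation_def)

lemma cr_sum: "cr n (sum f A) = (\<Sum>x\<in>A. cr n (f x))"
  by (simp add: cr_def creation_def sum_distrib_left)

lemma cr_scale: "cr n (scale c v) = scale c (cr n v)"
  by (simp add: cr_def creation_def scale_def mult.left_commute)

lemma an_add: "an n (v + w) = an n v + an n w"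
  by (rule poly_mapping_eqI) (simp add: an_def lookup_annihilation lookup_add algebra_simps)

lemma an_zero [simp]: "an n 0 = 0"
  by (rule poly_mapping_eqI) (simp add: an_def lookup_annihilation)

lemma an_sum: "an n (sum f A) = (\<Sum>x\<in>A. an n (f x))"
proof (cases "finite A")
  case True then show ?thesis by (induction A) (simp_all add: an_add)
qed simp

lemma an_scale: "an n (scale c v) = scale c (an n v)"
  by (rule poly_mapping_eqI) (simp add: an_def lookup_annihilation lookup_scale algebra_simps)

lemma cr_commute: "cr m (cr n v) = cr n (cr m v)"
  by (simp add: cr_def creation_commute)

lemma an_commute: "an m (an n v) = an n (an m v)"
  by (simp add: an_def annihilation_commute)

lemma an_cr:
  assumes "m > 0" "n > 0"
  shows "an m (cr n v) = cr n (an m v) + (if m = n then scale (of_nat m) v else 0)"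
proof -
  have "pos_of_nat m = pos_of_nat n \<longleftrightarrow> m = n"
    using assms by (subst pos_of_nat_inject) auto
  with annihilation_creation[of "pos_of_nat m" "pos_of_nat n" v] assms show ?thesis
    by (auto simp: an_def cr_def algebra_simps split: if_splits)
qed

lemma keys_cr: "Poly_Mapping.keys (cr n v) \<subseteq> add_mset (pos_of_nat n) ` Poly_Mapping.keys v"
proof
  fix mu assume "mu \<in> Poly_Mapping.keys (cr n v)"
  then have "pos_of_nat n \<in># mu" "mu - {#pos_of_nat n#} \<in> Poly_Mapping.keys v"
    by (auto simp: in_keys_iff cr_def lookup_creation split: if_splits)
  then show "mu \<in> add_mset (pos_of_nat n) ` Poly_Mapping.keys v"
    by (metis image_eqI insert_DiffM)
qed

lemma creation_eq_cr: "creation k = cr (nat_of_pos k)"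
  by (simp add: cr_def nat_of_pos_inverse)

lemma single_eq_creation:
  "Poly_Mapping.single (add_mset k mu) 1 = (creation k (Poly_Mapping.single mu 1) :: 'a::comm_ring_1 fock)"
  by (simp add: creation_def mult_single)

text \<open>Every linear statement about vectors of the Fock space can be proved by starting at
  the vacuum and applying creation operators.\<close>

lemma fock_induct [case_names vacuum cr add scale]:
  fixes v :: "'a::comm_ring_1 fock"
  assumes "Pr 1"
    and "\<And>n v. n > 0 \<Longrightarrow> Pr v \<Longrightarrow> Pr (cr n v)"
    and "\<And>v w. Pr v \<Longrightarrow> Pr w \<Longrightarrow> Pr (v + w)"
    and "\<And>c v. Pr v \<Longrightarrow> Pr (scale c v)"
  shows "Pr v"
proof -
  have mono: "Pr (Poly_Mapping.single mu 1)" for mu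
  proof (induction mu)
    case empty
    show ?case using assms(1) by (metis single_one)
  next
    case (add k mu)
    have "Pr (cr (nat_of_pos k) (Poly_Mapping.single mu 1))"
      by (rule assms(2)[OF nat_of_pos_gt_0 add])
    then show ?case by (simp only: single_eq_creation creation_eq_cr)
  qed
  have zero: "Pr 0"
    using assms(4)[OF assms(1), of 0] by simp
  have "Pr (\<Sum>mu\<in>A. scale (f mu) (Poly_Mapping.single mu 1))" if "finite A" for A and f :: "partition \<Rightarrow> 'a"
    using that by induction (auto intro: assms(3,4) mono zero)
  from this[of "Poly_Mapping.keys v" "Poly_Mapping.lookup v"] show ?thesis
    using fock_eq_sum[of v] by simp
qed

text \<open>The degree filtration. The bound is an integer, so that lowering operators of any
  index fit the same rule.\<close>

definition deg_le :: "int \<Rightarrow> 'a::comm_ring_1 fock \<Rightarrow> bool" where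
  "deg_le d v \<longleftrightarrow> (\<forall>mu. Poly_Mapping.lookup v mu \<noteq> 0 \<longrightarrow> int (weight mu) \<le> d)"

lemma deg_le_neg: "deg_le d v \<Longrightarrow> d < 0 \<Longrightarrow> v = 0"
  by (rule poly_mapping_eqI) (force simp: deg_le_def)

lemma deg_le_mono: "deg_le d v \<Longrightarrow> d \<le> e \<Longrightarrow> deg_le e v"
  by (force simp: deg_le_def)

lemma deg_le_zero [simp]: "deg_le d 0"
  by (simp add: deg_le_def)

lemma deg_le_add: "deg_le d v \<Longrightarrow> deg_le d w \<Longrightarrow> deg_le d (v + w)"
  unfolding deg_le_def lookup_add by (metis add_0)

lemma deg_le_scale: "deg_le d v \<Longrightarrow> deg_le d (scale c v)"
  unfolding deg_le_def lookup_scale by (metis mult_zero_right)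

lemma deg_le_sum: "(\<And>x. x \<in> A \<Longrightarrow> deg_le d (f x)) \<Longrightarrow> deg_le d (sum f A)"
  by (induction A rule: infinite_finite_induct) (simp_all add: deg_le_add)

lemma deg_le_cr: "n > 0 \<Longrightarrow> deg_le d v \<Longrightarrow> deg_le (d + int n) (cr n v)"
  unfolding deg_le_def cr_def lookup_creation
proof (intro allI impI)
  fix mu
  assume n: "n > 0" and d: "\<forall>mu. Poly_Mapping.lookup v mu \<noteq> 0 \<longrightarrow> int (weight mu) \<le> d"
    and nz: "(if pos_of_nat n \<in># mu then Poly_Mapping.lookup v (mu - {#pos_of_nat n#}) else 0) \<noteq> 0"
  from nz obtain nu where mu: "mu = add_mset (pos_of_nat n) nu"
    by (metis mset_add)
  from nz mu d have "int (weight nu) \<le> d" by simp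
  with n mu show "int (weight mu) \<le> d + int n" by simp
qed

lemma deg_le_an: "n > 0 \<Longrightarrow> deg_le d v \<Longrightarrow> deg_le (d - int n) (an n v)"
  unfolding deg_le_def an_def lookup_annihilation
proof (intro allI impI)
  fix mu
  assume n: "n > 0" and d: "\<forall>mu. Poly_Mapping.lookup v mu \<noteq> 0 \<longrightarrow> int (weight mu) \<le> d"
    and nz: "of_nat (nat_of_pos (pos_of_nat n) * Suc (count mu (pos_of_nat n))) *
      Poly_Mapping.lookup v (add_mset (pos_of_nat n) mu) \<noteq> 0"
  from nz have "Poly_Mapping.lookup v (add_mset (pos_of_nat n) mu) \<noteq> 0"
    by (metis mult_zero_right)
  with d have "int (weight (add_mset (pos_of_nat n) mu)) \<le> d" by blast
  with n show "int (weight mu) \<le> d - int n" by simp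
qed

lemma deg_le_exists: "\<exists>d::nat. deg_le (int d) v"
proof -
  have "Poly_Mapping.lookup v mu \<noteq> 0 \<Longrightarrow> weight mu \<le> (\<Sum>mu\<in>Poly_Mapping.keys v. weight mu)" for mu
    by (intro member_le_sum) (auto simp: in_keys_iff)
  then show ?thesis by (auto simp: deg_le_def)
qed

section \<open>The Jack scalar product\<close>

lemma jack_inner_superset:
  assumes "finite S" "Poly_Mapping.keys v \<subseteq> S"
  shows "jack_inner \<alpha> v w = (\<Sum>mu\<in>S. Poly_Mapping.lookup v mu * Poly_Mapping.lookup w mu
     * of_nat (z_partition mu) * \<alpha> ^ size mu)"
  unfolding jack_inner_def
  by (rule sum.mono_neutral_left) (use assms in \<open>auto simp: in_keys_iff\<close>)

lemma jack_inner_add_left: "jack_inner \<alpha> (v + v') w = jack_inner \<alpha> v w + jack_inner \<alpha> v' w"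
proof -
  let ?S = "Poly_Mapping.keys v \<union> Poly_Mapping.keys v'"
  have "Poly_Mapping.keys (v + v') \<subseteq> ?S" by (rule keys_add)
  then show ?thesis
    by (simp add: jack_inner_superset[of ?S] lookup_add sum.distrib algebra_simps)
qed

lemma jack_inner_scale_left: "jack_inner \<alpha> (scale c v) w = c * jack_inner \<alpha> v w"
proof -
  have "Poly_Mapping.keys (scale c v) \<subseteq> Poly_Mapping.keys v"
    by (auto simp: in_keys_iff lookup_scale)
  then show ?thesis
    by (simp add: jack_inner_superset[of "Poly_Mapping.keys v"] lookup_scale sum_distrib_left algebra_simps)
qed

lemma jack_inner_sym: "jack_inner \<alpha> v w = jack_inner \<alpha> w v"
proof -
  let ?S = "Poly_Mapping.keys v \<union> Poly_Mapping.keys w"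
  show ?thesis
    by (simp add: jack_inner_superset[of ?S] mult.commute)
qed

lemma jack_inner_add_right: "jack_inner \<alpha> w (v + v') = jack_inner \<alpha> w v + jack_inner \<alpha> w v'"
  by (metis jack_inner_add_left jack_inner_sym)

lemma jack_inner_scale_right: "jack_inner \<alpha> w (scale c v) = c * jack_inner \<alpha> w v"
  by (metis jack_inner_scale_left jack_inner_sym)

lemma jack_inner_zero_left [simp]: "jack_inner \<alpha> 0 w = 0"
  by (simp add: jack_inner_def)

lemma jack_inner_zero_right [simp]: "jack_inner \<alpha> w 0 = 0"
  by (simp add: jack_inner_def)

lemma jack_inner_sum_left: "jack_inner \<alpha> (sum f A) w = (\<Sum>x\<in>A. jack_inner \<alpha> (f x) w)"
  by (induction A rule: infinite_finite_induct) (simp_all add: jack_inner_add_left)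

lemma jack_inner_sum_right: "jack_inner \<alpha> w (sum f A) = (\<Sum>x\<in>A. jack_inner \<alpha> w (f x))"
  by (induction A rule: infinite_finite_induct) (simp_all add: jack_inner_add_right)

text \<open>The product of the factorials of the multiplicities occurs twice below: in the norm of
  a power sum product, and in the coefficients of the exponential of a linear series.\<close>

definition multi_fact :: "'v multiset \<Rightarrow> nat" where
  "multi_fact M = (\<Prod>i\<in>set_mset M. fact (count M i))"

lemma multi_fact_add_mset: "multi_fact (add_mset k M) = Suc (count M k) * multi_fact M"
proof -
  let ?f = "\<lambda>L i. fact (count L i) :: nat"
  have z: "multi_fact L = (\<Prod>i\<in>insert k (set_mset M). ?f L i)"
    if "set_mset L \<subseteq> insert k (set_mset M)" for L
    unfolding multi_fact_def
    by (rule prod.mono_neutral_left) (use that in \<open>auto simp: not_in_iff\<close>)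
  have "multi_fact (add_mset k M) = ?f (add_mset k M) k * (\<Prod>i\<in>set_mset M - {k}. ?f (add_mset k M) i)"
    by (subst z, simp, subst prod.insert_remove) auto
  also have "(\<Prod>i\<in>set_mset M - {k}. ?f (add_mset k M) i) = (\<Prod>i\<in>set_mset M - {k}. ?f M i)"
    by (intro prod.cong) auto
  also have "?f (add_mset k M) k = Suc (count M k) * ?f M k"
    by simp
  finally have "multi_fact (add_mset k M) = Suc (count M k) *
    (?f M k * (\<Prod>i\<in>set_mset M - {k}. ?f M i))"
    by (simp only: mult.assoc)
  also have "?f M k * (\<Prod>i\<in>set_mset M - {k}. ?f M i) = multi_fact M"
    by (subst z, blast, subst prod.insert_remove) auto
  finally show ?thesis .
qed

lemma multi_fact_nonzero [simp]: "multi_fact M \<noteq> 0"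
  by (simp add: multi_fact_def)

lemma z_partition_multi_fact: "z_partition mu = (\<Prod>i\<in>#mu. nat_of_pos i) * multi_fact mu"
  by (simp add: z_partition_def multi_fact_def prod.distrib image_prod_mset_multiplicity)

lemma z_partition_add_mset:
  "z_partition (add_mset k mu) = nat_of_pos k * Suc (count mu k) * z_partition mu"
  by (simp only: z_partition_multi_fact multi_fact_add_mset image_mset_add_mset prod_mset.add_mset mult_ac)

text \<open>The adjoint of multiplication by \<open>p_n\<close> is \<open>\<alpha> n \<partial> / \<partial> p_n\<close>.\<close>

lemma jack_inner_cr:
  assumes "n > 0"
  shows "jack_inner \<alpha> (cr n v) w = \<alpha> * jack_inner \<alpha> v (an n w)"
proof -
  let ?k = "pos_of_nat n"
  let ?S = "add_mset ?k ` Poly_Mapping.keys v"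
  have "jack_inner \<alpha> (cr n v) w = (\<Sum>mu\<in>Poly_Mapping.keys v. Poly_Mapping.lookup (cr n v) (add_mset ?k mu)
      * Poly_Mapping.lookup w (add_mset ?k mu) * of_nat (z_partition (add_mset ?k mu)) * \<alpha> ^ size (add_mset ?k mu))"
    by (subst jack_inner_superset[of ?S]) (simp_all add: sum.reindex inj_on_def keys_cr)
  also have "\<dots> = \<alpha> * jack_inner \<alpha> v (an n w)"
    unfolding jack_inner_def sum_distrib_left
    by (intro sum.cong) (use assms in \<open>auto simp: cr_def lookup_creation an_def lookup_annihilation
      z_partition_add_mset algebra_simps\<close>)
  finally show ?thesis .
qed

lemma z_partition_pos: "z_partition mu > 0"
  by (simp add: z_partition_def prod_pos)

text \<open>Over the complex rational functions there are nonzero vectors orthogonal to themselves, so an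
  orthogonality argument has to test against all vectors. Power sum products suffice because they form an
  orthogonal basis of vectors with nonzero norms.\<close>

lemma jack_inner_nondegenerate:
  fixes v :: "'a::field_char_0 fock"
  assumes "\<alpha> \<noteq> 0" "\<And>w. jack_inner \<alpha> v w = 0"
  shows "v = 0"
proof (rule poly_mapping_eqI)
  fix mu
  have "jack_inner \<alpha> (Poly_Mapping.single mu 1) v = 0"
    using assms(2) jack_inner_sym by metis
  then show "Poly_Mapping.lookup v mu = Poly_Mapping.lookup 0 mu"
    using z_partition_pos[of mu] assms(1) by (simp add: jack_inner_def)
qed

section \<open>Expansion of symmetric functions in the variables\<close>

text \<open>\<open>shift D f\<close> is the product of \<open>f\<close> with the monomial \<open>D\<close>, in terms of coefficients.\<close>

definition shift :: "nat multiset \<Rightarrow> (nat, 'a::zero) mseries \<Rightarrow> (nat, 'a) mseries" where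
  "shift D f M = (if D \<subseteq># M then f (M - D) else 0)"

lemma shift_shift: "shift D (shift E f) = shift (D + E) f"
proof
  fix M
  show "shift D (shift E f) M = shift (D + E) f M"
    unfolding shift_def
    by (auto simp: subset_mset.le_diff_conv2 add.commute diff_diff_eq
        dest: mset_subset_eq_add_left[THEN subset_mset.order_trans] mset_subset_eq_add_right[THEN subset_mset.order_trans])
qed

lemma shift_sum: "shift D (\<lambda>M. \<Sum>x\<in>A. f x M) M = (\<Sum>x\<in>A. shift D (f x) M)"
  for f :: "_ \<Rightarrow> (nat, 'a::comm_monoid_add) mseries"
  by (simp add: shift_def)

lemma shift_replicate: "shift (replicate_mset k j) f M = (if k \<le> count M j then f (M - replicate_mset k j) else 0)"
  by (simp add: shift_def count_le_replicate_mset_subset_eq)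

lemma shift_eq_0: "k > 0 \<Longrightarrow> j \<notin># M \<Longrightarrow> shift (replicate_mset k j) f M = 0"
  by (simp add: shift_replicate not_in_iff)

lemma finite_submultisets: "finite {A. A \<subseteq># (M :: 'v multiset)}"
proof (rule finite_subset)
  show "{A. A \<subseteq># M} \<subseteq> mset ` {xs. set xs \<subseteq> set_mset M \<and> length xs \<le> size M}"
  proof
    fix A assume A: "A \<in> {A. A \<subseteq># M}"
    obtain xs where xs: "A = mset xs" by (metis ex_mset)
    have "set xs \<subseteq> set_mset M" "length xs \<le> size M"
      using A set_mset_mono[of A M] size_mset_mono[of A M] by (auto simp: xs)
    with xs show "A \<in> mset ` {xs. set xs \<subseteq> set_mset M \<and> length xs \<le> size M}" by blast
  qed
qed (simp add: finite_lists_length_le)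

lemma finite_sum_pairs: "finite {(A, B). A + B = (M :: 'v multiset)}"
proof -
  have "{(A, B). A + B = M} \<subseteq> {A. A \<subseteq># M} \<times> {A. A \<subseteq># M}"
    by auto
  then show ?thesis
    by (rule finite_subset) (simp add: finite_submultisets)
qed

text \<open>The finite set \<open>S\<close> of variables may be larger than the support of \<open>M\<close>, so that the same range of
  summation can be used for several monomials at once.\<close>

lemma mseries_mult_power_sum:
  fixes f :: "(nat, 'a::comm_semiring_1) mseries"
  assumes "k > 0" "finite S" "set_mset M \<subseteq> S"
  shows "mseries_mult (power_sum k) f M = (\<Sum>j\<in>S. shift (replicate_mset k j) f M)"
proof -
  let ?J = "{j \<in> S. k \<le> count M j}"
  let ?h = "\<lambda>j. (replicate_mset k j, M - replicate_mset k j)"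
  have inj: "inj_on ?h ?J"
    using assms(1) by (auto simp: inj_on_def dest!: arg_cong[of _ _ set_mset] split: if_splits)
  have "mseries_mult (power_sum k) f M =
      (\<Sum>(A, B)\<in>?h ` ?J. (power_sum k A :: 'a) * f B)"
    unfolding mseries_mult_def
  proof (rule sum.mono_neutral_right)
    show "?h ` ?J \<subseteq> {(A, B). A + B = M}"
      by (auto simp: count_le_replicate_mset_subset_eq)
    show "\<forall>p\<in>{(A, B). A + B = M} - ?h ` ?J. (case p of (A, B) \<Rightarrow> (power_sum k A :: 'a) * f B) = 0"
    proof (rule ballI, rule ccontr)
      fix p assume p: "p \<in> {(A, B). A + B = M} - ?h ` ?J"
        and nz: "(case p of (A, B) \<Rightarrow> (power_sum k A :: 'a) * f B) \<noteq> 0"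
      obtain A B where AB: "p = (A, B)" by (cases p)
      with p have M: "M = A + B" and n: "(A, B) \<notin> ?h ` ?J" by auto
      from nz AB obtain j where j: "A = replicate_mset k j"
        by (auto simp: power_sum_def split: if_splits)
      have "j \<in> S"
        using assms(1,3) M j by (auto split: if_splits)
      then have "j \<in> ?J" "(A, B) = ?h j"
        using j M by auto
      then have "(A, B) \<in> ?h ` ?J" by (rule rev_image_eqI)
      with n show False by contradiction
    qed
  qed (rule finite_sum_pairs)
  also have "\<dots> = (\<Sum>j\<in>?J. (power_sum k (replicate_mset k j) :: 'a) * f (M - replicate_mset k j))"
    by (subst sum.reindex[OF inj]) simp
  also have "\<dots> = (\<Sum>j\<in>?J. f (M - replicate_mset k j))"
    by (intro sum.cong) (auto simp: power_sum_def)
  also have "\<dots> = (\<Sum>j\<in>S. shift (replicate_mset k j) f M)"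
    by (rule sum.mono_neutral_cong_left) (use assms in \<open>auto simp: shift_replicate\<close>)
  finally show ?thesis .
qed

lemma set_mset_minus_subset: "set_mset (M - D) \<subseteq> set_mset M"
  by (meson in_diffD subsetI)

lemma mseries_mult_power_sum_twice:
  fixes f :: "(nat, 'a::comm_semiring_1) mseries"
  assumes "k > 0" "l > 0"
  shows "mseries_mult (power_sum k) (mseries_mult (power_sum l) f) M =
    (\<Sum>j\<in>set_mset M. \<Sum>i\<in>set_mset M. shift (replicate_mset k j + replicate_mset l i) f M)"
proof -
  have "shift (replicate_mset k j) (mseries_mult (power_sum l) f) M =
      (\<Sum>i\<in>set_mset M. shift (replicate_mset k j + replicate_mset l i) f M)" for j
  proof -
    have "mseries_mult (power_sum l) f (M - D) = (\<Sum>i\<in>set_mset M. shift (replicate_mset l i) f (M - D))" for D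
      by (rule mseries_mult_power_sum[OF assms(2) finite_set_mset set_mset_minus_subset])
    then have "shift (replicate_mset k j) (mseries_mult (power_sum l) f) M =
        (\<Sum>i\<in>set_mset M. shift (replicate_mset k j) (shift (replicate_mset l i) f) M)"
      by (simp add: shift_def)
    then show ?thesis by (simp add: shift_shift)
  qed
  then show ?thesis
    by (simp add: mseries_mult_power_sum[OF assms(1) finite_set_mset order_refl])
qed

lemma mseries_mult_power_sum_commute:
  fixes f :: "(nat, 'a::comm_semiring_1) mseries"
  assumes "k > 0" "l > 0"
  shows "mseries_mult (power_sum k) (mseries_mult (power_sum l) f) =
    mseries_mult (power_sum l) (mseries_mult (power_sum k) f)"
proof
  fix M
  show "mseries_mult (power_sum k) (mseries_mult (power_sum l) f) M =
    mseries_mult (power_sum l) (mseries_mult (power_sum k) f) M"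
    unfolding mseries_mult_power_sum_twice[OF assms] mseries_mult_power_sum_twice[OF assms(2,1)]
    by (subst sum.swap) (simp add: add.commute)
qed

lemma mset_parts: "mset (parts lam) = image_mset nat_of_pos lam"
  by (simp add: parts_def)

lemma parts_pos: "x \<in> set (parts lam) \<Longrightarrow> x > 0"
  by (auto simp: parts_def)

text \<open>The parts are multiplied in decreasing order, and a new part may have to be inserted
  anywhere; commutativity lets it be moved to the front.\<close>

lemma power_sum_partition_add_mset:
  "power_sum_partition (add_mset k mu) =
    (mseries_mult (power_sum (nat_of_pos k)) (power_sum_partition mu) :: (nat, 'a::comm_semiring_1) mseries)"
proof -
  let ?F = "\<lambda>n. mseries_mult (power_sum n) :: (nat, 'a) mseries \<Rightarrow> _"
  have psp: "power_sum_partition lam = fold ?F (rev (parts lam)) mseries_one" for lam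
    by (simp add: power_sum_partition_def foldr_conv_fold rev_map fold_map comp_def)
  have "fold ?F (rev (parts (add_mset k mu))) = fold ?F (rev (parts mu) @ [nat_of_pos k])"
  proof (rule fold_multiset_equiv)
    fix m n
    assume "m \<in> set (rev (parts (add_mset k mu)))" "n \<in> set (rev (parts (add_mset k mu)))"
    then have "m > 0" "n > 0" by (auto dest: parts_pos)
    then show "?F m \<circ> ?F n = ?F n \<circ> ?F m"
      by (intro ext) (simp add: mseries_mult_power_sum_commute del: ext)
  qed (simp add: mset_parts)
  then show ?thesis by (simp add: psp)
qed

lemma power_sum_partition_empty: "power_sum_partition {#} = mseries_one"
  by (simp add: power_sum_partition_def parts_def)

lemma expand_superset:
  assumes "finite S" "Poly_Mapping.keys v \<subseteq> S"
  shows "expand v M = (\<Sum>mu\<in>S. Poly_Mapping.lookup v mu * power_sum_partition mu M)"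
  unfolding expand_def
  by (rule sum.mono_neutral_left) (use assms in \<open>auto simp: in_keys_iff\<close>)

lemma expand_add: "expand (v + w) M = expand v M + expand w M"
proof -
  let ?S = "Poly_Mapping.keys v \<union> Poly_Mapping.keys w"
  have "Poly_Mapping.keys (v + w) \<subseteq> ?S" by (rule keys_add)
  then show ?thesis
    by (simp add: expand_superset[of ?S] lookup_add sum.distrib algebra_simps)
qed

lemma expand_scale: "expand (scale c v) M = c * expand v M"
proof -
  have "Poly_Mapping.keys (scale c v) \<subseteq> Poly_Mapping.keys v"
    by (auto simp: in_keys_iff lookup_scale)
  then show ?thesis
    by (simp add: expand_superset[of "Poly_Mapping.keys v"] lookup_scale sum_distrib_left algebra_simps)
qed

lemma expand_zero [simp]: "expand 0 M = 0"
  by (simp add: expand_def)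

lemma expand_diff: "expand (v - w) M = expand v M - expand w M"
  using expand_add[of "v - w" w M] by simp

lemma expand_sum: "expand (sum f A) M = (\<Sum>x\<in>A. expand (f x) M)"
  by (induction A rule: infinite_finite_induct) (simp_all add: expand_add)

lemma expand_vacuum: "expand 1 = (mseries_one :: (nat, 'a::comm_ring_1) mseries)"
proof
  fix M
  have "Poly_Mapping.keys (1 :: 'a fock) \<subseteq> {{#}}"
    by (auto simp: in_keys_iff lookup_one when_def split: if_splits)
  then show "expand 1 M = (mseries_one M :: 'a)"
    by (subst expand_superset[of "{{#}}"]) (auto simp: lookup_one power_sum_partition_empty)
qed

text \<open>Multiplication by \<open>p_n\<close>, the sum of the \<open>n\<close>-th powers of the variables.\<close>

lemma expand_cr:
  fixes v :: "'a::comm_ring_1 fock"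
  assumes "n > 0" "finite S" "set_mset M \<subseteq> S"
  shows "expand (cr n v) M = (\<Sum>j\<in>S. shift (replicate_mset n j) (expand v) M)"
proof -
  let ?k = "pos_of_nat n"
  let ?S = "add_mset ?k ` Poly_Mapping.keys v"
  have "expand (cr n v) M = (\<Sum>mu\<in>Poly_Mapping.keys v. Poly_Mapping.lookup (cr n v) (add_mset ?k mu)
      * power_sum_partition (add_mset ?k mu) M)"
    by (subst expand_superset[of ?S]) (simp_all add: sum.reindex inj_on_def keys_cr)
  also have "\<dots> = (\<Sum>mu\<in>Poly_Mapping.keys v. \<Sum>j\<in>S. Poly_Mapping.lookup v mu * shift (replicate_mset n j) (power_sum_partition mu) M)"
    using assms by (simp add: power_sum_partition_add_mset cr_def lookup_creation mseries_mult_power_sum[OF assms] sum_distrib_left)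
  also have "\<dots> = (\<Sum>j\<in>S. \<Sum>mu\<in>Poly_Mapping.keys v. Poly_Mapping.lookup v mu * shift (replicate_mset n j) (power_sum_partition mu) M)"
    by (rule sum.swap)
  also have "\<dots> = (\<Sum>j\<in>S. shift (replicate_mset n j) (expand v) M)"
    by (intro sum.cong) (auto simp: shift_def expand_def)
  finally show ?thesis .
qed

text \<open>In each variable \<open>x\<close> the Euler operator is \<open>x \<partial>/\<partial>x = \<Sum>k. x^k k \<partial>/\<partial>p_k\<close>, since
  \<open>x \<partial>p_k/\<partial>x = k x^k\<close>.\<close>

lemma expand_euler:
  fixes v :: "'a::comm_ring_1 fock"
  assumes "count M i \<le> c"
  shows "of_nat (count M i) * expand v M = (\<Sum>k=1..c. shift (replicate_mset k i) (expand (an k v)) M)"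
  using assms
proof (induction v arbitrary: M c rule: fock_induct)
  case vacuum
  have "an k (1 :: 'a fock) = 0" for k
    by (rule poly_mapping_eqI) (simp add: an_def lookup_annihilation lookup_one when_def)
  then show ?case
    by (auto simp: expand_vacuum mseries_one_def shift_def)
next
  case (add v w)
  from add.IH(1)[OF add.prems] add.IH(2)[OF add.prems] show ?case
    by (simp add: expand_add an_add shift_def algebra_simps sum.distrib[symmetric] cong: if_cong)
      (intro sum.cong, auto)
next
  case (scale r v)
  from scale.IH[OF scale.prems] show ?case
    by (simp add: expand_scale an_scale shift_def mult.left_commute[of _ r] sum_distrib_left if_distrib cong: if_cong)
next
  case (cr n v)
  let ?r = "replicate_mset"
  have IH: "of_nat (count N i) * expand v N = (\<Sum>k=1..c. shift (?r k i) (expand (an k v)) N)"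
    if "N \<subseteq># M" for N
    using cr.IH[of N c] cr.prems that by (meson mset_subset_eq_count order_trans)
  have "of_nat (count M i) * expand (cr n v) M = (\<Sum>j\<in>set_mset M. of_nat (count M i) * shift (?r n j) (expand v) M)"
    by (simp add: expand_cr[OF cr(1) finite_set_mset order_refl] sum_distrib_left)
  also have "\<dots> = (\<Sum>j\<in>set_mset M. (\<Sum>k=1..c. shift (?r n j) (shift (?r k i) (expand (an k v))) M) +
     (if j = i then of_nat n * shift (?r n i) (expand v) M else 0))"
  proof (rule sum.cong[OF refl])
    fix j
    show "of_nat (count M i) * shift (?r n j) (expand v) M =
      (\<Sum>k=1..c. shift (?r n j) (shift (?r k i) (expand (an k v))) M) +
      (if j = i then of_nat n * shift (?r n i) (expand v) M else 0)"
    proof (cases "?r n j \<subseteq># M")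
      case False
      then show ?thesis by (auto simp: shift_def)
    next
      case True
      have cnt: "count M i = count (M - ?r n j) i + (if j = i then n else 0)"
        using True by (auto simp: count_le_replicate_mset_subset_eq)
      have "of_nat (count M i) * expand v (M - ?r n j) =
        of_nat (count (M - ?r n j) i) * expand v (M - ?r n j) +
        (if j = i then of_nat n * expand v (M - ?r n j) else 0)"
        by (subst cnt) (simp add: algebra_simps)
      also have "of_nat (count (M - ?r n j) i) * expand v (M - ?r n j) =
        (\<Sum>k=1..c. shift (?r k i) (expand (an k v)) (M - ?r n j))"
        by (rule IH) simp
      finally show ?thesis using True by (auto simp: shift_def[of "?r n _"])
    qed
  qed
  also have "\<dots> = (\<Sum>k=1..c. \<Sum>j\<in>set_mset M. shift (?r n j + ?r k i) (expand (an k v)) M) +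
     of_nat n * shift (?r n i) (expand v) M"
  proof -
    have "(\<Sum>j\<in>set_mset M. if j = i then of_nat n * shift (?r n i) (expand v) M else 0) =
      of_nat n * shift (?r n i) (expand v) M"
      using shift_eq_0[OF cr(1), of i M "expand v"] by (auto simp: sum.delta)
    then show ?thesis
      by (subst sum.distrib, subst sum.swap) (simp add: shift_shift)
  qed
  also have "of_nat n * shift (?r n i) (expand v) M =
     (\<Sum>k=1..c. if k = n then of_nat n * shift (?r n i) (expand v) M else 0)"
    using cr(1) cr.prems by (auto simp: sum.delta shift_replicate)
  also have "(\<Sum>k=1..c. \<Sum>j\<in>set_mset M. shift (?r n j + ?r k i) (expand (an k v)) M) + \<dots> =
     (\<Sum>k=1..c. shift (?r k i) (expand (an k (cr n v))) M)"
    unfolding sum.distrib[symmetric]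
  proof (rule sum.cong[OF refl])
    fix k assume k: "k \<in> {1..c}"
    have "expand (cr n (an k v)) (M - D) = (\<Sum>j\<in>set_mset M. shift (?r n j) (expand (an k v)) (M - D))" for D
      by (rule expand_cr[OF cr(1) finite_set_mset set_mset_minus_subset])
    then have "shift (?r k i) (expand (cr n (an k v))) M =
        (\<Sum>j\<in>set_mset M. shift (?r k i) (shift (?r n j) (expand (an k v))) M)"
      by (simp add: shift_def)
    then have "shift (?r k i) (expand (cr n (an k v))) M = (\<Sum>j\<in>set_mset M. shift (?r n j + ?r k i) (expand (an k v)) M)"
      by (simp add: shift_shift add.commute)
    with k cr(1) show "(\<Sum>j\<in>set_mset M. shift (?r n j + ?r k i) (expand (an k v)) M) +
       (if k = n then of_nat n * shift (?r n i) (expand v) M else 0) =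
       shift (?r k i) (expand (an k (cr n v))) M"
      by (auto simp: an_cr shift_def expand_add expand_scale)
  qed
  finally show ?case .
qed

section \<open>Shapes of monomials\<close>

text \<open>The exponents of a monomial without the variables that carry them: the partition of the
  monomial symmetric function to which it belongs.\<close>

definition shape :: "nat multiset \<Rightarrow> nat multiset" where
  "shape M = image_mset (count M) (mset_set (set_mset M))"

lemma shape_empty [simp]: "shape {#} = {#}"
  by (simp add: shape_def)

lemma shape_add_replicate:
  assumes "i \<notin># R"
  shows "shape (R + replicate_mset a i) = (if a = 0 then shape R else add_mset a (shape R))"
proof (cases "a = 0")
  case False
  have "image_mset (count (R + replicate_mset a i)) (mset_set (set_mset R)) = shape R"
    unfolding shape_def by (intro image_mset_cong) (use assms in auto)
  moreover have "count R i = 0" using assms by (simp add: not_in_iff)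
  then have "shape (R + replicate_mset a i) =
    add_mset a (image_mset (count (R + replicate_mset a i)) (mset_set (set_mset R)))"
    unfolding shape_def using False assms by simp
  ultimately show ?thesis
    using False by simp
qed simp

lemma size_shape: "size (shape M) = card (set_mset M)"
  by (simp add: shape_def)

lemma sum_shape: "(\<Sum>x\<in>#shape M. f x) = (\<Sum>i\<in>set_mset M. f (count M i))"
  by (simp add: shape_def sum_unfold_sum_mset image_mset.compositionality comp_def)

lemma size_eq_sum_shape: "size M = \<Sum>\<^sub># (shape M)"
  using sum_shape[of "\<lambda>x. x" M] by (simp add: size_multiset_overloaded_eq)

lemma shape_pos: "0 \<notin># shape M"
  unfolding shape_def by (auto dest: count_eq_zero_iff[THEN iffD1])

lemma shape_eq_empty_iff [simp]: "shape M = {#} \<longleftrightarrow> M = {#}"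
  by (simp add: shape_def mset_set_empty_iff)

lemma shape_remove:
  assumes "j \<in># M" "k > 0" "k \<le> count M j"
  shows "shape (M - replicate_mset k j) =
    (shape M - {#count M j#}) + (if k < count M j then {#count M j - k#} else {#})"
proof -
  define R where "R = filter_mset (\<lambda>x. x \<noteq> j) M"
  have R: "j \<notin># R" by (simp add: R_def)
  have M: "M = R + replicate_mset (count M j) j"
    by (rule multiset_eqI) (simp add: R_def)
  have M': "M - replicate_mset k j = R + replicate_mset (count M j - k) j"
    by (rule multiset_eqI) (use assms in \<open>simp add: R_def\<close>)
  have "shape M = add_mset (count M j) (shape R)"
    using shape_add_replicate[OF R, of "count M j"] M assms by simp
  then show ?thesis
    unfolding M' shape_add_replicate[OF R] using assms by auto
qed

text \<open>Multiplication by \<open>p_n\<close> collects the coefficients at the monomials with one exponent lowered by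
  \<open>n\<close>, and the multiset of their shapes is determined by the shape alone.\<close>

lemma expand_shape_ex:
  fixes v :: "'a::comm_ring_1 fock"
  shows "\<exists>\<Phi>. \<forall>M. expand v M = \<Phi> (shape M)"
proof (induction v rule: fock_induct)
  case vacuum
  then show ?case
    by (intro exI[of _ "\<lambda>X. if X = {#} then 1 else 0"]) (simp add: expand_vacuum mseries_one_def)
next
  case (cr n v)
  then obtain \<Phi> where \<Phi>: "expand v M = \<Phi> (shape M)" for M by blast
  show ?case
  proof (intro exI allI)
    fix M
    let ?h = "\<lambda>X x. if n \<le> x then \<Phi> ((X - {#x#}) + (if n < x then {#x - n#} else {#})) else 0"
    have "expand (cr n v) M = (\<Sum>j\<in>set_mset M. ?h (shape M) (count M j))"
      unfolding expand_cr[OF cr(1) finite_set_mset order_refl]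
      by (intro sum.cong) (use cr(1) in \<open>auto simp: shift_replicate \<Phi> shape_remove\<close>)
    then show "expand (cr n v) M = (\<lambda>X. \<Sum>x\<in>#X. ?h X x) (shape M)"
      by (simp add: sum_shape)
  qed
next
  case (add v w)
  then obtain \<Phi> \<Psi> where "expand v M = \<Phi> (shape M)" "expand w M = \<Psi> (shape M)" for M by blast
  then show ?case by (intro exI[of _ "\<lambda>X. \<Phi> X + \<Psi> X"]) (simp add: expand_add)
next
  case (scale c v)
  then obtain \<Phi> where "expand v M = \<Phi> (shape M)" for M by blast
  then show ?case by (intro exI[of _ "\<lambda>X. c * \<Phi> X"]) (simp add: expand_scale)
qed

lemma expand_shape: "shape M = shape N \<Longrightarrow> expand v M = expand v N"
  using expand_shape_ex[of v] by metis

text \<open>Each factor of the product contributes a power of a single variable. If there are as many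
  variables as factors, then no two factors share one, and the exponents are the parts.\<close>

lemma power_sum_partition_nonzero:
  fixes M :: "nat multiset"
  assumes "power_sum_partition mu M \<noteq> (0 :: 'a::comm_semiring_1)"
  shows "card (set_mset M) \<le> size mu \<and> (card (set_mset M) = size mu \<longrightarrow> shape M = image_mset nat_of_pos mu)"
  using assms
proof (induction mu arbitrary: M)
  case empty
  then show ?case by (auto simp: power_sum_partition_empty mseries_one_def split: if_splits)
next
  case (add k mu)
  let ?n = "nat_of_pos k"
  from add.prems obtain j where j: "j \<in># M" "?n \<le> count M j"
      and nz: "power_sum_partition mu (M - replicate_mset ?n j) \<noteq> (0 :: 'a)"
    unfolding power_sum_partition_add_mset mseries_mult_power_sum[OF nat_of_pos_gt_0 finite_set_mset order_refl]
    by (rule sum.not_neutral_contains_not_neutral) (metis shift_replicate)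
  let ?N = "M - replicate_mset ?n j"
  have N: "shape ?N = (shape M - {#count M j#}) + (if ?n < count M j then {#count M j - ?n#} else {#})"
    by (rule shape_remove[OF j(1) _ j(2)]) simp
  have mem: "count M j \<in># shape M" using j by (auto simp: shape_def)
  then have sz: "size (shape M) = Suc (size (shape M - {#count M j#}))"
    by (simp add: size_Suc_Diff1)
  note IH = add.IH[OF nz]
  show ?case
  proof (cases "?n < count M j")
    case True
    then have "size (shape ?N) = size (shape M)" using N sz by simp
    with IH show ?thesis by (simp add: size_shape)
  next
    case False
    then have eq: "count M j = ?n" using j by simp
    have "size (shape M) = Suc (size (shape ?N))" using N sz False by simp
    moreover have "shape M = add_mset ?n (shape ?N)" using N eq mem by simp
    moreover from this have "card (set_mset M) = Suc (card (set_mset ?N))"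
      by (metis size_shape size_add_mset)
    ultimately show ?thesis
      using IH by auto
  qed
qed

text \<open>The coefficients are natural numbers, hence not cancelled in characteristic zero, and the factors can be matched with
  the variables when the shape is \<open>mu\<close>.\<close>

lemma power_sum_partition_leading:
  "\<exists>N. \<forall>M. power_sum_partition mu M = (of_nat (N M) :: 'a::comm_semiring_1) \<and>
     (shape M = image_mset nat_of_pos mu \<longrightarrow> N M > 0)"
proof (induction mu)
  case empty
  show ?case
    by (intro exI[of _ "\<lambda>M. if M = {#} then 1 else 0"]) (auto simp: power_sum_partition_empty mseries_one_def)
next
  case (add k mu)
  then obtain N where N: "power_sum_partition mu M = (of_nat (N M) :: 'a)"
    "shape M = image_mset nat_of_pos mu \<Longrightarrow> N M > 0" for M by blast
  let ?n = "nat_of_pos k"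
  let ?N = "\<lambda>M. \<Sum>j\<in>set_mset M. shift (replicate_mset ?n j) N M"
  show ?case
  proof (intro exI[of _ ?N] allI conjI impI)
    fix M
    show "power_sum_partition (add_mset k mu) M = (of_nat (?N M) :: 'a)"
      unfolding power_sum_partition_add_mset mseries_mult_power_sum[OF nat_of_pos_gt_0 finite_set_mset order_refl]
      by (auto simp: shift_def N intro!: sum.cong)
    assume sh: "shape M = image_mset nat_of_pos (add_mset k mu)"
    then have "?n \<in># shape M" by simp
    then obtain j where j: "j \<in># M" "count M j = ?n" by (auto simp: shape_def)
    have "shape (M - replicate_mset ?n j) = image_mset nat_of_pos mu"
      using shape_remove[OF j(1), of ?n] j(2) sh by simp
    then have "N (M - replicate_mset ?n j) > 0" by (rule N)
    then have "shift (replicate_mset ?n j) N M > 0"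
      using j by (simp add: shift_replicate)
    with j(1) show "?N M > 0"
      by (metis (no_types, lifting) finite_set_mset sum_eq_0_iff not_gr_zero)
  qed
qed

text \<open>One monomial of each shape: the \<open>i\<close>-th part is the exponent of the \<open>i\<close>-th variable.\<close>

definition monomial_of :: "partition \<Rightarrow> nat multiset" where
  "monomial_of lam = (\<Sum>i<length (parts lam). replicate_mset (parts lam ! i) i)"

lemma shape_sum_replicate:
  assumes "\<And>x. x \<in> set xs \<Longrightarrow> x > 0"
  shows "shape (\<Sum>i<length xs. replicate_mset (xs ! i) i) = mset xs"
  using assms
proof (induction xs rule: rev_induct)
  case (snoc x xs)
  let ?R = "\<Sum>i<length xs. replicate_mset (xs ! i) i"
  have eq: "(\<Sum>i<length (xs @ [x]). replicate_mset ((xs @ [x]) ! i) i) = ?R + replicate_mset x (length xs)"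
    by (simp add: nth_append)
  have "set_mset ?R \<subseteq> {..<length xs}"
    by (auto simp: set_mset_sum split: if_splits)
  then have "length xs \<notin># ?R" by auto
  moreover have "x > 0" "shape ?R = mset xs" using snoc by auto
  ultimately show ?case
    unfolding eq shape_add_replicate[OF \<open>length xs \<notin># ?R\<close>] by simp
qed simp

lemma shape_monomial_of: "shape (monomial_of lam) = image_mset nat_of_pos lam"
  unfolding monomial_of_def by (subst shape_sum_replicate) (auto dest: parts_pos simp: mset_parts)

lemma shape_eq_partition: "\<exists>lam. shape M = image_mset nat_of_pos lam"
proof
  show "shape M = image_mset nat_of_pos (image_mset pos_of_nat (shape M))"
    using shape_pos[of M] by (auto simp: multiset.map_comp intro!: multiset.map_ident_strong[symmetric])
      (metis nat_of_pos_of_nat gr0I)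
qed

lemma image_nat_of_pos_inject: "image_mset nat_of_pos lam = image_mset nat_of_pos mu \<longleftrightarrow> lam = mu"
proof -
  have "inj (image_mset nat_of_pos)"
    by (rule multiset.inj_map) (simp add: inj_def nat_of_pos_inject)
  then show ?thesis by (rule inj_eq)
qed

text \<open>Power sums are algebraically independent: among the products with the largest number
  of factors, each is the only one that contains the monomial of its own shape.\<close>

lemma expand_inject:
  fixes v :: "'a::field_char_0 fock"
  assumes "\<And>M. expand v M = 0"
  shows "v = 0"
proof (rule ccontr)
  assume "v \<noteq> 0"
  then have ne: "Poly_Mapping.keys v \<noteq> {}" by simp
  define m where "m = Max (size ` Poly_Mapping.keys v)"
  have "m \<in> size ` Poly_Mapping.keys v"
    unfolding m_def by (rule Max_in) (use ne in auto)
  then obtain mu where mu: "mu \<in> Poly_Mapping.keys v" "size mu = m" by auto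
  have le: "size nu \<le> size mu" if "nu \<in> Poly_Mapping.keys v" for nu
    using that mu(2) unfolding m_def by (metis Max_ge finite_imageI finite_keys image_eqI)
  let ?M = "monomial_of mu"
  have card: "card (set_mset ?M) = size mu"
    by (metis shape_monomial_of size_image_mset size_shape)
  have zero: "power_sum_partition nu ?M = (0 :: 'a)" if "nu \<in> Poly_Mapping.keys v" "nu \<noteq> mu" for nu
  proof (rule ccontr)
    assume nz: "power_sum_partition nu ?M \<noteq> (0 :: 'a)"
    from power_sum_partition_nonzero[OF nz] le[OF that(1)] card
    have "image_mset nat_of_pos nu = image_mset nat_of_pos mu"
      by (simp add: shape_monomial_of)
    with that(2) show False by (simp add: image_nat_of_pos_inject)
  qed
  have "expand v ?M = Poly_Mapping.lookup v mu * power_sum_partition mu ?M"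
    unfolding expand_def
    by (subst sum.remove[OF _ mu(1)]) (auto intro!: sum.neutral simp: zero)
  moreover have "power_sum_partition mu ?M \<noteq> (0 :: 'a)"
    using power_sum_partition_leading[of mu] shape_monomial_of[of mu]
    by (metis of_nat_eq_0_iff less_numeral_extra(3))
  ultimately show False using assms[of ?M] mu(1) by (simp add: in_keys_iff)
qed

section \<open>The Lax operator and the Heckman operators\<close>

text \<open>A sequence \<open>g\<close> with indices \<open>1, \<dots>, d\<close> stands for the sum of \<open>x ^ n * g n\<close>, where \<open>x\<close> is a marked
  variable. In the Lax matrix, differentiating \<open>g m\<close> in the marked variable
  raises the power of \<open>x\<close> by means of annihilation operators; the divided difference of \<open>x ^ m\<close> lowers it,
  multiplying by power sums. The truncation at \<open>d\<close> is harmless on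
  vectors of degree at most \<open>d\<close>, where the components beyond \<open>d\<close> vanish.\<close>

definition lax :: "'a::comm_ring_1 \<Rightarrow> nat \<Rightarrow> (nat \<Rightarrow> 'a fock) \<Rightarrow> nat \<Rightarrow> 'a fock" where
  "lax \<alpha> d g n = scale ((\<alpha> - 1) * of_nat n) (g n)
     + (\<Sum>m=1..d. \<Sum>k=1..d. if m + k = n then scale \<alpha> (an k (g m)) else 0)
     + (\<Sum>m=1..d. \<Sum>r=1..d. if m = n + r then cr r (g m) else 0)"

text \<open>Mark a variable by the Euler operator, apply the Lax matrix \<open>j\<close> times, and sum over the choices
  of the marked variable, which replaces \<open>x ^ n\<close> by \<open>p_n\<close>.\<close>

definition ham :: "'a::comm_ring_1 \<Rightarrow> nat \<Rightarrow> nat \<Rightarrow> 'a fock \<Rightarrow> 'a fock" where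
  "ham \<alpha> d j v = (\<Sum>n=1..d. cr n ((lax \<alpha> d ^^ j) (\<lambda>n. an n v) n))"

text \<open>The degree condition under which the truncation of the Lax matrix loses nothing; it holds for the Euler operator
  applied to a vector of degree at most \<open>d\<close>.\<close>

definition graded :: "nat \<Rightarrow> (nat \<Rightarrow> 'a::comm_ring_1 fock) \<Rightarrow> bool" where
  "graded d g \<longleftrightarrow> (\<forall>n>0. deg_le (int d - int n) (g n))"

lemma graded_an: "deg_le (int d) v \<Longrightarrow> graded d (\<lambda>n. an n v)"
  by (simp add: graded_def deg_le_an)

lemma graded_lax:
  assumes "graded d g"
  shows "graded d (lax \<alpha> d g)"
  unfolding graded_def
proof (intro allI impI)
  fix n :: nat assume n: "n > 0"
  have g: "deg_le (int d - int m) (g m)" if "m > 0" for m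
    using assms that by (simp add: graded_def)
  have "deg_le (int d - int n) (if m + k = n then scale \<alpha> (an k (g m)) else 0)" if "m \<in> {1..d}" "k \<in> {1..d}" for m k
    using deg_le_an[of k, OF _ g[of m]] that by (auto intro!: deg_le_scale simp: algebra_simps)
  moreover have "deg_le (int d - int n) (if m = n + r then cr r (g m) else 0)" if "m \<in> {1..d}" "r \<in> {1..d}" for m r
    using deg_le_cr[of r, OF _ g[of m]] that by (auto simp: algebra_simps)
  ultimately show "deg_le (int d - int n) (lax \<alpha> d g n)"
    unfolding lax_def by (intro deg_le_add deg_le_sum deg_le_scale g n)
qed

text \<open>The function that a sequence stands for when \<open>i\<close> is the marked variable.\<close>

definition mark :: "nat \<Rightarrow> (nat \<Rightarrow> 'a::comm_ring_1 fock) \<Rightarrow> nat \<Rightarrow> (nat, 'a) mseries" where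
  "mark d g i M = (\<Sum>m=1..d. shift (replicate_mset m i) (expand (g m)) M)"

definition set_exponents :: "nat multiset \<Rightarrow> nat \<Rightarrow> nat \<Rightarrow> nat \<Rightarrow> nat \<Rightarrow> nat multiset" where
  "set_exponents M i c j e = filter_mset (\<lambda>x. x \<noteq> i \<and> x \<noteq> j) M + replicate_mset c i + replicate_mset e j"

text \<open>The coefficient at the monomial \<open>M\<close> of the normalized Heckman operator of the variable \<open>i\<close>,
  for series all of whose monomials contain \<open>i\<close>. Write \<open>D\<close> for the operator
  \<open>x_i / (x_i - x_j) (1 - s)\<close> with \<open>s\<close> exchanging \<open>x_i\<close> and \<open>x_j\<close>. For \<open>c > e\<close> it sends \<open>x_i^c x_j^e\<close>
  to the sum of \<open>x_i^m x_j^(c + e - m)\<close> over \<open>e < m \<le> c\<close>, and it is antisymmetric in \<open>c\<close> and \<open>e\<close>.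
  Collecting the terms in which \<open>x_i\<close> has the exponent \<open>a\<close> and \<open>x_j\<close> the exponent \<open>b\<close> yields the inner sum, over
  \<open>c \<ge> max a (b + 1)\<close>. Subtracting one for each variable, including \<open>x_i\<close> itself, makes the sum over
  infinitely many \<open>j\<close> finite: \<open>D - 1\<close> contributes nothing when \<open>x_j\<close> does not occur in \<open>M\<close>.\<close>

definition heckman :: "'a::comm_ring_1 \<Rightarrow> nat \<Rightarrow> (nat, 'a) mseries \<Rightarrow> (nat, 'a) mseries" where
  "heckman \<alpha> i G M = (\<alpha> * of_nat (count M i) - of_nat (card (set_mset M))) * G M +
     (\<Sum>j\<in>set_mset M - {i}. \<Sum>c=max (count M i) (Suc (count M j))..count M i + count M j.
        G (set_exponents M i c j (count M i + count M j - c)) - G (set_exponents M i (count M i + count M j - c) j c))"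

lemma replicate_mset_plus: "replicate_mset (m + n) x = replicate_mset m x + replicate_mset n x"
  by (rule multiset_eqI) simp

text \<open>The range of the Euler formula may be bounded by the degree in place of the
  exponent, because annihilation operators beyond the degree give zero.\<close>

lemma expand_euler_deg_le:
  fixes v :: "'a::comm_ring_1 fock"
  assumes "deg_le e v" "e \<le> int d"
  shows "of_nat (count M i) * expand v M = (\<Sum>k=1..d. shift (replicate_mset k i) (expand (an k v)) M)"
proof -
  have "of_nat (count M i) * expand v M = (\<Sum>k=1..max d (count M i). shift (replicate_mset k i) (expand (an k v)) M)"
    by (rule expand_euler) simp
  also have "\<dots> = (\<Sum>k=1..d. shift (replicate_mset k i) (expand (an k v)) M)"
  proof (rule sum.mono_neutral_right)
    show "\<forall>k\<in>{1..max d (count M i)} - {1..d}. shift (replicate_mset k i) (expand (an k v)) M = 0"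
    proof
      fix k assume "k \<in> {1..max d (count M i)} - {1..d}"
      then have "an k v = 0"
        using assms by (intro deg_le_neg[OF deg_le_an[OF _ assms(1)]]) auto
      then show "shift (replicate_mset k i) (expand (an k v)) M = 0"
        by (simp add: shift_def)
    qed
  qed auto
  finally show ?thesis .
qed

lemma telescope:
  fixes \<phi> :: "int \<Rightarrow> 'a::ab_group_add" and l s m :: nat
  assumes "l \<le> Suc s"
  shows "(\<Sum>c=l..s. \<phi> (int c - int m) - \<phi> (int c)) =
    (\<Sum>n=1..m. \<phi> (int l - int n)) - (\<Sum>n=1..m. \<phi> (int (Suc s) - int n))"
  using assms
proof (induction s)
  case 0
  then consider "l = 0" | "l = 1" by linarith
  then show ?case
  proof cases
    case 1
    have "(\<Sum>n=1..m. \<phi> (1 - int n)) + \<phi> (- int m) = \<phi> 0 + (\<Sum>n=1..m. \<phi> (- int n))"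
      by (induction m) (simp_all add: algebra_simps)
    with 1 show ?thesis by (simp add: algebra_simps)
  qed simp
next
  case (Suc s)
  show ?case
  proof (cases "l = Suc (Suc s)")
    case False
    have step: "(\<Sum>n=1..m. \<phi> (int (Suc (Suc s)) - int n)) + \<phi> (int (Suc s) - int m) =
        \<phi> (int (Suc s)) + (\<Sum>n=1..m. \<phi> (int (Suc s) - int n))"
    proof (induction m)
      case (Suc m)
      have "int (Suc (Suc s)) - int (Suc m) = int (Suc s) - int m" by simp
      with Suc show ?case by (simp only: sum.cl_ivl_Suc) (simp add: algebra_simps)
    qed simp
    from False Suc show ?thesis
      by (simp del: of_nat_Suc) (use step in \<open>simp add: algebra_simps del: of_nat_Suc\<close>)
  qed simp
qed

text \<open>The combinatorial core of the divided difference. If \<open>b < a\<close> the telescoping sum is the right-hand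
  side; otherwise it is its mirror image under the symmetry of \<open>\<phi>\<close>.\<close>

lemma telescope_symmetric:
  fixes \<phi> :: "int \<Rightarrow> 'a::ab_group_add" and a b m :: nat
  assumes "a > 0" "m > 0"
    and sym: "\<And>x. \<phi> (int (a + b) - int m - x) = \<phi> x"
    and zero: "\<And>x. x > int (a + b) - int m \<Longrightarrow> \<phi> x = 0"
  shows "(\<Sum>c=max a (Suc b)..a + b. \<phi> (int c - int m) - \<phi> (int c)) = (\<Sum>n=1..m. \<phi> (int a - int n))"
proof -
  have z: "(\<Sum>n=1..m. \<phi> (int (Suc (a + b)) - int n)) = 0"
    by (intro sum.neutral ballI zero) auto
  have "(\<Sum>c=max a (Suc b)..a + b. \<phi> (int c - int m) - \<phi> (int c)) = (\<Sum>n=1..m. \<phi> (int (max a (Suc b)) - int n))"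
    by (subst telescope) (use z assms(1) in auto)
  also have "\<dots> = (\<Sum>n=1..m. \<phi> (int a - int n))"
  proof (cases "b < a")
    case False
    then have "(\<Sum>n=1..m. \<phi> (int (max a (Suc b)) - int n)) = (\<Sum>n=1..m. \<phi> (int (Suc b) - int n))"
      by (simp add: max_def)
    also have "\<dots> = (\<Sum>n=1..m. \<phi> (int a - int (m + 1 - n)))"
    proof (rule sum.cong[OF refl])
      fix n assume "n \<in> {1..m}"
      then have "int (a + b) - int m - (int a - int (m + 1 - n)) = int (Suc b) - int n"
        by (simp add: of_nat_diff)
      then show "\<phi> (int (Suc b) - int n) = \<phi> (int a - int (m + 1 - n))"
        using sym by metis
    qed
    also have "\<dots> = (\<Sum>n=1..m. \<phi> (int a - int n))"
      by (rule sum.reindex_bij_witness[of _ "\<lambda>n. m + 1 - n" "\<lambda>n. m + 1 - n"]) auto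
    finally show ?thesis .
  qed (simp add: max_absorb1)
  finally show ?thesis .
qed

lemma count_set_exponents: "i \<noteq> j \<Longrightarrow> count (set_exponents M i c j e) x = (if x = i then c else if x = j then e else count M x)"
  by (simp add: set_exponents_def)

lemma shape_set_exponents:
  assumes "i \<noteq> j"
  shows "shape (set_exponents M i c j e) = shape (filter_mset (\<lambda>x. x \<noteq> i \<and> x \<noteq> j) M) +
    (if c = 0 then {#} else {#c#}) + (if e = 0 then {#} else {#e#})"
  unfolding set_exponents_def using assms by (subst shape_add_replicate) (auto simp: shape_add_replicate)

text \<open>For symmetric \<open>f\<close>, applying \<open>x_i / (x_i - x_j) (1 - s) - 1\<close> to \<open>x_i^m f\<close> gives the sum of
  \<open>x_i^n x_j^(m - n) f\<close> over \<open>0 < n < m\<close>, since \<open>f\<close> is a constant for the exchange \<open>s\<close> and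
  \<open>x_i (x_i^m - x_j^m) / (x_i - x_j)\<close> is a geometric sum. In coefficients this becomes a telescoping sum along
  the line where the exponents of \<open>x_i\<close> and \<open>x_j\<close> have a fixed total; \<open>\<phi>\<close> is \<open>f\<close> along this line, extended
  by zero.\<close>

lemma pair_exchange:
  fixes f :: "(nat, 'a::comm_ring_1) mseries"
  assumes ij: "i \<noteq> j" and i: "i \<in># M" and m: "m > 0"
    and sym: "\<And>M N. shape M = shape N \<Longrightarrow> f M = f N"
  defines "a \<equiv> count M i" and "b \<equiv> count M j"
  shows "(\<Sum>n=1..<m. shift (replicate_mset n i + replicate_mset (m - n) j) f M) =
    (\<Sum>c=max a (Suc b)..a + b. shift (replicate_mset m i) f (set_exponents M i c j (a + b - c)) -
       shift (replicate_mset m i) f (set_exponents M i (a + b - c) j c)) - shift (replicate_mset m i) f M"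
proof -
  define \<phi> where "\<phi> x = (if 0 \<le> x \<and> x \<le> int (a + b) - int m then f (set_exponents M i (nat x) j (nat (int (a + b) - int m - x))) else 0)" for x
  have a: "a > 0" using i by (simp add: a_def)
  have sym\<phi>: "\<phi> (int (a + b) - int m - x) = \<phi> x" for x
    unfolding \<phi>_def by (auto intro!: sym simp: shape_set_exponents[OF ij])
  have zero: "\<phi> x = 0" if "x > int (a + b) - int m" for x
    using that by (simp add: \<phi>_def)
  have 1: "shift (replicate_mset n i + replicate_mset (m - n) j) f M = \<phi> (int a - int n)" if "n \<in> {1..<m}" for n
  proof -
    have c: "(replicate_mset n i + replicate_mset (m - n) j \<subseteq># M) \<longleftrightarrow> n \<le> a \<and> m - n \<le> b"
      using ij by (auto simp: subseteq_mset_def a_def b_def dest: spec[of _ i] spec[of _ j])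
    have "M - (replicate_mset n i + replicate_mset (m - n) j) =
       set_exponents M i (nat (int a - int n)) j (nat (int (a + b) - int m - (int a - int n)))"
      if "n \<le> a" "m - n \<le> b"
      by (rule multiset_eqI) (use ij that \<open>n \<in> {1..<m}\<close> in \<open>auto simp: count_set_exponents a_def b_def\<close>)
    with that show ?thesis
      unfolding shift_def c \<phi>_def by auto
  qed
  have 2: "shift (replicate_mset m i) f (set_exponents M i c j e) = \<phi> (int c - int m)" if "c + e = a + b" for c e
  proof -
    have "set_exponents M i c j e - replicate_mset m i = set_exponents M i (c - m) j e" if "m \<le> c"
      by (rule multiset_eqI) (use ij in \<open>auto simp: count_set_exponents\<close>)
    moreover have "nat (int c - int m) = c - m" "nat (int (a + b) - int m - (int c - int m)) = e"
      using that by auto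
    ultimately show ?thesis
      using that unfolding shift_replicate \<phi>_def by (auto simp: count_set_exponents[OF ij])
  qed
  have M: "M = set_exponents M i a j b"
    by (rule multiset_eqI) (use ij in \<open>auto simp: count_set_exponents a_def b_def\<close>)
  have 3: "shift (replicate_mset m i) f M = \<phi> (int a - int m)"
    by (subst M) (rule 2, simp)
  have 4: "shift (replicate_mset m i) f (set_exponents M i (a + b - c) j c) = \<phi> (int c)" if "c \<le> a + b" for c
  proof -
    have "shift (replicate_mset m i) f (set_exponents M i (a + b - c) j c) = \<phi> (int (a + b - c) - int m)"
      by (rule 2) (use that in simp)
    also have "int (a + b - c) - int m = int (a + b) - int m - int c"
      using that by (simp add: of_nat_diff)
    finally show ?thesis by (simp only: sym\<phi>)
  qed
  have "(\<Sum>c=max a (Suc b)..a + b. shift (replicate_mset m i) f (set_exponents M i c j (a + b - c)) -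
       shift (replicate_mset m i) f (set_exponents M i (a + b - c) j c)) =
     (\<Sum>c=max a (Suc b)..a + b. \<phi> (int c - int m) - \<phi> (int c))"
    by (intro sum.cong refl arg_cong2[where f = "(-)"] 2 4) auto
  also have "\<dots> = (\<Sum>n=1..m. \<phi> (int a - int n))"
    by (rule telescope_symmetric[of a m \<phi> b, OF a m sym\<phi> zero])
  also have "{1..m} = insert m {1..<m}" using m by auto
  finally show ?thesis by (simp add: 1 3)
qed

text \<open>The Lax matrix is the Heckman operator. On \<open>x_i^m g\<close> with symmetric \<open>g\<close> the Euler operator
  contributes \<open>\<alpha> m x_i^m g\<close> and, by \<open>expand_euler_deg_le\<close>, the terms that raise the power.
  By \<open>pair_exchange\<close> each other variable \<open>x_j\<close> contributes \<open>x_i^n x_j^(m - n) g\<close> for \<open>0 < n < m\<close>; the sum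
  over \<open>j\<close> is the term with \<open>p_(m - n)\<close> that lowers the power, except that the latter includes
  \<open>j = i\<close>. Its \<open>m - 1\<close> summands for \<open>j = i\<close> and the one subtracted for \<open>x_i\<close> itself are the reason
  for \<open>(\<alpha> - 1) m\<close> in place of \<open>\<alpha> m\<close> on the diagonal.\<close>

lemma mark_lax:
  fixes g :: "nat \<Rightarrow> 'a::comm_ring_1 fock"
  assumes g: "graded d g"
  shows "mark d (lax \<alpha> d g) i = heckman \<alpha> i (mark d g i)"
proof
  fix M
  let ?r = "\<lambda>n. replicate_mset n i"
  define a where "a = count M i"
  define sh where "sh m = shift (?r m) (expand (g m)) M" for m
  have deg: "deg_le (int d - int m) (g m)" if "m \<in> {1..d}" for m
    using g that by (simp add: graded_def)
  show "mark d (lax \<alpha> d g) i M = heckman \<alpha> i (mark d g i) M"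
  proof (cases "i \<in># M")
    case False
    then have "mark d h i M = 0" for h :: "nat \<Rightarrow> 'a fock"
      by (auto simp: mark_def shift_eq_0 intro!: sum.neutral)
    moreover have "count M i = 0" using False by (simp add: not_in_iff)
    ultimately show ?thesis by (simp add: heckman_def)
  next
    case i: True
    define up where "up m = (\<Sum>n=1..d. \<Sum>k=1..d. if m + k = n then \<alpha> * shift (?r n) (expand (an k (g m))) M else 0)" for m
    define dn where "dn m = (\<Sum>n=1..d. \<Sum>r=1..d. if m = n + r then shift (?r n) (expand (cr r (g m))) M else 0)" for m
    have "mark d (lax \<alpha> d g) i M = (\<Sum>n=1..d. (\<alpha> - 1) * of_nat n * sh n
        + (\<Sum>m=1..d. \<Sum>k=1..d. if m + k = n then \<alpha> * shift (?r n) (expand (an k (g m))) M else 0)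
        + (\<Sum>m=1..d. \<Sum>r=1..d. if m = n + r then shift (?r n) (expand (cr r (g m))) M else 0))"
      unfolding mark_def lax_def sh_def
      by (intro sum.cong refl)
        (auto simp: shift_def expand_add expand_scale expand_sum if_distrib[of "\<lambda>v. expand v _"] cong: if_cong)
    also have "\<dots> = (\<Sum>m=1..d. (\<alpha> - 1) * of_nat m * sh m) + (\<Sum>m=1..d. up m) + (\<Sum>m=1..d. dn m)"
      unfolding sum.distrib up_def dn_def by (subst (2) sum.swap, subst (4) sum.swap) simp
    also have "\<dots> = (\<Sum>m=1..d. (\<alpha> - 1) * of_nat m * sh m + up m + dn m)"
      by (simp add: sum.distrib)
    also have "\<dots> = (\<Sum>m=1..d. (\<alpha> * of_nat a - of_nat (card (set_mset M))) * sh m +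
       (\<Sum>j\<in>set_mset M - {i}. \<Sum>c=max a (Suc (count M j))..a + count M j.
        shift (?r m) (expand (g m)) (set_exponents M i c j (a + count M j - c)) -
        shift (?r m) (expand (g m)) (set_exponents M i (a + count M j - c) j c)))" (is "_ = (\<Sum>m=1..d. _ + ?X m)")
    proof (rule sum.cong[OF refl])
      fix m assume m: "m \<in> {1..d}"
      have "up m = (\<Sum>k=1..d. \<Sum>n=1..d. if m + k = n then \<alpha> * shift (?r n) (expand (an k (g m))) M else 0)"
        unfolding up_def by (rule sum.swap)
      also have "\<dots> = (\<Sum>k=1..d. \<alpha> * shift (?r m) (shift (?r k) (expand (an k (g m)))) M)"
      proof (rule sum.cong[OF refl])
        fix k assume k: "k \<in> {1..d}"
        have z: "an k (g m) = 0" if "m + k > d"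
          by (rule deg_le_neg[OF deg_le_an[OF _ deg[OF m]]]) (use k that in auto)
        show "(\<Sum>n=1..d. if m + k = n then \<alpha> * shift (?r n) (expand (an k (g m))) M else 0) =
          \<alpha> * shift (?r m) (shift (?r k) (expand (an k (g m)))) M"
        proof (cases "m + k \<le> d")
          case True
          then show ?thesis
            using m by (simp add: shift_shift replicate_mset_plus sum.delta')
        next
          case False
          then have "an k (g m) = 0" using z by simp
          then show ?thesis by (simp add: shift_def)
        qed
      qed
      also have "\<dots> = \<alpha> * shift (?r m) (\<lambda>N. of_nat (count N i) * expand (g m) N) M"
      proof -
        have "of_nat (count N i) * expand (g m) N = (\<Sum>k=1..d. shift (?r k) (expand (an k (g m))) N)" for N
          by (rule expand_euler_deg_le[OF deg[OF m]]) simp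
        then show ?thesis by (simp add: sum_distrib_left[symmetric] shift_sum[symmetric])
      qed
      also have "\<dots> = \<alpha> * (of_nat a - of_nat m) * sh m"
        by (simp add: sh_def shift_replicate a_def)
      finally have up: "up m = \<alpha> * (of_nat a - of_nat m) * sh m" .
      have dn: "dn m = (\<Sum>n=1..<m. \<Sum>j\<in>set_mset M. shift (?r n + replicate_mset (m - n) j) (expand (g m)) M)"
      proof -
        have eq: "(\<Sum>r=1..d. if m = n + r then shift (?r n) (expand (cr r (g m))) M else 0) =
            (if n < m then \<Sum>j\<in>set_mset M. shift (?r n + replicate_mset (m - n) j) (expand (g m)) M else 0)"
          for n
        proof (cases "n < m")
          case True
          have "(m = n + r) = (r = m - n)" for r using True by auto
          then have "(\<Sum>r=1..d. if m = n + r then shift (?r n) (expand (cr r (g m))) M else 0) =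
            shift (?r n) (expand (cr (m - n) (g m))) M"
            using m True by (simp add: sum.delta, intro impI) linarith
          also have "\<dots> = (\<Sum>j\<in>set_mset M. shift (?r n) (shift (replicate_mset (m - n) j) (expand (g m))) M)"
            unfolding shift_def[of "?r n"]
            using True by (auto simp: expand_cr[OF _ finite_set_mset set_mset_minus_subset])
          finally show ?thesis using True by (simp add: shift_shift)
        qed (auto intro!: sum.neutral)
        have "{1..<m} = {n \<in> {1..d}. n < m}" using m by auto
        then show ?thesis
          unfolding dn_def eq by (simp only: sum.inter_filter finite_atLeastAtMost)
      qed
      also have "\<dots> = (\<Sum>j\<in>set_mset M. \<Sum>n=1..<m. shift (?r n + replicate_mset (m - n) j) (expand (g m)) M)"
        by (rule sum.swap)
      also have "\<dots> = (\<Sum>n=1..<m. shift (?r n + ?r (m - n)) (expand (g m)) M) +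
        (\<Sum>j\<in>set_mset M - {i}. \<Sum>n=1..<m. shift (?r n + replicate_mset (m - n) j) (expand (g m)) M)"
        by (rule sum.remove) (use i in auto)
      also have "(\<Sum>n=1..<m. shift (?r n + ?r (m - n)) (expand (g m)) M) = (of_nat m - 1) * sh m"
        using m by (simp add: replicate_mset_plus[symmetric] sh_def of_nat_diff)
      also have "(\<Sum>j\<in>set_mset M - {i}. \<Sum>n=1..<m. shift (?r n + replicate_mset (m - n) j) (expand (g m)) M) =
         (\<Sum>j\<in>set_mset M - {i}. (\<Sum>c=max a (Suc (count M j))..a + count M j.
        shift (?r m) (expand (g m)) (set_exponents M i c j (a + count M j - c)) -
        shift (?r m) (expand (g m)) (set_exponents M i (a + count M j - c) j c)) - sh m)"
        unfolding a_def sh_def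
        by (intro sum.cong refl pair_exchange) (use i m expand_shape in auto)
      also have "\<dots> = ?X m - (of_nat (card (set_mset M)) - 1) * sh m"
      proof -
        have "card (set_mset M) > 0" using i by (auto simp: card_gt_0_iff)
        then have "of_nat (card (set_mset M - {i})) = (of_nat (card (set_mset M)) - 1 :: 'a)"
          using i by (simp add: of_nat_diff)
        then show ?thesis by (simp add: sum_subtractf)
      qed
      finally have dn: "dn m = (of_nat m - 1) * sh m + (?X m - (of_nat (card (set_mset M)) - 1) * sh m)" .
      show "(\<alpha> - 1) * of_nat m * sh m + up m + dn m = (\<alpha> * of_nat a - of_nat (card (set_mset M))) * sh m + ?X m"
        unfolding up dn by (simp add: algebra_simps)
    qed
    also have "\<dots> = heckman \<alpha> i (mark d g i) M"
    proof -
      have "(\<Sum>m=1..d. ?X m) = (\<Sum>j\<in>set_mset M - {i}. \<Sum>c=max a (Suc (count M j))..a + count M j.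
        mark d g i (set_exponents M i c j (a + count M j - c)) - mark d g i (set_exponents M i (a + count M j - c) j c))"
        unfolding mark_def sum_subtractf[symmetric]
        by (rule trans[OF sum.swap], rule sum.cong[OF refl], rule sum.swap)
      then show ?thesis
        by (simp add: heckman_def a_def sum.distrib mark_def sh_def sum_distrib_left)
    qed
    finally show ?thesis .
  qed
qed

lemma graded_lax_funpow: "deg_le (int d) v \<Longrightarrow> graded d ((lax \<alpha> d ^^ j) (\<lambda>n. an n v))"
  by (induction j) (simp_all add: graded_an graded_lax)

text \<open>The right-hand side does not depend on the truncation, and in this form the operators can be
  evaluated on monomials.\<close>

lemma expand_ham:
  fixes v :: "'a::comm_ring_1 fock"
  assumes "deg_le (int d) v"
  shows "expand (ham \<alpha> d j v) M = (\<Sum>i\<in>set_mset M. (heckman \<alpha> i ^^ j) (\<lambda>N. of_nat (count N i) * expand v N) M)"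
proof -
  have mk: "mark d ((lax \<alpha> d ^^ j) (\<lambda>n. an n v)) i = (heckman \<alpha> i ^^ j) (\<lambda>N. of_nat (count N i) * expand v N)" for i
  proof (induction j)
    case 0
    show ?case
      by (rule ext) (simp add: mark_def expand_euler_deg_le[OF assms order_refl])
  next
    case (Suc j)
    then show ?case by (simp add: mark_lax[OF graded_lax_funpow[OF assms]])
  qed
  have "expand (ham \<alpha> d j v) M = (\<Sum>i\<in>set_mset M. mark d ((lax \<alpha> d ^^ j) (\<lambda>n. an n v)) i M)"
    unfolding ham_def expand_sum mark_def
    by (subst sum.swap) (intro sum.cong refl, auto simp: expand_cr[OF _ finite_set_mset order_refl])
  then show ?thesis by (simp add: mk)
qed

section \<open>Triangularity\<close>

text \<open>Sums of squares of exponents serve in place of the dominance order: a dominating partition has the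
  larger sum, and the sum visibly increases when two exponents with a fixed total move apart.\<close>

definition square_sum :: "nat multiset \<Rightarrow> nat" where
  "square_sum X = (\<Sum>x\<in>#X. x\<^sup>2)"

lemma square_sum_add [simp]: "square_sum (X + Y) = square_sum X + square_sum Y"
  and square_sum_add_mset [simp]: "square_sum (add_mset x X) = x\<^sup>2 + square_sum X"
  and square_sum_empty [simp]: "square_sum {#} = 0"
  by (simp_all add: square_sum_def)

lemma square_sum_set_exponents:
  "i \<noteq> j \<Longrightarrow> square_sum (shape (set_exponents M i c j e)) =
     square_sum (shape (filter_mset (\<lambda>x. x \<noteq> i \<and> x \<noteq> j) M)) + c\<^sup>2 + e\<^sup>2"
  by (simp add: shape_set_exponents)

lemma set_exponents_self: "i \<noteq> j \<Longrightarrow> set_exponents M i (count M i) j (count M j) = M"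
  by (rule multiset_eqI) (auto simp: count_set_exponents)

lemma spread_squares:
  fixes a b c s :: nat
  assumes "a < c" "b < c" "c \<le> a + b"
  shows "a\<^sup>2 + b\<^sup>2 < c\<^sup>2 + (a + b - c)\<^sup>2"
proof -
  define e where "e = a + b - c"
  have "int e = int a + int b - int c" using assms by (simp add: e_def of_nat_diff)
  then have "(int c)\<^sup>2 + (int e)\<^sup>2 - ((int a)\<^sup>2 + (int b)\<^sup>2) = 2 * ((int c - int a) * (int c - int b))"
    by (simp only:) (simp add: power2_eq_square algebra_simps)
  also have "\<dots> > 0" using assms by simp
  finally have "int (a\<^sup>2 + b\<^sup>2) < int (c\<^sup>2 + e\<^sup>2)" by simp
  then show ?thesis unfolding e_def by linarith
qed

text \<open>In the definition of \<^const>\<open>heckman\<close> the exponents \<open>c\<close> and \<open>a + b - c\<close> are at least as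
  far apart as \<open>a\<close> and \<open>b\<close>. Unless \<open>c\<close> is \<open>a\<close>, they are strictly further apart, and
  those monomials do not occur in \<open>G\<close>.\<close>

lemma heckman_top:
  fixes G :: "(nat, 'a::comm_ring_1) mseries"
  assumes zero: "\<And>N. square_sum (shape N) > square_sum (shape M) \<Longrightarrow> G N = 0"
  shows "heckman \<alpha> i G M = (\<alpha> * of_nat (count M i) - of_nat (card (set_mset M))) * G M +
     (\<Sum>j\<in>set_mset M. if count M j < count M i then G M - G (set_exponents M i (count M j) j (count M i)) else 0)"
proof -
  let ?a = "count M i"
  have eq: "(\<Sum>c=max ?a (Suc (count M j))..?a + count M j.
        G (set_exponents M i c j (?a + count M j - c)) - G (set_exponents M i (?a + count M j - c) j c)) =
      (if count M j < ?a then G M - G (set_exponents M i (count M j) j ?a) else 0)" if j: "j \<noteq> i" for j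
  proof -
    let ?b = "count M j"
    let ?F = "\<lambda>c. G (set_exponents M i c j (?a + ?b - c)) - G (set_exponents M i (?a + ?b - c) j c)"
    have sq: "square_sum (shape M) = square_sum (shape (filter_mset (\<lambda>x. x \<noteq> i \<and> x \<noteq> j) M)) + ?a\<^sup>2 + ?b\<^sup>2"
      using square_sum_set_exponents[of i j M ?a ?b] set_exponents_self[of i j M] j by simp
    have F: "?F c = 0" if "?a < c" "?b < c" "c \<le> ?a + ?b" for c
      using spread_squares[OF that] j
      by (subst (1 2) zero) (auto simp: square_sum_set_exponents sq)
    show ?thesis
    proof (cases "?b < ?a")
      case True
      have "(\<Sum>c=max ?a (Suc ?b)..?a + ?b. ?F c) = (\<Sum>c\<in>{?a}. ?F c)"
        by (rule sum.mono_neutral_right) (use True F in auto)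
      then show ?thesis using True j by (simp add: set_exponents_self)
    next
      case False
      then show ?thesis by (auto intro!: sum.neutral F)
    qed
  qed
  have "(\<Sum>j\<in>set_mset M - {i}. if count M j < ?a then G M - G (set_exponents M i (count M j) j ?a) else 0) =
    (\<Sum>j\<in>set_mset M. if count M j < ?a then G M - G (set_exponents M i (count M j) j ?a) else 0)"
    by (rule sum.mono_neutral_left) auto
  then show ?thesis unfolding heckman_def by (simp add: eq)
qed

text \<open>The factor by which the Heckman operator, applied to \<open>x_i \<partial>f/\<partial>x_i\<close>, changes the coefficient of a
  symmetric \<open>f\<close> at a monomial of shape \<open>X\<close> that is extremal in \<open>f\<close> and has exponent \<open>a\<close> at \<open>x_i\<close>.\<close>

definition top_coeff :: "'a::comm_ring_1 \<Rightarrow> nat multiset \<Rightarrow> nat \<Rightarrow> 'a" where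
  "top_coeff \<alpha> X a = (\<alpha> * of_nat a - of_nat (size X)) * of_nat a +
     (\<Sum>b\<in>#X. if b < a then of_nat a - of_nat b else 0)"

text \<open>The diagonal entries for \<open>j = 0, 1, 2\<close>; the formula in the last branch is meaningful for
  \<open>j = 2\<close> only.\<close>

definition ham_eigenvalue :: "'a::comm_ring_1 \<Rightarrow> nat \<Rightarrow> nat multiset \<Rightarrow> 'a" where
  "ham_eigenvalue \<alpha> j X = (\<Sum>a\<in>#X. if j = 0 then of_nat a else if j = 1 then top_coeff \<alpha> X a else
     (\<alpha> * of_nat a - of_nat (size X)) * top_coeff \<alpha> X a + (\<Sum>b\<in>#X. if b < a then top_coeff \<alpha> X a - top_coeff \<alpha> X b else 0))"

lemma shape_swap:
  assumes "i \<noteq> j"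
  shows "shape (set_exponents M i (count M j) j (count M i)) = shape M"
proof -
  have "shape M = shape (set_exponents M i (count M i) j (count M j))"
    by (simp add: set_exponents_self assms)
  then show ?thesis by (simp add: shape_set_exponents[OF assms])
qed

text \<open>Exchanging the exponents of \<open>x_i\<close> and \<open>x_j\<close> leaves the symmetric function unchanged and turns the
  factor of exponent \<open>a\<close> into that of exponent \<open>b\<close>, so \<open>heckman_top\<close> can be applied twice with known
  values.\<close>

lemma expand_ham_top:
  fixes v :: "'a::comm_ring_1 fock"
  assumes d: "deg_le (int d) v" and j: "j \<le> 2"
    and zero: "\<And>N. square_sum (shape N) > square_sum (shape M) \<Longrightarrow> expand v N = 0"
  shows "expand (ham \<alpha> d j v) M = ham_eigenvalue \<alpha> j (shape M) * expand v M"
proof -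
  let ?q = "square_sum (shape M)"
  define g where "g i N = of_nat (count N i) * expand v N" for i N
  have swap: "expand v (set_exponents N i (count N l) l (count N i)) = expand v N" if "i \<noteq> l" for N i l
    by (rule expand_shape) (rule shape_swap[OF that])
  have if_sub: "(if c then x * y - z * y else 0) = (if c then x - z else 0) * y" for c and x y z :: 'a
    by (simp add: algebra_simps)
  have g1: "heckman \<alpha> i (g i) N = top_coeff \<alpha> (shape N) (count N i) * expand v N" if "square_sum (shape N) \<ge> ?q" for i N
  proof -
    have z: "g i L = 0" if "square_sum (shape L) > square_sum (shape N)" for L
      using zero[of L] that \<open>square_sum (shape N) \<ge> ?q\<close> by (simp add: g_def)
    have "heckman \<alpha> i (g i) N = (\<alpha> * of_nat (count N i) - of_nat (card (set_mset N))) * g i N +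
       (\<Sum>l\<in>set_mset N. (if count N l < count N i then of_nat (count N i) - of_nat (count N l) else 0) * expand v N)"
    proof -
      have "(if count N l < count N i then g i N - g i (set_exponents N i (count N l) l (count N i)) else 0) =
        (if count N l < count N i then of_nat (count N i) - of_nat (count N l) else 0) * expand v N" for l
        by (cases "i = l") (auto simp: g_def swap count_set_exponents algebra_simps)
      then show ?thesis by (simp only: heckman_top[of N "g i", OF z])
    qed
    then show ?thesis
      by (simp only: top_coeff_def g_def sum_shape size_shape sum_distrib_right[symmetric] distrib_right mult.assoc)
  qed
  have g2: "heckman \<alpha> i (heckman \<alpha> i (g i)) M = ((\<alpha> * of_nat (count M i) - of_nat (size (shape M))) * top_coeff \<alpha> (shape M) (count M i)
     + (\<Sum>b\<in>#shape M. if b < count M i then top_coeff \<alpha> (shape M) (count M i) - top_coeff \<alpha> (shape M) b else 0)) * expand v M" for i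
  proof -
    have z: "heckman \<alpha> i (g i) L = 0" if "square_sum (shape L) > ?q" for L
      using zero[of L] that g1[of L i] by simp
    have "(if count M l < count M i then heckman \<alpha> i (g i) M - heckman \<alpha> i (g i) (set_exponents M i (count M l) l (count M i)) else 0) =
        (if count M l < count M i then top_coeff \<alpha> (shape M) (count M i) - top_coeff \<alpha> (shape M) (count M l) else 0) * expand v M" for l
    proof (cases "i = l")
      case False
      then show ?thesis
        by (simp add: g1 shape_swap swap count_set_exponents algebra_simps)
    qed simp
    then have "heckman \<alpha> i (heckman \<alpha> i (g i)) M =
      (\<alpha> * of_nat (count M i) - of_nat (card (set_mset M))) * heckman \<alpha> i (g i) M + (\<Sum>l\<in>set_mset M.
        (if count M l < count M i then top_coeff \<alpha> (shape M) (count M i) - top_coeff \<alpha> (shape M) (count M l) else 0) * expand v M)"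
      by (simp only: heckman_top[of M "heckman \<alpha> i (g i)", OF z])
    then show ?thesis
      by (simp only: g1[OF order_refl] sum_shape size_shape sum_distrib_right[symmetric] distrib_right mult.assoc)
  qed
  \<comment> \<open>The operator applied once and twice is known; the sum over the variables is the sum over the shape.\<close>
  consider "j = 0" | "j = 1" | "j = 2" using j by linarith
  then show ?thesis
  proof cases
    case 1
    then show ?thesis
      by (simp add: expand_ham[OF d] ham_eigenvalue_def sum_shape sum_distrib_right)
  next
    case 2
    then show ?thesis
      by (simp add: expand_ham[OF d] g_def[symmetric] g1 ham_eigenvalue_def sum_shape sum_distrib_right)
  next
    case 3
    then show ?thesis
      by (simp add: expand_ham[OF d] g_def[symmetric] g2 ham_eigenvalue_def sum_shape sum_distrib_right numeral_2_eq_2)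
  qed
qed

section \<open>Self-adjointness\<close>

text \<open>The transpose of the part of the Lax matrix that raises the index is the part that lowers it,
  because \<open>\<alpha> an k\<close> is adjoint to \<open>cr k\<close>.\<close>

lemma jack_inner_lax:
  fixes g h :: "nat \<Rightarrow> 'a::field_char_0 fock"
  shows "(\<Sum>n=1..d. jack_inner \<alpha> (lax \<alpha> d g n) (h n)) = (\<Sum>n=1..d. jack_inner \<alpha> (g n) (lax \<alpha> d h n))"
proof -
  let ?I = "jack_inner \<alpha>"
  let ?up = "\<lambda>g h. \<Sum>n=1..d. \<Sum>m=1..d. \<Sum>k=1..d. if m + k = n then ?I (scale \<alpha> (an k (g m))) (h n) else 0"
  let ?dn = "\<lambda>g h. \<Sum>n=1..d. \<Sum>m=1..d. \<Sum>k=1..d. if m = n + k then ?I (cr k (g m)) (h n) else 0"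
  let ?dg = "\<lambda>g h. \<Sum>n=1..d. (\<alpha> - 1) * of_nat n * ?I (g n) (h n)"
  have split: "(\<Sum>n=1..d. ?I (lax \<alpha> d g n) (h n)) = ?dg g h + ?up g h + ?dn g h" for g h :: "nat \<Rightarrow> 'a fock"
    unfolding lax_def jack_inner_add_left jack_inner_scale_left jack_inner_sum_left sum.distrib
    by (simp add: if_distrib[of "\<lambda>v. ?I v _"] jack_inner_scale_left cong: if_cong)
  have swap: "?dn g h = ?up h g" for g h :: "nat \<Rightarrow> 'a fock"
  proof -
    have "?dn g h = (\<Sum>m=1..d. \<Sum>n=1..d. \<Sum>k=1..d. if m = n + k then ?I (cr k (g m)) (h n) else 0)"
      by (rule sum.swap)
    also have "\<dots> = ?up h g"
      by (intro sum.cong refl)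
        (auto simp: jack_inner_cr jack_inner_scale_left jack_inner_sym[of _ "g m" for m])
    finally show ?thesis .
  qed
  have dg: "?dg g h = ?dg h g" by (simp add: jack_inner_sym)
  have "(\<Sum>n=1..d. ?I (lax \<alpha> d g n) (h n)) = (\<Sum>n=1..d. ?I (lax \<alpha> d h n) (g n))"
    unfolding split swap dg by (simp add: add_ac)
  then show ?thesis by (simp add: jack_inner_sym)
qed

lemma jack_inner_lax_funpow:
  fixes g h :: "nat \<Rightarrow> 'a::field_char_0 fock"
  shows "(\<Sum>n=1..d. jack_inner \<alpha> ((lax \<alpha> d ^^ j) g n) (h n)) = (\<Sum>n=1..d. jack_inner \<alpha> (g n) ((lax \<alpha> d ^^ j) h n))"
proof (induction j arbitrary: h)
  case (Suc j)
  have "(\<Sum>n=1..d. jack_inner \<alpha> ((lax \<alpha> d ^^ Suc j) g n) (h n)) =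
    (\<Sum>n=1..d. jack_inner \<alpha> ((lax \<alpha> d ^^ j) g n) (lax \<alpha> d h n))"
    by (simp only: funpow.simps(2) o_apply jack_inner_lax)
  also have "\<dots> = (\<Sum>n=1..d. jack_inner \<alpha> (g n) ((lax \<alpha> d ^^ j) (lax \<alpha> d h) n))"
    by (rule Suc)
  finally show ?case by (simp only: funpow_Suc_right o_apply)
qed simp

lemma jack_inner_ham:
  fixes v w :: "'a::field_char_0 fock"
  shows "jack_inner \<alpha> (ham \<alpha> d j v) w = jack_inner \<alpha> v (ham \<alpha> d j w)"
proof -
  have 1: "jack_inner \<alpha> (ham \<alpha> d j v) w = \<alpha> * (\<Sum>n=1..d. jack_inner \<alpha> ((lax \<alpha> d ^^ j) (\<lambda>n. an n v) n) (an n w))" for v w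
    unfolding ham_def jack_inner_sum_left sum_distrib_left
    by (intro sum.cong refl) (auto simp: jack_inner_cr)
  have "jack_inner \<alpha> (ham \<alpha> d j v) w = jack_inner \<alpha> (ham \<alpha> d j w) v"
    unfolding 1 by (subst jack_inner_lax_funpow, subst jack_inner_sym, rule refl)
  also have "\<dots> = jack_inner \<alpha> v (ham \<alpha> d j w)" by (rule jack_inner_sym)
  finally show ?thesis .
qed

section \<open>Dominance and sums of squares\<close>

definition part_squares :: "partition \<Rightarrow> nat" where
  "part_squares lam = square_sum (image_mset nat_of_pos lam)"

text \<open>Parts followed by zeros, so that partitions of different lengths can be compared entry by entry.\<close>

definition pad :: "nat list \<Rightarrow> nat \<Rightarrow> nat" where
  "pad xs i = (if i < length xs then xs ! i else 0)"

lemma sum_pad: "(\<Sum>i<k. pad xs i) = sum_list (take k xs)"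
proof (induction k)
  case (Suc k)
  then show ?case
    by (cases "k < length xs") (simp_all add: pad_def take_Suc_conv_app_nth)
qed simp

lemma square_sum_mset_pad: "length xs \<le> n \<Longrightarrow> square_sum (mset xs) = (\<Sum>i<n. (pad xs i)\<^sup>2)"
proof -
  assume n: "length xs \<le> n"
  have "square_sum (mset xs) = sum_list (map power2 xs)"
    unfolding square_sum_def by (metis mset_map sum_mset_sum_list)
  also have "\<dots> = (\<Sum>i<length xs. (pad xs i)\<^sup>2)"
    by (simp add: sum_list_sum_nth pad_def lessThan_atLeast0)
  also have "\<dots> = (\<Sum>i<n. (pad xs i)\<^sup>2)"
    by (rule sum.mono_neutral_left) (use n in \<open>auto simp: pad_def\<close>)
  finally show ?thesis .
qed

lemma parts_antimono: "i \<le> j \<Longrightarrow> j < length (parts lam) \<Longrightarrow> parts lam ! j \<le> parts lam ! i"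
  unfolding parts_def
  by (simp add: rev_nth sorted_nth_mono)

text \<open>Summation by parts; in the application \<open>m\<close> is a partition and the partial sums of \<open>\<delta>\<close> express
  dominance.\<close>

lemma abel_nonneg:
  fixes m \<delta> :: "nat \<Rightarrow> int"
  assumes "\<And>i. m (Suc i) \<le> m i" "\<And>k. (\<Sum>i<k. \<delta> i) \<ge> 0"
  shows "(\<Sum>i<n. m i * \<delta> i) \<ge> m n * (\<Sum>i<n. \<delta> i)"
proof (induction n)
  case (Suc n)
  have "m (Suc n) * (\<Sum>i<Suc n. \<delta> i) \<le> m n * (\<Sum>i<Suc n. \<delta> i)"
    by (intro mult_right_mono assms)
  with Suc show ?case by (simp add: algebra_simps)
qed simp

text \<open>With \<open>x\<close> and \<open>y\<close> the two lists of parts, the difference of the sums of squares is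
  \<open>\<Sum> (x - y)^2 + 2 \<Sum> y (x - y)\<close>. The second sum is nonnegative by \<open>abel_nonneg\<close>, and the first is positive if
  \<open>x \<noteq> y\<close>.\<close>

lemma dominates_part_squares:
  assumes "dominates lam mu" "mu \<noteq> lam"
  shows "part_squares mu < part_squares lam"
proof -
  let ?x = "\<lambda>i. int (pad (parts lam) i)" and ?y = "\<lambda>i. int (pad (parts mu) i)"
  let ?n = "max (length (parts lam)) (length (parts mu))"
  have sq: "int (part_squares nu) = (\<Sum>i<?n. (int (pad (parts nu) i))\<^sup>2)" if "length (parts nu) \<le> ?n" for nu
    unfolding part_squares_def mset_parts[symmetric] by (subst square_sum_mset_pad[OF that]) simp
  have partial: "(\<Sum>i<k. ?x i - ?y i) \<ge> 0" for k
  proof -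
    have "sum_list (take k (parts mu)) \<le> sum_list (take k (parts lam))"
      using assms(1) by (simp add: dominates_def)
    then have "int (\<Sum>i<k. pad (parts mu) i) \<le> int (\<Sum>i<k. pad (parts lam) i)"
      by (simp only: sum_pad of_nat_le_iff)
    then show ?thesis by (simp add: sum_subtractf)
  qed
  have anti: "?y (Suc i) \<le> ?y i" for i
    by (auto simp: pad_def parts_antimono)
  have "0 \<le> ?y ?n * (\<Sum>i<?n. ?x i - ?y i)"
    by (intro mult_nonneg_nonneg partial) simp
  also have "\<dots> \<le> (\<Sum>i<?n. ?y i * (?x i - ?y i))"
    by (rule abel_nonneg[of ?y "\<lambda>i. ?x i - ?y i", OF anti partial])
  finally have ge: "0 \<le> (\<Sum>i<?n. ?y i * (?x i - ?y i))" .
  have diff: "int (part_squares lam) - int (part_squares mu) =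
     (\<Sum>i<?n. (?x i - ?y i)\<^sup>2) + 2 * (\<Sum>i<?n. ?y i * (?x i - ?y i))"
    by (simp add: sq sum_subtractf[symmetric] sum.distrib[symmetric] sum_distrib_left)
      (intro sum.cong refl, simp add: power2_eq_square algebra_simps)
  have "(\<Sum>i<?n. (?x i - ?y i)\<^sup>2) > 0"
  proof (rule ccontr)
    assume "\<not> ?thesis"
    then have "(\<Sum>i<?n. (?x i - ?y i)\<^sup>2) = 0"
      by (meson linorder_neqE_linordered_idom not_le sum_nonneg zero_le_power2)
    then have eq: "?x i = ?y i" for i
      by (cases "i < ?n") (auto simp: sum_nonneg_eq_0_iff pad_def)
    have pos: "pad (parts nu) i > 0 \<longleftrightarrow> i < length (parts nu)" for i nu
      using parts_pos[of _ nu] by (auto simp: pad_def)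
    have len: "length (parts lam) = length (parts mu)"
      using pos[of lam] pos[of mu] eq by (metis linorder_neqE_nat of_nat_eq_iff order_less_irrefl)
    have "parts lam = parts mu"
      using len eq by (intro nth_equalityI) (auto simp: pad_def dest: spec split: if_splits, metis)
    then have "lam = mu" by (metis image_nat_of_pos_inject mset_parts)
    with assms(2) show False by simp
  qed
  with ge diff show ?thesis by linarith
qed

lemma finite_part_squares: "finite {lam. part_squares lam = q}"
proof (rule inj_on_finite)
  show "inj_on (image_mset nat_of_pos) {lam. part_squares lam = q}"
    by (simp add: inj_on_def image_nat_of_pos_inject)
  show "image_mset nat_of_pos ` {lam. part_squares lam = q} \<subseteq> mset ` {xs. set xs \<subseteq> {..q} \<and> length xs \<le> q}"
  proof
    fix X assume "X \<in> image_mset nat_of_pos ` {lam. part_squares lam = q}"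
    then obtain lam where lam: "X = image_mset nat_of_pos lam" "part_squares lam = q" by auto
    obtain xs where xs: "X = mset xs" by (metis ex_mset)
    have bound: "size Y \<le> square_sum Y \<and> (\<forall>x\<in>#Y. x \<le> square_sum Y)" if "0 \<notin># Y" for Y
      using that
    proof (induction Y)
      case (add y Y)
      then have "y > 0" by (metis gr0I union_single_eq_member)
      then have "y \<le> y\<^sup>2" "1 \<le> y\<^sup>2" by (simp_all add: power2_eq_square)
      with add show ?case by (auto intro: trans_le_add2)
    qed simp
    have "0 \<notin># X" using lam(1) by auto
    then have "set xs \<subseteq> {..q}" "length xs \<le> q"
      using bound[of X] lam(2) unfolding part_squares_def lam(1)[symmetric] xs by auto
    with xs show "X \<in> mset ` {xs. set xs \<subseteq> {..q} \<and> length xs \<le> q}" by blast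
  qed
qed (simp add: finite_lists_length_le)

section \<open>Jack functions as eigenvectors\<close>

text \<open>The filtration by sums of squares on symmetric functions. It replaces the spans of the
  monomial symmetric functions below a given partition.\<close>

definition squares_below :: "nat \<Rightarrow> 'a::comm_ring_1 fock \<Rightarrow> bool" where
  "squares_below q v \<longleftrightarrow> (\<forall>M. expand v M \<noteq> 0 \<longrightarrow> square_sum (shape M) < q)"

lemma monomial_sym_shape: "monomial_sym lam M = (if shape M = image_mset nat_of_pos lam then 1 else 0)"
  by (simp add: monomial_sym_def shape_def)

text \<open>Unitriangularity in the weaker order by sums of squares; the second occurrence of the coefficient
  on the right stands for an unknown value.\<close>

lemma jack_P_expand:
  fixes P :: "partition \<Rightarrow> 'a::field_char_0 fock"
  assumes "is_jack_P \<alpha> P"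
  shows "expand (P lam) M = (if shape M = image_mset nat_of_pos lam then 1
     else if square_sum (shape M) < part_squares lam then expand (P lam) M else 0)"
proof -
  from assms obtain u where u: "expand (P lam) M =
      monomial_sym lam M + (\<Sum>mu | dominates lam mu \<and> mu \<noteq> lam. u mu * monomial_sym mu M)" for M
    unfolding is_jack_P_def by meson
  have z: "(\<Sum>mu | dominates lam mu \<and> mu \<noteq> lam. u mu * monomial_sym mu M) = (0::'a)"
    if "\<not> square_sum (shape M) < part_squares lam"
  proof (rule sum.neutral, clarify)
    fix mu assume "dominates lam mu" "mu \<noteq> lam"
    then have "part_squares mu < part_squares lam" by (rule dominates_part_squares)
    with that have "shape M \<noteq> image_mset nat_of_pos mu" by (auto simp: part_squares_def)
    then show "u mu * monomial_sym mu M = 0" by (simp add: monomial_sym_shape)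
  qed
  have "\<not> square_sum (shape M) < part_squares lam" if "shape M = image_mset nat_of_pos lam"
    using that by (simp add: part_squares_def)
  with z u[of M] show ?thesis by (auto simp: monomial_sym_shape)
qed

lemma jack_P_squares_below: "is_jack_P \<alpha> P \<Longrightarrow> squares_below (Suc (part_squares lam)) (P lam)"
  unfolding squares_below_def
  by (metis jack_P_expand less_Suc_eq part_squares_def)

text \<open>A vector of the filtration is a combination of the Jack functions that it contains:
  subtract the Jack functions with the highest sum of squares, with the coefficients of \<open>v\<close> at the
  monomials of these shapes, and use induction. The shapes with a given sum of squares are finite in number.\<close>

lemma orthogonal_squares_below:
  fixes P :: "partition \<Rightarrow> 'a::field_char_0 fock"
  assumes P: "is_jack_P \<alpha> P"
    and "squares_below q v"
    and "\<And>mu. part_squares mu < q \<Longrightarrow> jack_inner \<alpha> u (P mu) = 0"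
  shows "jack_inner \<alpha> u v = 0"
  using assms(2,3)
proof (induction q arbitrary: v)
  case 0
  then have "v = 0" by (intro expand_inject) (auto simp: squares_below_def)
  then show ?case by simp
next
  case (Suc q)
  let ?T = "{lam. part_squares lam = q}"
  define w where "w = (\<Sum>mu\<in>?T. scale (expand v (monomial_of mu)) (P mu))"
  have "squares_below q (v - w)"
    unfolding squares_below_def
  proof (intro allI impI, rule ccontr)
    fix M assume nz: "expand (v - w) M \<noteq> 0" and "\<not> square_sum (shape M) < q"
    then have ge: "q \<le> square_sum (shape M)" by simp
    have w: "expand w M = (\<Sum>mu\<in>?T. expand v (monomial_of mu) * expand (P mu) M)"
      by (simp add: w_def expand_sum expand_scale)
    obtain nu where nu: "shape M = image_mset nat_of_pos nu"
      using shape_eq_partition by blast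
    have Pmu: "expand (P mu) M = (if mu = nu then 1 else 0)" if "mu \<in> ?T" for mu
      using ge that by (subst jack_P_expand[OF P]) (auto simp: nu image_nat_of_pos_inject)
    have w': "expand w M = (if nu \<in> ?T then expand v (monomial_of nu) else 0)"
    proof -
      have "expand w M = (\<Sum>mu\<in>?T. if mu = nu then expand v (monomial_of nu) else 0)"
        unfolding w by (intro sum.cong) (auto simp: Pmu)
      then show ?thesis using finite_part_squares[of q] by (simp add: sum.delta)
    qed
    show False
    proof (cases "nu \<in> ?T")
      case True
      have "expand v (monomial_of nu) = expand v M"
        by (rule expand_shape) (simp add: nu shape_monomial_of)
      with True w' nz show False by (simp add: expand_diff)
    next
      case False
      then have "square_sum (shape M) > q" using ge by (simp add: nu part_squares_def)
      then have "expand v M = 0" using Suc.prems(1) by (force simp: squares_below_def)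
      with False w' nz show False by (simp add: expand_diff)
    qed
  qed
  then have "jack_inner \<alpha> u (v - w) = 0"
    by (rule Suc.IH) (use Suc.prems(2) in simp)
  moreover have "jack_inner \<alpha> u w = 0"
    by (simp add: w_def jack_inner_sum_right jack_inner_scale_right Suc.prems(2))
  ultimately show ?case
    using jack_inner_add_right[of \<alpha> u "v - w" w] by simp
qed

lemma power_sum_partition_size: "power_sum_partition mu M \<noteq> (0 :: 'a::comm_semiring_1) \<Longrightarrow> size M = weight mu"
proof (induction mu arbitrary: M)
  case empty
  then show ?case by (auto simp: power_sum_partition_empty mseries_one_def split: if_splits)
next
  case (add k mu)
  let ?n = "nat_of_pos k"
  from add.prems obtain j where "shift (replicate_mset ?n j) (power_sum_partition mu) M \<noteq> (0 :: 'a)"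
    unfolding power_sum_partition_add_mset mseries_mult_power_sum[OF nat_of_pos_gt_0 finite_set_mset order_refl]
    by (rule sum.not_neutral_contains_not_neutral)
  then have sub: "replicate_mset ?n j \<subseteq># M" and "power_sum_partition mu (M - replicate_mset ?n j) \<noteq> (0 :: 'a)"
    by (auto simp: shift_def split: if_splits)
  from add.IH[OF this(2)] size_Diff_submset[OF sub] size_mset_mono[OF sub] show ?case by simp
qed

lemma square_sum_le: "square_sum X \<le> (\<Sum>\<^sub># X)\<^sup>2"
  by (induction X) (simp_all add: power2_sum)

lemma squares_below_exists: "\<exists>q. squares_below q v"
proof -
  let ?q = "Suc (\<Sum>mu\<in>Poly_Mapping.keys v. (weight mu)\<^sup>2)"
  have "square_sum (shape M) < ?q" if nz: "expand v M \<noteq> 0" for M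
  proof -
    from nz obtain mu where mu: "mu \<in> Poly_Mapping.keys v"
        and "Poly_Mapping.lookup v mu * power_sum_partition mu M \<noteq> 0"
      unfolding expand_def by (rule sum.not_neutral_contains_not_neutral)
    then have "power_sum_partition mu M \<noteq> (0::'a)" by auto
    then have "size M = weight mu" by (rule power_sum_partition_size)
    then have "square_sum (shape M) \<le> (weight mu)\<^sup>2"
      using square_sum_le[of "shape M"] by (simp add: size_eq_sum_shape)
    also have "\<dots> \<le> (\<Sum>mu\<in>Poly_Mapping.keys v. (weight mu)\<^sup>2)"
      by (rule member_le_sum) (use mu in auto)
    finally show ?thesis by simp
  qed
  then show ?thesis unfolding squares_below_def by blast
qed

text \<open>Two vectors of different degree can be brought to a common truncation.\<close>

lemma ham_truncation:
  fixes v :: "'a::field_char_0 fock"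
  assumes "deg_le (int d) v" "deg_le (int e) v"
  shows "ham \<alpha> d j v = ham \<alpha> e j v"
proof -
  have "ham \<alpha> d j v - ham \<alpha> e j v = 0"
    by (rule expand_inject) (simp add: expand_diff expand_ham assms)
  then show ?thesis by simp
qed

lemma ham_squares_below:
  assumes "deg_le (int d) v" "j \<le> 2" "squares_below q v"
  shows "squares_below q (ham \<alpha> d j v)"
  unfolding squares_below_def
proof (intro allI impI, rule ccontr)
  fix M assume nz: "expand (ham \<alpha> d j v) M \<noteq> 0" and "\<not> square_sum (shape M) < q"
  then have z: "expand v N = 0" if "square_sum (shape N) \<ge> square_sum (shape M)" for N
    using assms(3) that by (force simp: squares_below_def)
  have "expand (ham \<alpha> d j v) M = ham_eigenvalue \<alpha> j (shape M) * expand v M"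
    by (rule expand_ham_top[OF assms(1,2)]) (use z in auto)
  with z[of M] nz show False by simp
qed

text \<open>By triangularity the defect \<open>w\<close> lies strictly below \<open>P lam\<close> in the filtration, hence in the span of the
  Jack functions with a smaller sum of squares, and so it is orthogonal to all others. It is also
  orthogonal to a smaller one, \<open>P mu\<close>: by self-adjointness the operator can be moved to \<open>P mu\<close>, and it
  keeps \<open>P mu\<close> in the span of Jack functions orthogonal to \<open>P lam\<close>. Therefore \<open>w\<close> is orthogonal
  to everything.\<close>

lemma ham_jack:
  fixes P :: "partition \<Rightarrow> 'a::field_char_0 fock"
  assumes P: "is_jack_P \<alpha> P" and \<alpha>: "\<alpha> \<noteq> 0" and j: "j \<le> 2" and d: "deg_le (int d) (P lam)"
  shows "ham \<alpha> d j (P lam) = scale (ham_eigenvalue \<alpha> j (image_mset nat_of_pos lam)) (P lam)"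
proof -
  let ?e = "ham_eigenvalue \<alpha> j (image_mset nat_of_pos lam)"
  define w where "w = ham \<alpha> d j (P lam) - scale ?e (P lam)"
  have orth: "jack_inner \<alpha> (P mu) (P nu) = 0" if "mu \<noteq> nu" for mu nu
    using P that by (simp add: is_jack_P_def)
  have low: "squares_below (part_squares lam) w"
    unfolding squares_below_def
  proof (intro allI impI, rule ccontr)
    fix M assume nz: "expand w M \<noteq> 0" and "\<not> square_sum (shape M) < part_squares lam"
    then have ge: "part_squares lam \<le> square_sum (shape M)" by simp
    have "expand (P lam) N = 0" if "square_sum (shape N) > square_sum (shape M)" for N
      using jack_P_squares_below[OF P, of lam] ge that by (force simp: squares_below_def)
    then have "expand (ham \<alpha> d j (P lam)) M = ham_eigenvalue \<alpha> j (shape M) * expand (P lam) M"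
      by (rule expand_ham_top[OF d j])
    moreover have "shape M = image_mset nat_of_pos lam \<or> expand (P lam) M = 0"
      using jack_P_expand[OF P, of lam M] ge by (metis not_le)
    ultimately have "expand w M = 0" by (auto simp: w_def expand_diff expand_scale)
    with nz show False by simp
  qed
  have Pw: "jack_inner \<alpha> (P mu) w = 0" for mu
  proof (cases "part_squares mu < part_squares lam")
    case False
    show ?thesis
      by (rule orthogonal_squares_below[OF P low], rule orth) (use False in auto)
  next
    case True
    obtain e where e: "deg_le (int e) (P mu)" using deg_le_exists by blast
    let ?d = "max d e"
    have dl: "deg_le (int ?d) (P lam)" and dm: "deg_le (int ?d) (P mu)"
      using deg_le_mono[OF d, of "int ?d"] deg_le_mono[OF e, of "int ?d"] by auto
    have "jack_inner \<alpha> (P mu) (ham \<alpha> d j (P lam)) = jack_inner \<alpha> (ham \<alpha> ?d j (P mu)) (P lam)"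
      by (simp add: ham_truncation[OF d dl] jack_inner_ham)
    also have "\<dots> = jack_inner \<alpha> (P lam) (ham \<alpha> ?d j (P mu))" by (rule jack_inner_sym)
    also have "\<dots> = 0"
      by (rule orthogonal_squares_below[OF P ham_squares_below[OF dm j jack_P_squares_below[OF P]]], rule orth)
        (use True in auto)
    finally have "jack_inner \<alpha> (P mu) (ham \<alpha> d j (P lam)) = 0" .
    moreover have "jack_inner \<alpha> (P mu) (P lam) = 0" using True by (intro orth) auto
    ultimately show ?thesis
      using jack_inner_add_right[of \<alpha> "P mu" w "scale ?e (P lam)"] by (simp add: w_def jack_inner_scale_right)
  qed
  have "w = 0"
  proof (rule jack_inner_nondegenerate[OF \<alpha>])
    fix u :: "'a fock"
    obtain q where "squares_below q u" using squares_below_exists by blast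
    then show "jack_inner \<alpha> w u = 0"
      by (rule orthogonal_squares_below[OF P]) (metis Pw jack_inner_sym)
  qed
  then show ?thesis by (simp add: w_def)
qed

section \<open>The eigenvalues\<close>

text \<open>Power sums of the contents \<open>\<alpha> a' - l'\<close> of the cells of the diagram with rows \<open>xs\<close>.\<close>

definition content_sum :: "'a::field_char_0 \<Rightarrow> nat \<Rightarrow> nat list \<Rightarrow> 'a" where
  "content_sum \<alpha> k xs = (\<Sum>r<length xs. \<Sum>c<xs ! r. (\<alpha> * of_nat c - of_nat r) ^ k)"

lemma sum_mset_nth: "(\<Sum>x\<in>#mset xs. f x) = (\<Sum>r<length xs. f (xs ! r))"
proof -
  have "(\<Sum>x\<in>#mset xs. f x) = sum_list (map f xs)"
    by (metis mset_map sum_mset_sum_list)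
  then show ?thesis by (simp add: sum_list_sum_nth lessThan_atLeast0)
qed

lemma sum_triangle_swap: "(\<Sum>r<n. \<Sum>s\<in>{r<..<n}. F r s) = (\<Sum>s<n. \<Sum>r<s. F r s)"
  for F :: "nat \<Rightarrow> nat \<Rightarrow> 'a::comm_monoid_add"
proof -
  have "(\<Sum>r<n. \<Sum>s\<in>{r<..<n}. F r s) = (\<Sum>r<n. \<Sum>s<n. if r < s then F r s else 0)"
    by (intro sum.cong refl sum.mono_neutral_cong_left) auto
  also have "\<dots> = (\<Sum>s<n. \<Sum>r<n. if r < s then F r s else 0)" by (rule sum.swap)
  also have "\<dots> = (\<Sum>s<n. \<Sum>r<s. F r s)"
    by (intro sum.cong refl sum.mono_neutral_cong_right) auto
  finally show ?thesis .
qed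

context
  fixes xs :: "nat list" and \<alpha> :: "'a::field_char_0"
  assumes antimono: "\<And>i j. i \<le> j \<Longrightarrow> j < length xs \<Longrightarrow> xs ! j \<le> xs ! i"
begin

text \<open>Rows below the \<open>r\<close>-th are the parts that are smaller, up to parts of equal length, which
  contribute zero.\<close>

lemma sum_smaller:
  fixes F :: "nat \<Rightarrow> 'a"
  assumes "r < length xs"
  shows "(\<Sum>b\<in>#mset xs. if b < xs ! r then F (xs ! r) - F b else 0) = (\<Sum>s\<in>{r<..<length xs}. F (xs ! r) - F (xs ! s))"
  unfolding sum_mset_nth
proof (rule sum.mono_neutral_cong_right)
  show "\<forall>s\<in>{..<length xs} - {r<..<length xs}. (if xs ! s < xs ! r then F (xs ! r) - F (xs ! s) else 0) = 0"
  proof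
    fix s assume "s \<in> {..<length xs} - {r<..<length xs}"
    then have "xs ! r \<le> xs ! s" using assms by (intro antimono) auto
    then show "(if xs ! s < xs ! r then F (xs ! r) - F (xs ! s) else 0) = 0" by simp
  qed
next
  fix s assume "s \<in> {r<..<length xs}"
  then have "xs ! s \<le> xs ! r" by (intro antimono) auto
  then show "(if xs ! s < xs ! r then F (xs ! r) - F (xs ! s) else 0) = F (xs ! r) - F (xs ! s)"
    by (cases "xs ! s = xs ! r") auto
qed auto

lemma top_coeff_nth:
  assumes "r < length xs"
  shows "top_coeff \<alpha> (mset xs) (xs ! r) = of_nat (xs ! r) * (\<alpha> * of_nat (xs ! r) - of_nat r - 1)
     - (\<Sum>s\<in>{r<..<length xs}. of_nat (xs ! s))"
proof -
  have "(\<Sum>s\<in>{r<..<length xs}. of_nat (xs ! r)) = (of_nat (length xs) - of_nat r - 1) * (of_nat (xs ! r) :: 'a)"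
    using assms by (simp add: of_nat_diff)
  then show ?thesis
    unfolding top_coeff_def sum_smaller[OF assms, of of_nat] sum_subtractf
    by (simp only:) (simp add: algebra_simps)
qed

lemma ham_eigenvalue_0: "ham_eigenvalue \<alpha> 0 (mset xs) = (\<Sum>r<length xs. of_nat (xs ! r))"
  by (simp add: ham_eigenvalue_def sum_mset_nth)

lemma ham_eigenvalue_1: "ham_eigenvalue \<alpha> 1 (mset xs) =
  (\<Sum>r<length xs. of_nat (xs ! r) * (\<alpha> * of_nat (xs ! r) - 2 * of_nat r - 1))"
proof -
  have "(\<Sum>r<length xs. \<Sum>s\<in>{r<..<length xs}. of_nat (xs ! s)) = (\<Sum>s<length xs. of_nat s * (of_nat (xs ! s) :: 'a))"
    by (simp add: sum_triangle_swap)
  then have "ham_eigenvalue \<alpha> 1 (mset xs) =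
    (\<Sum>r<length xs. of_nat (xs ! r) * (\<alpha> * of_nat (xs ! r) - of_nat r - 1)) - (\<Sum>r<length xs. of_nat r * of_nat (xs ! r))"
    by (simp add: ham_eigenvalue_def sum_mset_nth top_coeff_nth sum_subtractf)
  then show ?thesis
    unfolding sum_subtractf[symmetric] by (simp add: algebra_simps)
qed

lemma sum_odd: "(\<Sum>r<n. 2 * of_nat r + 1) = (of_nat n ^ 2 :: 'a)"
  by (induction n) (simp_all add: power2_eq_square algebra_simps)

text \<open>The sum of \<open>\<lambda>_r\<close> times the total of the later parts is quadratic in the parts as a whole and not a sum
  over rows; it is the source of the square of \<open>\<Sum> \<lambda>_r\<close>, which \<open>content_sum_2\<close> compensates by the
  square of the energy.\<close>

lemma ham_eigenvalue_2: "ham_eigenvalue \<alpha> 2 (mset xs) =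
  (\<Sum>r<length xs. of_nat (xs ! r) * (\<alpha> * of_nat (xs ! r) - of_nat r - 1) * (\<alpha> * of_nat (xs ! r) - 2 * of_nat r - 1)
     + of_nat r ^ 2 * of_nat (xs ! r) + \<alpha> / 2 * of_nat (xs ! r) ^ 2)
   - \<alpha> / 2 * (\<Sum>r<length xs. of_nat (xs ! r)) ^ 2"
proof -
  let ?n = "length xs"
  let ?l = "\<lambda>r. of_nat (xs ! r) :: 'a"
  let ?t = "\<lambda>r. \<Sum>s\<in>{r<..<?n}. ?l s"
  let ?R = "\<lambda>r. top_coeff \<alpha> (mset xs) (xs ! r)"
  have "ham_eigenvalue \<alpha> 2 (mset xs) = (\<Sum>r<?n. (\<alpha> * ?l r - of_nat ?n) * ?R r + (\<Sum>s\<in>{r<..<?n}. ?R r - ?R s))"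
    unfolding ham_eigenvalue_def
    by (subst sum_mset_nth) (intro sum.cong refl, simp only: lessThan_iff sum_smaller[of _ "top_coeff \<alpha> (mset xs)"], simp)
  also have "\<dots> = (\<Sum>r<?n. (\<alpha> * ?l r - of_nat ?n) * ?R r) + (\<Sum>r<?n. (of_nat ?n - of_nat r - 1) * ?R r) - (\<Sum>r<?n. of_nat r * ?R r)"
  proof -
    have "(\<Sum>r<?n. \<Sum>s\<in>{r<..<?n}. ?R s) = (\<Sum>s<?n. of_nat s * ?R s)"
      by (simp add: sum_triangle_swap)
    moreover have "(\<Sum>r<?n. \<Sum>s\<in>{r<..<?n}. ?R r) = (\<Sum>r<?n. (of_nat ?n - of_nat r - 1) * ?R r)"
      by (intro sum.cong refl) (simp add: of_nat_diff)
    ultimately show ?thesis by (simp add: sum.distrib sum_subtractf)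
  qed
  also have "\<dots> = (\<Sum>r<?n. (\<alpha> * ?l r - 2 * of_nat r - 1) * ?R r)"
    unfolding sum.distrib[symmetric] sum_subtractf[symmetric]
    by (intro sum.cong refl) (simp add: algebra_simps)
  also have "\<dots> = (\<Sum>r<?n. ?l r * (\<alpha> * ?l r - of_nat r - 1) * (\<alpha> * ?l r - 2 * of_nat r - 1))
     - \<alpha> * (\<Sum>r<?n. ?l r * ?t r) + (\<Sum>r<?n. (2 * of_nat r + 1) * ?t r)"
    unfolding sum_distrib_left[of \<alpha>] sum.distrib[symmetric] sum_subtractf[symmetric]
    by (intro sum.cong refl) (simp add: top_coeff_nth algebra_simps)
  also have "(\<Sum>r<?n. (2 * of_nat r + 1) * ?t r) = (\<Sum>r<?n. of_nat r ^ 2 * ?l r)"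
    by (simp add: sum_distrib_left sum_triangle_swap sum_odd flip: sum_distrib_right)
  also have "(\<Sum>r<?n. ?l r * ?t r) = ((\<Sum>r<?n. ?l r) ^ 2 - (\<Sum>r<?n. ?l r ^ 2)) / 2"
  proof -
    have "(\<Sum>r<n. f r) ^ 2 = (\<Sum>r<n. f r ^ 2) + 2 * (\<Sum>s<n. \<Sum>r<s. f r * f s)" for n and f :: "nat \<Rightarrow> 'a"
      by (induction n) (simp_all add: power2_eq_square algebra_simps sum_distrib_left sum_distrib_right)
    from this[of ?l ?n] show ?thesis
      unfolding sum_distrib_left[of "?l r" for r] sum_triangle_swap by simp
  qed
  finally show ?thesis
    by (simp only: sum.distrib sum_distrib_left[symmetric]) (simp add: field_simps)
qed

lemma row_sum_1: "2 * (\<Sum>c<n. \<alpha> * of_nat c - of_nat r) = of_nat n * (\<alpha> * (of_nat n - 1) - 2 * of_nat r)"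
  by (induction n) (simp_all add: algebra_simps)

lemma row_sum_2: "6 * (\<Sum>c<n. (\<alpha> * of_nat c - of_nat r) ^ 2) =
    of_nat n * (\<alpha> ^ 2 * (of_nat n - 1) * (2 * of_nat n - 1) - 6 * \<alpha> * of_nat r * (of_nat n - 1) + 6 * of_nat r ^ 2)"
  by (induction n) (simp_all add: power2_eq_square algebra_simps)

lemma content_sum_0: "content_sum \<alpha> 0 xs = ham_eigenvalue \<alpha> 0 (mset xs)"
  by (simp add: content_sum_def ham_eigenvalue_0)

lemma content_sum_1:
  "2 * content_sum \<alpha> 1 xs = ham_eigenvalue \<alpha> 1 (mset xs) - (\<alpha> - 1) * ham_eigenvalue \<alpha> 0 (mset xs)"
proof -
  have "2 * content_sum \<alpha> 1 xs = (\<Sum>r<length xs. 2 * (\<Sum>c<xs ! r. (\<alpha> * of_nat c - of_nat r) ^ 1))"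
    unfolding content_sum_def by (rule sum_distrib_left)
  also have "\<dots> = (\<Sum>r<length xs. of_nat (xs ! r) * (\<alpha> * of_nat (xs ! r) - 2 * of_nat r - 1) - (\<alpha> - 1) * of_nat (xs ! r))"
    by (intro sum.cong refl) (simp only: power_one_right row_sum_1, simp add: algebra_simps)
  finally show ?thesis
    by (simp only: ham_eigenvalue_0 ham_eigenvalue_1 sum_distrib_left[of "\<alpha> - 1"] sum_subtractf)
qed

lemma content_sum_2:
  "3 * content_sum \<alpha> 2 xs = ham_eigenvalue \<alpha> 2 (mset xs) + \<alpha> / 2 * ham_eigenvalue \<alpha> 0 (mset xs) ^ 2
     - 3 / 2 * (\<alpha> - 1) * ham_eigenvalue \<alpha> 1 (mset xs) + (\<alpha> ^ 2 - 3 * \<alpha> + 1) / 2 * ham_eigenvalue \<alpha> 0 (mset xs)"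
proof -
  let ?l = "\<lambda>r. of_nat (xs ! r) :: 'a"
  let ?S = "\<lambda>r. \<Sum>c<xs ! r. (\<alpha> * of_nat c - of_nat r) ^ 2"
  let ?row = "\<lambda>r. (?l r * (\<alpha> * ?l r - of_nat r - 1) * (\<alpha> * ?l r - 2 * of_nat r - 1)
     + of_nat r ^ 2 * ?l r + \<alpha> / 2 * ?l r ^ 2) - 3 / 2 * (\<alpha> - 1) * (?l r * (\<alpha> * ?l r - 2 * of_nat r - 1))
     + (\<alpha> ^ 2 - 3 * \<alpha> + 1) / 2 * ?l r"
  have row: "3 * ?S r = ?row r" for r
  proof -
    have "3 * ?S r = (6 * ?S r) / 2" by simp
    also have "\<dots> = ?row r"
      unfolding row_sum_2 by (simp add: power2_eq_square field_simps)
    finally show ?thesis .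
  qed
  have "3 * content_sum \<alpha> 2 xs = (\<Sum>r<length xs. 3 * ?S r)"
    by (simp add: content_sum_def sum_distrib_left)
  then show ?thesis
    unfolding row ham_eigenvalue_0 ham_eigenvalue_1 ham_eigenvalue_2
    by (simp add: sum.distrib sum_subtractf sum_distrib_left)
qed

end

section \<open>Normal ordering\<close>

text \<open>The normally ordered polynomials that occur, named by the numbers of creation and annihilation
  operators. In each monomial the total index of the creation operators equals that of the
  annihilation operators; the exponent \<open>j\<close> is a weight by a power of this total.\<close>

definition normal11 :: "nat \<Rightarrow> nat \<Rightarrow> 'a::comm_ring_1 fock \<Rightarrow> 'a fock" where
  "normal11 d j v = (\<Sum>a=1..d. scale (of_nat a ^ j) (cr a (an a v)))"

definition normal21 :: "nat \<Rightarrow> nat \<Rightarrow> 'a::comm_ring_1 fock \<Rightarrow> 'a fock" where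
  "normal21 d j v = (\<Sum>a=1..d. \<Sum>b=1..d. \<Sum>c=1..d.
     if a + b = c then scale (of_nat c ^ j) (cr a (cr b (an c v))) else 0)"

definition normal12 :: "nat \<Rightarrow> nat \<Rightarrow> 'a::comm_ring_1 fock \<Rightarrow> 'a fock" where
  "normal12 d j v = (\<Sum>a=1..d. \<Sum>b=1..d. \<Sum>c=1..d.
     if a = b + c then scale (of_nat a ^ j) (cr a (an b (an c v))) else 0)"

definition normal31 :: "nat \<Rightarrow> 'a::comm_ring_1 fock \<Rightarrow> 'a fock" where
  "normal31 d v = (\<Sum>a=1..d. \<Sum>b=1..d. \<Sum>c=1..d. \<Sum>e=1..d.
     if a + b + c = e then cr a (cr b (cr c (an e v))) else 0)"

definition normal22 :: "nat \<Rightarrow> 'a::comm_ring_1 fock \<Rightarrow> 'a fock" where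
  "normal22 d v = (\<Sum>a=1..d. \<Sum>b=1..d. \<Sum>c=1..d. \<Sum>e=1..d.
     if a + b = c + e then cr a (cr b (an c (an e v))) else 0)"

definition normal13 :: "nat \<Rightarrow> 'a::comm_ring_1 fock \<Rightarrow> 'a fock" where
  "normal13 d v = (\<Sum>a=1..d. \<Sum>b=1..d. \<Sum>c=1..d. \<Sum>e=1..d.
     if a = b + c + e then cr a (an b (an c (an e v))) else 0)"

definition normal22_diag :: "nat \<Rightarrow> 'a::comm_ring_1 fock \<Rightarrow> 'a fock" where
  "normal22_diag d v = (\<Sum>a=1..d. \<Sum>b=1..d. cr a (cr b (an a (an b v))))"

lemma if_zero_linear:
  "cr n (if Q then x else 0) = (if Q then cr n x else 0)"
  "an n (if Q then x else 0) = (if Q then an n x else 0)"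
  "scale c (if Q then x else 0) = (if Q then scale c x else 0)"
  by auto

lemmas fock_linear = cr_add cr_sum cr_scale an_add an_sum an_scale scale_add_right scale_sum
  scale_scale if_zero_linear

lemma if_zero_sum: "(if Q then sum f A else 0) = (\<Sum>x\<in>A. if Q then f x else 0)"
  by simp

lemma scale_two: "scale 2 v = v + v"
  using scale_add_left[of 1 1 v] by simp

lemma scale_sum_left: "scale (sum f A) v = (\<Sum>x\<in>A. scale (f x) v)"
  by (induction A rule: infinite_finite_induct) (simp_all add: scale_add_left)

lemma sum_collapse:
  fixes f :: "nat \<Rightarrow> 'b::comm_monoid_add"
  assumes "finite S"
  shows "(\<Sum>m\<in>S. if m = x then f m else 0) = (if x \<in> S then f x else 0)"
    "(\<Sum>m\<in>S. if x = m then f m else 0) = (if x \<in> S then f x else 0)"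
  using assms by (simp_all add: sum.delta sum.delta')

lemma ham_0: "ham \<alpha> d 0 v = normal11 d 0 v"
  by (simp add: ham_def normal11_def)

text \<open>The square of the energy is needed to cancel \<^const>\<open>normal22_diag\<close> in \<open>H 2\<close>.\<close>

lemma ham_0_twice: "ham \<alpha> d 0 (ham \<alpha> d 0 v) = normal22_diag d v + normal11 d 1 v"
proof -
  have "ham \<alpha> d 0 (ham \<alpha> d 0 v) = (\<Sum>a=1..d. \<Sum>b=1..d. cr a (cr b (an a (an b v))) +
      (if a = b then scale (of_nat a) (cr a (an b v)) else 0))"
    by (auto simp: ham_0 normal11_def cr_sum an_sum an_cr cr_add cr_scale intro!: sum.cong)
  also have "\<dots> = normal22_diag d v + (\<Sum>a=1..d. \<Sum>b=1..d. if a = b then scale (of_nat a) (cr a (an b v)) else 0)"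
    by (simp add: sum.distrib normal22_diag_def)
  also have "(\<Sum>a=1..d. \<Sum>b=1..d. if a = b then scale (of_nat a) (cr a (an b v)) else 0) = normal11 d 1 v"
    unfolding normal11_def by (intro sum.cong refl) (simp add: sum.delta')
  finally show ?thesis .
qed

lemma lax_add: "lax \<alpha> d (\<lambda>n. f n + g n) n = lax \<alpha> d f n + lax \<alpha> d g n"
proof -
  have "(if Q then x + y else 0) = (if Q then x else 0) + (if Q then y else 0)" for Q and x y :: "'a fock"
    by simp
  then show ?thesis
    unfolding lax_def fock_linear by (simp only: sum.distrib) (simp add: algebra_simps)
qed

text \<open>The three parts of the Lax matrix; \<open>H 2\<close> is the sum over the nine paths of two steps.\<close>

definition lax_diag :: "'a::comm_ring_1 \<Rightarrow> nat \<Rightarrow> (nat \<Rightarrow> 'a fock) \<Rightarrow> nat \<Rightarrow> 'a fock" where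
  "lax_diag \<alpha> d g n = scale ((\<alpha> - 1) * of_nat n) (g n)"

definition lax_up :: "'a::comm_ring_1 \<Rightarrow> nat \<Rightarrow> (nat \<Rightarrow> 'a fock) \<Rightarrow> nat \<Rightarrow> 'a fock" where
  "lax_up \<alpha> d g n = (\<Sum>m=1..d. \<Sum>k=1..d. if m + k = n then scale \<alpha> (an k (g m)) else 0)"

definition lax_down :: "'a::comm_ring_1 \<Rightarrow> nat \<Rightarrow> (nat \<Rightarrow> 'a fock) \<Rightarrow> nat \<Rightarrow> 'a fock" where
  "lax_down \<alpha> d g n = (\<Sum>m=1..d. \<Sum>r=1..d. if m = n + r then cr r (g m) else 0)"

lemma lax_split: "lax \<alpha> d g n = lax_diag \<alpha> d g n + lax_up \<alpha> d g n + lax_down \<alpha> d g n"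
  by (simp add: lax_def lax_diag_def lax_up_def lax_down_def)

text \<open>Summation over the choices of the marked variable.\<close>

definition unmark :: "nat \<Rightarrow> (nat \<Rightarrow> 'a::comm_ring_1 fock) \<Rightarrow> 'a fock" where
  "unmark d g = (\<Sum>n=1..d. cr n (g n))"

lemma unmark_add: "unmark d (\<lambda>n. f n + g n) = unmark d f + unmark d g"
  by (simp add: unmark_def cr_add sum.distrib)

lemma ham_1: "ham \<alpha> d 1 v = scale (\<alpha> - 1) (normal11 d 1 v) + scale \<alpha> (normal12 d 0 v) + normal21 d 0 v"
proof -
  let ?g = "\<lambda>n. an n v"
  have "ham \<alpha> d 1 v = unmark d (lax_diag \<alpha> d ?g) + unmark d (lax_up \<alpha> d ?g) + unmark d (lax_down \<alpha> d ?g)"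
    unfolding unmark_add[symmetric] lax_split[symmetric] by (simp add: ham_def unmark_def)
  also have "unmark d (lax_diag \<alpha> d ?g) = scale (\<alpha> - 1) (normal11 d 1 v)"
    by (simp add: unmark_def lax_diag_def normal11_def fock_linear)
  also have "unmark d (lax_up \<alpha> d ?g) = scale \<alpha> (normal12 d 0 v)"
    unfolding unmark_def lax_up_def normal12_def fock_linear
    by (intro sum.cong refl) (auto simp: an_commute)
  also have "unmark d (lax_down \<alpha> d ?g) = normal21 d 0 v"
    unfolding unmark_def lax_down_def normal21_def fock_linear
    by (rule sum.cong[OF refl], subst sum.swap, intro sum.cong refl) auto
  finally show ?thesis .
qed

text \<open>On a family symmetric in two summation indices whose sum is fixed, the weight \<open>m\<close> may be
  replaced by half of the sum.\<close>

lemma symmetrize_weight: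
  fixes f :: "nat \<Rightarrow> nat \<Rightarrow> nat \<Rightarrow> 'a::comm_ring_1 fock"
  assumes "\<And>n m k. f n m k = f n k m"
  shows "scale 2 (\<Sum>n=1..d. \<Sum>m=1..d. \<Sum>k=1..d. if m + k = n then scale (of_nat m) (f n m k) else 0) =
    (\<Sum>n=1..d. \<Sum>m=1..d. \<Sum>k=1..d. if m + k = n then scale (of_nat n) (f n m k) else 0)"
    (is "scale 2 (\<Sum>n=1..d. ?X n) = (\<Sum>n=1..d. ?Y n)")
  unfolding scale_sum[of 2 "?X"]
proof (rule sum.cong[OF refl])
  fix n
  have "?X n = (\<Sum>k=1..d. \<Sum>m=1..d. if m + k = n then scale (of_nat m) (f n m k) else 0)"
    by (rule sum.swap)
  also have "\<dots> = (\<Sum>m=1..d. \<Sum>k=1..d. if m + k = n then scale (of_nat k) (f n m k) else 0)"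
    by (intro sum.cong refl) (simp add: add.commute assms[of n])
  finally have "scale 2 (?X n) = ?X n + (\<Sum>m=1..d. \<Sum>k=1..d. if m + k = n then scale (of_nat k) (f n m k) else 0)"
    by (simp only: scale_two)
  also have "\<dots> = ?Y n"
    unfolding sum.distrib[symmetric] by (intro sum.cong refl) (auto simp: scale_add_left)
  finally show "scale 2 (?X n) = ?Y n" .
qed

text \<open>Paths that begin with a diagonal step.\<close>

lemma unmark_lax_diag:
  fixes v :: "'a::comm_ring_1 fock" and \<alpha> :: 'a and d :: nat
  defines "y \<equiv> lax_diag \<alpha> d (\<lambda>n. an n v)"
  shows "unmark d (lax_diag \<alpha> d y) = scale ((\<alpha> - 1)\<^sup>2) (normal11 d 2 v)"
    and "scale 2 (unmark d (lax_up \<alpha> d y)) = scale (\<alpha> * (\<alpha> - 1)) (normal12 d 1 v)"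
    and "unmark d (lax_down \<alpha> d y) = scale (\<alpha> - 1) (normal21 d 1 v)"
proof -
  show "unmark d (lax_diag \<alpha> d y) = scale ((\<alpha> - 1)\<^sup>2) (normal11 d 2 v)"
    by (simp add: unmark_def lax_diag_def y_def normal11_def fock_linear power2_eq_square algebra_simps)
  have "unmark d (lax_up \<alpha> d y) = scale (\<alpha> * (\<alpha> - 1)) (\<Sum>n=1..d. \<Sum>m=1..d. \<Sum>k=1..d.
      if m + k = n then scale (of_nat m) (cr n (an k (an m v))) else 0)"
    unfolding unmark_def lax_up_def lax_diag_def y_def fock_linear
    by (intro sum.cong refl) (auto simp: algebra_simps)
  then have "scale 2 (unmark d (lax_up \<alpha> d y)) = scale (\<alpha> * (\<alpha> - 1)) (scale 2 (\<Sum>n=1..d. \<Sum>m=1..d. \<Sum>k=1..d.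
      if m + k = n then scale (of_nat m) (cr n (an k (an m v))) else 0))"
    by (simp only: scale_scale mult.commute)
  also have "\<dots> = scale (\<alpha> * (\<alpha> - 1)) (normal12 d 1 v)"
    by (subst symmetrize_weight) (auto simp: an_commute normal12_def intro!: arg_cong[of _ _ "scale _"] sum.cong)
  finally show "scale 2 (unmark d (lax_up \<alpha> d y)) = scale (\<alpha> * (\<alpha> - 1)) (normal12 d 1 v)" .
  show "unmark d (lax_down \<alpha> d y) = scale (\<alpha> - 1) (normal21 d 1 v)"
    unfolding unmark_def lax_down_def lax_diag_def y_def normal21_def fock_linear
    by (rule sum.cong[OF refl], subst sum.swap, intro sum.cong refl) auto
qed

text \<open>Paths that begin with a step up. A step up beyond \<open>d\<close> would be lost in the truncation, but
  it would annihilate \<open>v\<close>.\<close>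

lemma unmark_lax_up:
  fixes v :: "'a::comm_ring_1 fock" and \<alpha> :: 'a and d :: nat
  assumes v: "deg_le (int d) v"
  defines "y \<equiv> lax_up \<alpha> d (\<lambda>n. an n v)"
  shows "unmark d (lax_diag \<alpha> d y) = scale (\<alpha> * (\<alpha> - 1)) (normal12 d 1 v)"
    and "unmark d (lax_up \<alpha> d y) = scale (\<alpha>\<^sup>2) (normal13 d v)"
    and "unmark d (lax_down \<alpha> d y) = scale \<alpha> (normal22 d v)"
proof -
  show "unmark d (lax_diag \<alpha> d y) = scale (\<alpha> * (\<alpha> - 1)) (normal12 d 1 v)"
    unfolding unmark_def lax_up_def lax_diag_def y_def normal12_def fock_linear
    by (intro sum.cong refl) (auto simp: algebra_simps an_commute)
  have "unmark d (lax_up \<alpha> d y) = (\<Sum>n=1..d. \<Sum>m=1..d. \<Sum>k=1..d. \<Sum>b=1..d. \<Sum>c=1..d.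
     if m = b + c then if m + k = n then scale (\<alpha>\<^sup>2) (cr n (an k (an c (an b v)))) else 0 else 0)"
    unfolding unmark_def lax_up_def y_def fock_linear if_zero_sum power2_eq_square
    by (intro sum.cong refl) auto
  also have "\<dots> = (\<Sum>n=1..d. \<Sum>k=1..d. \<Sum>b=1..d. \<Sum>c=1..d. \<Sum>m=1..d.
     if m = b + c then if m + k = n then scale (\<alpha>\<^sup>2) (cr n (an k (an c (an b v)))) else 0 else 0)"
    by (rule sum.cong[OF refl], subst sum.swap, rule sum.cong[OF refl], subst sum.swap,
        rule sum.cong[OF refl], rule sum.swap)
  also have "\<dots> = scale (\<alpha>\<^sup>2) (normal13 d v)"
    unfolding normal13_def fock_linear
  proof (intro sum.cong refl)
    fix n k b c assume "n \<in> {1..d}" "k \<in> {1..d}" "b \<in> {1..d}" "c \<in> {1..d}"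
    then show "(\<Sum>m=1..d. if m = b + c then if m + k = n then scale (\<alpha>\<^sup>2) (cr n (an k (an c (an b v)))) else 0 else 0) =
      (if n = k + b + c then scale (\<alpha>\<^sup>2) (cr n (an k (an b (an c v)))) else 0)"
      by (subst sum_collapse) (auto simp: an_commute)
  qed
  finally show "unmark d (lax_up \<alpha> d y) = scale (\<alpha>\<^sup>2) (normal13 d v)" .
  have "unmark d (lax_down \<alpha> d y) = (\<Sum>n=1..d. \<Sum>m=1..d. \<Sum>r=1..d. \<Sum>b=1..d. \<Sum>c=1..d.
     if m = n + r then if b + c = m then scale \<alpha> (cr n (cr r (an c (an b v)))) else 0 else 0)"
    unfolding unmark_def lax_up_def lax_down_def y_def fock_linear if_zero_sum
    by (intro sum.cong refl)
  also have "\<dots> = (\<Sum>n=1..d. \<Sum>r=1..d. \<Sum>b=1..d. \<Sum>c=1..d. \<Sum>m=1..d.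
     if m = n + r then if b + c = m then scale \<alpha> (cr n (cr r (an c (an b v)))) else 0 else 0)"
    by (rule sum.cong[OF refl], subst sum.swap, rule sum.cong[OF refl], subst sum.swap,
        rule sum.cong[OF refl], rule sum.swap)
  also have "\<dots> = scale \<alpha> (normal22 d v)"
    unfolding normal22_def fock_linear
  proof (intro sum.cong refl)
    fix n r b c assume i: "n \<in> {1..d}" "r \<in> {1..d}" "b \<in> {1..d}" "c \<in> {1..d}"
    have z: "an c (an b v) = 0" if "b + c > d"
      by (rule deg_le_neg[OF deg_le_an[OF _ deg_le_an[OF _ v]]]) (use i that in auto)
    show "(\<Sum>m=1..d. if m = n + r then if b + c = m then scale \<alpha> (cr n (cr r (an c (an b v)))) else 0 else 0) =
      (if n + r = b + c then scale \<alpha> (cr n (cr r (an b (an c v)))) else 0)"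
      using i z by (subst sum_collapse) (auto simp: an_commute)
  qed
  finally show "unmark d (lax_down \<alpha> d y) = scale \<alpha> (normal22 d v)" .
qed

text \<open>In the path that first goes down and then up, the constraint that the intermediate
  index is positive is \<open>l < n\<close>; exchanging both pairs of indices turns it into \<open>n < l\<close>, so
  that twice the sum is the full sum without the terms with \<open>l = n\<close>.\<close>

lemma symmetrize_constraint:
  fixes f :: "nat \<Rightarrow> nat \<Rightarrow> nat \<Rightarrow> nat \<Rightarrow> 'a::comm_ring_1 fock"
  assumes "\<And>n r l k. f n r l k = f r n k l"
  shows "scale 2 (\<Sum>n=1..d. \<Sum>r=1..d. \<Sum>l=1..d. \<Sum>k=1..d. if n + r = l + k \<and> l < n then f n r l k else 0) +
     (\<Sum>n=1..d. \<Sum>r=1..d. f n r n r) =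
    (\<Sum>n=1..d. \<Sum>r=1..d. \<Sum>l=1..d. \<Sum>k=1..d. if n + r = l + k then f n r l k else 0)"
proof -
  let ?S = "\<lambda>Q. \<Sum>n=1..d. \<Sum>r=1..d. \<Sum>l=1..d. \<Sum>k=1..d. if n + r = l + k \<and> Q l n then f n r l k else 0"
  have "?S (<) = (\<Sum>r=1..d. \<Sum>n=1..d. \<Sum>k=1..d. \<Sum>l=1..d. if n + r = l + k \<and> l < n then f n r l k else 0)"
    by (rule trans[OF sum.swap], rule sum.cong[OF refl], rule sum.cong[OF refl], rule sum.swap)
  also have "\<dots> = ?S (\<lambda>l n. n < l)"
  proof (intro sum.cong refl)
    fix a b c e :: nat
    have "b + a = e + c \<and> e < b \<longleftrightarrow> a + b = c + e \<and> a < c" by linarith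
    then show "(if b + a = e + c \<and> e < b then f b a e c else 0) = (if a + b = c + e \<and> a < c then f a b c e else 0)"
      using assms[of b a e c] by simp
  qed
  finally have "scale 2 (?S (<)) = ?S (<) + ?S (\<lambda>l n. n < l)"
    by (simp only: scale_two)
  moreover have "(\<Sum>n=1..d. \<Sum>r=1..d. f n r n r) = ?S (=)"
  proof (intro sum.cong refl)
    fix n r assume nr: "n \<in> {1..d}" "r \<in> {1..d}"
    have "(\<Sum>l=1..d. \<Sum>k=1..d. if n + r = l + k \<and> l = n then f n r l k else 0) =
      (\<Sum>l=1..d. if l = n then f n r l r else 0)"
    proof (intro sum.cong refl)
      fix l
      have "(\<Sum>k=1..d. if n + r = l + k \<and> l = n then f n r l k else 0) =
        (\<Sum>k=1..d. if k = r then if l = n then f n r l k else 0 else 0)"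
        by (intro sum.cong) auto
      then show "(\<Sum>k=1..d. if n + r = l + k \<and> l = n then f n r l k else 0) = (if l = n then f n r l r else 0)"
        using nr by (simp add: sum_collapse)
    qed
    then show "f n r n r = (\<Sum>l=1..d. \<Sum>k=1..d. if n + r = l + k \<and> l = n then f n r l k else 0)"
      using nr by (simp add: sum_collapse)
  qed
  ultimately have "scale 2 (?S (<)) + (\<Sum>n=1..d. \<Sum>r=1..d. f n r n r) = ?S (<) + ?S (\<lambda>l n. n < l) + ?S (=)"
    by simp
  also have "\<dots> = (\<Sum>n=1..d. \<Sum>r=1..d. \<Sum>l=1..d. \<Sum>k=1..d. if n + r = l + k then f n r l k else 0)"
    unfolding sum.distrib[symmetric] by (intro sum.cong refl) auto
  finally show ?thesis .
qed

lemma sum_index_below: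
  fixes n d :: nat
  assumes "n \<le> d"
  shows "2 * (\<Sum>m=1..d. \<Sum>l=1..d. if m + l = n then l else 0) + n = n\<^sup>2"
proof -
  have "(\<Sum>m=1..d. \<Sum>l=1..d. if m + l = n then l else 0) = (\<Sum>l=1..d. \<Sum>m=1..d. if m = n - l then if l < n then l else 0 else 0)"
    by (subst sum.swap) (intro sum.cong refl, auto)
  also have "\<dots> = (\<Sum>l=1..d. if l < n then l else 0)"
    using assms by (intro sum.cong refl, subst sum_collapse) auto
  also have "\<dots> = (\<Sum>l<n. l)"
    using assms by (intro sum.mono_neutral_cong) auto
  also have "2 * \<dots> + n = n\<^sup>2"
    by (induction n) (simp_all add: power2_eq_square)
  finally show ?thesis .
qed

text \<open>Paths that begin with a step down. Only the path that continues upwards needs reordering: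
  the commutator yields the terms with \<open>l = r\<close>, which close up with weight \<open>1 + \<dots> + (n - 1)\<close>, half
  of \<open>n^2 - n\<close>. Its normally ordered part is governed by \<open>symmetrize_constraint\<close>.\<close>

lemma unmark_lax_down:
  fixes v :: "'a::comm_ring_1 fock" and \<alpha> :: 'a and d :: nat
  defines "y \<equiv> lax_down \<alpha> d (\<lambda>n. an n v)"
  shows "scale 2 (unmark d (lax_diag \<alpha> d y)) = scale (\<alpha> - 1) (normal21 d 1 v)"
    and "scale 2 (unmark d (lax_up \<alpha> d y)) + scale \<alpha> (normal22_diag d v) + scale \<alpha> (normal11 d 1 v) = scale \<alpha> (normal22 d v) + scale \<alpha> (normal11 d 2 v)"
    and "unmark d (lax_down \<alpha> d y) = normal31 d v"
proof -
  have "unmark d (lax_diag \<alpha> d y) = (\<Sum>n=1..d. \<Sum>k=1..d. \<Sum>r=1..d.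
      if n + r = k then scale ((\<alpha> - 1) * of_nat n) (cr n (cr r (an k v))) else 0)"
    unfolding unmark_def lax_down_def lax_diag_def y_def fock_linear
    by (intro sum.cong refl) auto
  also have "\<dots> = scale (\<alpha> - 1) (\<Sum>k=1..d. \<Sum>n=1..d. \<Sum>r=1..d.
      if n + r = k then scale (of_nat n) (cr n (cr r (an k v))) else 0)"
    unfolding fock_linear by (rule sum.swap)
  finally have "scale 2 (unmark d (lax_diag \<alpha> d y)) = scale (\<alpha> - 1) (scale 2 (\<Sum>k=1..d. \<Sum>n=1..d. \<Sum>r=1..d.
      if n + r = k then scale (of_nat n) (cr n (cr r (an k v))) else 0))"
    by (simp only: scale_scale mult.commute)
  also have "\<dots> = scale (\<alpha> - 1) (\<Sum>k=1..d. \<Sum>n=1..d. \<Sum>r=1..d.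
      if n + r = k then scale (of_nat k) (cr n (cr r (an k v))) else 0)"
    by (subst symmetrize_weight) (simp_all add: cr_commute)
  also have "(\<Sum>k=1..d. \<Sum>n=1..d. \<Sum>r=1..d. if n + r = k then scale (of_nat k) (cr n (cr r (an k v))) else 0) = normal21 d 1 v"
    unfolding normal21_def power_one_right
    by (rule trans[OF sum.swap], rule sum.cong[OF refl], rule sum.swap)
  finally show "scale 2 (unmark d (lax_diag \<alpha> d y)) = scale (\<alpha> - 1) (normal21 d 1 v)" .

  have "unmark d (lax_down \<alpha> d y) = (\<Sum>n=1..d. \<Sum>m=1..d. \<Sum>r=1..d. \<Sum>e=1..d. \<Sum>c=1..d.
     if m = n + r then if e = m + c then cr n (cr r (cr c (an e v))) else 0 else 0)"
    unfolding unmark_def lax_down_def y_def fock_linear if_zero_sum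
    by (intro sum.cong refl)
  also have "\<dots> = (\<Sum>n=1..d. \<Sum>r=1..d. \<Sum>c=1..d. \<Sum>e=1..d. \<Sum>m=1..d.
     if m = n + r then if e = m + c then cr n (cr r (cr c (an e v))) else 0 else 0)"
    by (rule sum.cong[OF refl], subst sum.swap, rule sum.cong[OF refl], subst sum.swap,
        subst (2) sum.swap, subst sum.swap, rule sum.cong[OF refl], rule sum.cong[OF refl], rule refl)
  also have "\<dots> = normal31 d v"
    unfolding normal31_def
    by (intro sum.cong refl, subst sum_collapse) auto
  finally show "unmark d (lax_down \<alpha> d y) = normal31 d v" .

  have "unmark d (lax_up \<alpha> d y) = (\<Sum>n=1..d. \<Sum>m=1..d. \<Sum>l=1..d. \<Sum>k=1..d. \<Sum>r=1..d.
     if m + l = n then if k = m + r then scale \<alpha> (cr n (cr r (an l (an k v))) +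
       (if l = r then scale (of_nat l) (cr n (an k v)) else 0)) else 0 else 0)"
    unfolding unmark_def lax_up_def lax_down_def y_def fock_linear if_zero_sum
    by (intro sum.cong refl) (auto simp: an_cr fock_linear)
  also have "\<dots> = (\<Sum>n=1..d. \<Sum>m=1..d. \<Sum>l=1..d. \<Sum>k=1..d. \<Sum>r=1..d.
     if m + l = n then if k = m + r then scale \<alpha> (cr n (cr r (an l (an k v)))) else 0 else 0)
   + (\<Sum>n=1..d. \<Sum>m=1..d. \<Sum>l=1..d. \<Sum>k=1..d. \<Sum>r=1..d.
     if m + l = n then if k = m + r then if l = r then scale (\<alpha> * of_nat l) (cr n (an k v)) else 0 else 0 else 0)"
    (is "_ = ?A + ?B")
    unfolding sum.distrib[symmetric] by (intro sum.cong refl) (auto simp: fock_linear)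
  finally have AB: "unmark d (lax_up \<alpha> d y) = ?A + ?B" .
  have "?A = scale \<alpha> (\<Sum>n=1..d. \<Sum>r=1..d. \<Sum>l=1..d. \<Sum>k=1..d.
      if n + r = l + k \<and> l < n then cr n (cr r (an l (an k v))) else 0)"
  proof -
    have "?A = (\<Sum>n=1..d. \<Sum>l=1..d. \<Sum>k=1..d. \<Sum>r=1..d. \<Sum>m=1..d.
       if m + l = n then if k = m + r then scale \<alpha> (cr n (cr r (an l (an k v)))) else 0 else 0)"
      by (rule sum.cong[OF refl], subst sum.swap, rule sum.cong[OF refl], subst sum.swap,
        rule sum.cong[OF refl], rule sum.swap)
    also have "\<dots> = (\<Sum>n=1..d. \<Sum>l=1..d. \<Sum>k=1..d. \<Sum>r=1..d.
       if n + r = l + k \<and> l < n then scale \<alpha> (cr n (cr r (an l (an k v)))) else 0)"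
    proof (intro sum.cong refl)
      fix n l k r assume i: "n \<in> {1..d}" "l \<in> {1..d}" "k \<in> {1..d}" "r \<in> {1..d}"
      have "(\<Sum>m=1..d. if m + l = n then if k = m + r then scale \<alpha> (cr n (cr r (an l (an k v)))) else 0 else 0) =
        (\<Sum>m=1..d. if m = n - l then if n + r = l + k \<and> l < n then scale \<alpha> (cr n (cr r (an l (an k v)))) else 0 else 0)"
        using i by (intro sum.cong) auto
      then show "(\<Sum>m=1..d. if m + l = n then if k = m + r then scale \<alpha> (cr n (cr r (an l (an k v)))) else 0 else 0) =
        (if n + r = l + k \<and> l < n then scale \<alpha> (cr n (cr r (an l (an k v)))) else 0)"
        using i by (subst (asm) sum_collapse) auto
    qed
    also have "\<dots> = (\<Sum>n=1..d. \<Sum>r=1..d. \<Sum>l=1..d. \<Sum>k=1..d.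
       if n + r = l + k \<and> l < n then scale \<alpha> (cr n (cr r (an l (an k v)))) else 0)"
      by (rule sum.cong[OF refl], rule trans, rule sum.cong[OF refl], rule sum.swap, rule sum.swap)
    finally show ?thesis by (simp only: fock_linear)
  qed
  then have A: "scale 2 ?A + scale \<alpha> (normal22_diag d v) = scale \<alpha> (normal22 d v)"
  proof -
    let ?R = "\<Sum>n=1..d. \<Sum>r=1..d. \<Sum>l=1..d. \<Sum>k=1..d.
      if n + r = l + k \<and> l < n then cr n (cr r (an l (an k v))) else 0"
    have "scale 2 ?R + normal22_diag d v = normal22 d v"
      unfolding normal22_diag_def normal22_def
    proof (rule symmetrize_constraint)
      fix n r l k
      show "cr n (cr r (an l (an k v))) = cr r (cr n (an k (an l v)))"
        by (simp only: cr_commute[of n r] an_commute[of l k])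
    qed
    then have "scale \<alpha> (scale 2 ?R) + scale \<alpha> (normal22_diag d v) = scale \<alpha> (normal22 d v)"
      by (simp only: scale_add_right[symmetric])
    moreover assume "?A = scale \<alpha> ?R"
    ultimately show ?thesis by (simp only: scale_scale mult.commute)
  qed
  have B: "scale 2 ?B + scale \<alpha> (normal11 d 1 v) = scale \<alpha> (normal11 d 2 v)"
  proof -
    have "?B = (\<Sum>n=1..d. scale (\<alpha> * of_nat (\<Sum>m=1..d. \<Sum>l=1..d. if m + l = n then l else 0)) (cr n (an n v)))"
    proof (rule sum.cong[OF refl])
      fix n assume n: "n \<in> {1..d}"
      have "(\<Sum>m=1..d. \<Sum>l=1..d. \<Sum>k=1..d. \<Sum>r=1..d.
         if m + l = n then if k = m + r then if l = r then scale (\<alpha> * of_nat l) (cr n (an k v)) else 0 else 0 else 0) =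
        (\<Sum>m=1..d. \<Sum>l=1..d. scale (\<alpha> * of_nat (if m + l = n then l else 0)) (cr n (an n v)))"
      proof (intro sum.cong refl)
        fix m l assume i: "m \<in> {1..d}" "l \<in> {1..d}"
        have "(\<Sum>k=1..d. \<Sum>r=1..d.
           if m + l = n then if k = m + r then if l = r then scale (\<alpha> * of_nat l) (cr n (an k v)) else 0 else 0 else 0) =
          (\<Sum>k=1..d. \<Sum>r=1..d. if l = r then
           if k = n then if m + l = n then scale (\<alpha> * of_nat l) (cr n (an k v)) else 0 else 0 else 0)"
          by (intro sum.cong refl) auto
        also have "\<dots> = (\<Sum>k=1..d. if k = n then if m + l = n then scale (\<alpha> * of_nat l) (cr n (an k v)) else 0 else 0)"
          using i by (intro sum.cong refl, subst sum_collapse) auto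
        also have "\<dots> = scale (\<alpha> * of_nat (if m + l = n then l else 0)) (cr n (an n v))"
          using n by (subst sum_collapse) auto
        finally show "(\<Sum>k=1..d. \<Sum>r=1..d.
           if m + l = n then if k = m + r then if l = r then scale (\<alpha> * of_nat l) (cr n (an k v)) else 0 else 0 else 0) =
          scale (\<alpha> * of_nat (if m + l = n then l else 0)) (cr n (an n v))" .
      qed
      also have "\<dots> = scale (\<alpha> * of_nat (\<Sum>m=1..d. \<Sum>l=1..d. if m + l = n then l else 0)) (cr n (an n v))"
        by (simp only: scale_sum_left of_nat_sum sum_distrib_left)
      finally show "(\<Sum>m=1..d. \<Sum>l=1..d. \<Sum>k=1..d. \<Sum>r=1..d.
         if m + l = n then if k = m + r then if l = r then scale (\<alpha> * of_nat l) (cr n (an k v)) else 0 else 0 else 0) =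
        scale (\<alpha> * of_nat (\<Sum>m=1..d. \<Sum>l=1..d. if m + l = n then l else 0)) (cr n (an n v))" .
    qed
    then have "scale 2 ?B + scale \<alpha> (normal11 d 1 v) = (\<Sum>n=1..d. scale (\<alpha> * of_nat
        (2 * (\<Sum>m=1..d. \<Sum>l=1..d. if m + l = n then l else 0) + n)) (cr n (an n v)))"
      by (simp only: normal11_def scale_sum scale_scale sum.distrib[symmetric] scale_add_left[symmetric])
        (simp add: algebra_simps)
    also have "\<dots> = scale \<alpha> (normal11 d 2 v)"
      unfolding normal11_def scale_sum scale_scale
      by (intro sum.cong refl) (simp only: sum_index_below atLeastAtMost_iff of_nat_power)
    finally show ?thesis .
  qed
  show "scale 2 (unmark d (lax_up \<alpha> d y)) + scale \<alpha> (normal22_diag d v) + scale \<alpha> (normal11 d 1 v) = scale \<alpha> (normal22 d v) + scale \<alpha> (normal11 d 2 v)"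
    unfolding AB A[symmetric] B[symmetric] by (simp add: scale_add_right algebra_simps)
qed

lemma ham_2:
  fixes v :: "'a::comm_ring_1 fock"
  assumes v: "deg_le (int d) v"
  shows "scale 2 (ham \<alpha> d 2 v) + scale \<alpha> (normal22_diag d v) + scale \<alpha> (normal11 d 1 v) =
    scale (2 * (\<alpha> - 1)\<^sup>2 + \<alpha>) (normal11 d 2 v) + scale (3 * (\<alpha> * (\<alpha> - 1))) (normal12 d 1 v)
    + scale (3 * (\<alpha> - 1)) (normal21 d 1 v) + scale (2 * \<alpha>\<^sup>2) (normal13 d v) + scale (3 * \<alpha>) (normal22 d v) + scale 2 (normal31 d v)"
proof -
  let ?g = "\<lambda>n. an n v"
  let ?D = "lax_diag \<alpha> d" and ?U = "lax_up \<alpha> d" and ?W = "lax_down \<alpha> d"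
  have lax: "lax \<alpha> d h = (\<lambda>n. ?D h n + ?U h n + ?W h n)" for h :: "nat \<Rightarrow> 'a fock"
    by (rule ext) (rule lax_split)
  have step: "unmark d (lax \<alpha> d h) = unmark d (?D h) + unmark d (?U h) + unmark d (?W h)" for h :: "nat \<Rightarrow> 'a fock"
    unfolding lax unmark_add by (rule refl)
  have "ham \<alpha> d 2 v = unmark d (lax \<alpha> d (lax \<alpha> d ?g))"
    by (simp add: ham_def unmark_def numeral_2_eq_2)
  also have "\<dots> = unmark d (lax \<alpha> d (?D ?g)) + unmark d (lax \<alpha> d (?U ?g)) + unmark d (lax \<alpha> d (?W ?g))"
    unfolding lax[of ?g] unmark_add[symmetric] by (simp add: unmark_def lax_add)
  finally have "ham \<alpha> d 2 v = unmark d (?D (?D ?g)) + unmark d (?U (?D ?g)) + unmark d (?W (?D ?g))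
     + (unmark d (?D (?U ?g)) + unmark d (?U (?U ?g)) + unmark d (?W (?U ?g)))
     + (unmark d (?D (?W ?g)) + unmark d (?U (?W ?g)) + unmark d (?W (?W ?g)))"
    by (simp only: step)
  then have "scale 2 (ham \<alpha> d 2 v) + scale \<alpha> (normal22_diag d v) + scale \<alpha> (normal11 d 1 v) =
      scale 2 (unmark d (?D (?D ?g))) + scale 2 (unmark d (?U (?D ?g))) + scale 2 (unmark d (?W (?D ?g)))
     + (scale 2 (unmark d (?D (?U ?g))) + scale 2 (unmark d (?U (?U ?g))) + scale 2 (unmark d (?W (?U ?g))))
     + (scale 2 (unmark d (?D (?W ?g))) + (scale 2 (unmark d (?U (?W ?g))) + scale \<alpha> (normal22_diag d v) + scale \<alpha> (normal11 d 1 v))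
     + scale 2 (unmark d (?W (?W ?g))))"
    by (simp add: scale_add_right algebra_simps)
  also have "\<dots> = scale (2 * (\<alpha> - 1)\<^sup>2) (normal11 d 2 v) + scale (\<alpha> * (\<alpha> - 1)) (normal12 d 1 v) + scale (2 * (\<alpha> - 1)) (normal21 d 1 v)
     + (scale (2 * (\<alpha> * (\<alpha> - 1))) (normal12 d 1 v) + scale (2 * \<alpha>\<^sup>2) (normal13 d v) + scale (2 * \<alpha>) (normal22 d v))
     + (scale (\<alpha> - 1) (normal21 d 1 v) + (scale \<alpha> (normal22 d v) + scale \<alpha> (normal11 d 2 v)) + scale 2 (normal31 d v))"
    unfolding unmark_lax_diag unmark_lax_up[OF v] unmark_lax_down scale_scale by (rule refl)
  also have "\<dots> = scale (2 * (\<alpha> - 1)\<^sup>2 + \<alpha>) (normal11 d 2 v) + scale (3 * (\<alpha> * (\<alpha> - 1))) (normal12 d 1 v)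
    + scale (3 * (\<alpha> - 1)) (normal21 d 1 v) + scale (2 * \<alpha>\<^sup>2) (normal13 d v) + scale (3 * \<alpha>) (normal22 d v) + scale 2 (normal31 d v)"
    by (rule poly_mapping_eqI) (simp add: lookup_add lookup_scale algebra_simps)
  finally show ?thesis .
qed

section \<open>Exponentials of linear series\<close>

text \<open>The coefficient at \<open>M\<close> of the exponential of the linear series \<open>\<Sum> c_i x_i\<close>.\<close>

definition exp_coeff :: "('v \<Rightarrow> 'r::field_char_0) \<Rightarrow> 'v multiset \<Rightarrow> 'r" where
  "exp_coeff c M = (\<Prod>i\<in>#M. c i) / of_nat (multi_fact M)"

lemma exp_coeff_empty [simp]: "exp_coeff c {#} = 1"
  by (simp add: exp_coeff_def multi_fact_def)

lemma exp_coeff_remove: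
  fixes c :: "'v \<Rightarrow> 'r::field_char_0"
  assumes "i \<in># M"
  shows "of_nat (count M i) * exp_coeff c M = c i * exp_coeff c (M - {#i#})"
proof -
  obtain N where M: "M = add_mset i N" using assms by (metis mset_add)
  have "of_nat (Suc (count N i)) \<noteq> (0 :: 'r)" by (metis nat.distinct(1) of_nat_eq_0_iff)
  then show ?thesis
    unfolding M exp_coeff_def multi_fact_add_mset by (simp del: of_nat_Suc mult_Suc)
qed

lemma exp_coeff_size:
  "of_nat (size M) * exp_coeff c M = (\<Sum>i\<in>set_mset M. c i * exp_coeff c (M - {#i#}))"
proof -
  have "of_nat (size M) * exp_coeff c M = (\<Sum>i\<in>set_mset M. of_nat (count M i) * exp_coeff c M)"
    by (simp add: size_multiset_overloaded_eq sum_distrib_right)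
  then show ?thesis by (simp add: exp_coeff_remove)
qed

lemma exp_coeff_eq_0: "i \<in># M \<Longrightarrow> c i = 0 \<Longrightarrow> exp_coeff c M = 0"
  by (auto simp: exp_coeff_def prod_mset_zero_iff)

lemma mseries_mult_linear:
  "mseries_mult (mseries_linear c) f M = (\<Sum>i\<in>set_mset M. c i * f (M - {#i#}))"
  for c :: "'v \<Rightarrow> 'r::comm_semiring_1"
proof -
  let ?h = "\<lambda>i. ({#i#}, M - {#i#})"
  have lin: "mseries_linear c {#i#} = c i" for i
    by (simp add: mseries_linear_def)
  have "mseries_mult (mseries_linear c) f M = (\<Sum>(A, B)\<in>?h ` set_mset M. mseries_linear c A * f B)"
    unfolding mseries_mult_def
  proof (rule sum.mono_neutral_right)
    show "?h ` set_mset M \<subseteq> {(A, B). A + B = M}" by auto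
    show "\<forall>p\<in>{(A, B). A + B = M} - ?h ` set_mset M. (case p of (A, B) \<Rightarrow> mseries_linear c A * f B) = 0"
    proof (rule ballI, rule ccontr)
      fix p assume p: "p \<in> {(A, B). A + B = M} - ?h ` set_mset M"
        and nz: "(case p of (A, B) \<Rightarrow> mseries_linear c A * f B) \<noteq> 0"
      obtain A B where AB: "p = (A, B)" by (cases p)
      have "\<exists>i. A = {#i#}"
      proof (rule ccontr)
        assume "\<not> ?thesis"
        then have "{i. A = {#i#}} = {}" by auto
        with nz AB show False by (simp add: mseries_linear_def)
      qed
      then obtain i where i: "A = {#i#}" by blast
      with p AB have "M = add_mset i B" by auto
      with i AB have "p = ?h i" "i \<in># M" by auto
      with p show False by blast
    qed
  qed (rule finite_sum_pairs)
  also have "\<dots> = (\<Sum>i\<in>set_mset M. c i * f (M - {#i#}))"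
    by (subst sum.reindex) (auto simp: inj_on_def lin)
  finally show ?thesis .
qed

lemma mseries_power_linear:
  fixes c :: "'v \<Rightarrow> 'r::field_char_0"
  shows "mseries_power (mseries_linear c) n M = (if size M = n then of_nat (fact n) * exp_coeff c M else 0)"
proof (induction n arbitrary: M)
  case 0
  show ?case by (auto simp: mseries_one_def)
next
  case (Suc n)
  have sz: "size M = Suc (size (M - {#i#}))" if "i \<in># M" for i
    using that by (simp add: size_Suc_Diff1)
  have "mseries_power (mseries_linear c) (Suc n) M =
      (\<Sum>i\<in>set_mset M. c i * (if size (M - {#i#}) = n then of_nat (fact n) * exp_coeff c (M - {#i#}) else 0))"
    by (simp only: mseries_power.simps mseries_mult_linear Suc)
  also have "\<dots> = (\<Sum>i\<in>set_mset M. if size M = Suc n then of_nat (fact n) * (c i * exp_coeff c (M - {#i#})) else 0)"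
    by (intro sum.cong refl) (auto dest!: sz)
  also have "\<dots> = (if size M = Suc n then of_nat (fact n) * (\<Sum>i\<in>set_mset M. c i * exp_coeff c (M - {#i#})) else 0)"
    by (simp add: sum_distrib_left)
  also have "\<dots> = (if size M = Suc n then of_nat (fact n) * (of_nat (size M) * exp_coeff c M) else 0)"
    by (simp only: exp_coeff_size)
  finally show ?case by (simp add: algebra_simps)
qed

lemma mseries_exp_linear: "mseries_exp (mseries_linear c) = exp_coeff c"
  by (rule ext) (simp add: mseries_exp_def mseries_power_linear if_distrib[of "\<lambda>x. x / _"] cong: if_cong)

text \<open>Each variable carries the power of \<open>z\<close> opposite to its index, so a generalized partition carries
  the power opposite to the sum of its entries.\<close>

lemma exp_coeff_monomial:
  fixes u :: "int \<Rightarrow> 'b::field_char_0"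
  assumes "\<And>i. i \<in># M \<Longrightarrow> w i = fls_const (u i) * fls_X_intpow (- i)"
  shows "exp_coeff w M = fls_const (exp_coeff u M) * fls_X_intpow (- \<Sum>\<^sub># M)"
proof -
  have "(\<Prod>i\<in>#M. w i) = fls_const (\<Prod>i\<in>#M. u i) * fls_X_intpow (- \<Sum>\<^sub># M)"
    using assms
  proof (induction M)
    case (add i M)
    have "fls_X_intpow (- i) * fls_X_intpow (- \<Sum>\<^sub># M) = (fls_X_intpow (- \<Sum>\<^sub># (add_mset i M)) :: 'b fls)"
      by (subst fls_X_intpow_times_fls_X_intpow) (simp add: algebra_simps)
    with add show ?case
      by (simp add: mult_ac flip: fls_const_mult_const)
  qed simp
  then show ?thesis
    by (simp add: exp_coeff_def fls_of_nat fls_const_divide_const[symmetric])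
qed

text \<open>The factors of the vertex operator involve negative and positive indices only, so the
  convolution product that defines it has at most one nonzero term.\<close>

lemma genpart_split_unique:
  fixes A B A' B' :: "int multiset"
  assumes "A + B = A' + B'" "\<And>i. i \<in># A \<Longrightarrow> i < 0" "\<And>i. i \<in># A' \<Longrightarrow> i < 0"
    "\<And>i. i \<in># B \<Longrightarrow> i > 0" "\<And>i. i \<in># B' \<Longrightarrow> i > 0"
  shows "A = A' \<and> B = B'"
proof -
  have "filter_mset (\<lambda>i. i < 0) (X + Y) = X" if "\<And>i. i \<in># X \<Longrightarrow> i < 0" "\<And>i. i \<in># Y \<Longrightarrow> i > 0" for X Y :: "int multiset"
  proof -
    have "filter_mset (\<lambda>i. i < 0) X = X" by (simp add: filter_mset_eq_conv that)
    moreover have "filter_mset (\<lambda>i. i < 0) Y = {#}"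
    proof (rule multiset_eqI)
      fix x
      show "count (filter_mset (\<lambda>i. i < 0) Y) x = count {#} x"
        using that(2)[of x] by (auto simp: count_eq_zero_iff)
    qed
    ultimately show ?thesis by simp
  qed
  from this[of A B] this[of A' B'] assms have "A = A'" by auto
  with assms(1) show ?thesis by simp
qed

lemma vertex0_split:
  fixes q t q' t' :: "'b::field_char_0"
  assumes A: "\<And>i. i \<in># A \<Longrightarrow> i < 0" and B: "\<And>i. i \<in># B \<Longrightarrow> i > 0"
  shows "vertex0 q t q' t' (A + B) = (if \<Sum>\<^sub># (A + B) = 0 then
     exp_coeff (\<lambda>i. (q ^ nat (- i) - q' ^ nat (- i)) / of_nat (nat (- i))) A *
     exp_coeff (\<lambda>i. (t' ^ nat i - t ^ nat i) / of_nat (nat i)) B else 0)"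
proof -
  let ?u = "\<lambda>i. (q ^ nat (- i) - q' ^ nat (- i)) / of_nat (nat (- i))"
  let ?w = "\<lambda>i. (t' ^ nat i - t ^ nat i) / of_nat (nat i)"
  have c0: "vertex_creation q q' X = 0" if "i \<in># X" "\<not> i < 0" for X i
    unfolding vertex_creation_def mseries_exp_linear by (rule exp_coeff_eq_0[OF that(1)]) (use that in simp)
  have a0: "vertex_annihilation t t' X = 0" if "i \<in># X" "\<not> i > 0" for X i
    unfolding vertex_annihilation_def mseries_exp_linear by (rule exp_coeff_eq_0[OF that(1)]) (use that in simp)
  have "vertex q t q' t' (A + B) = (\<Sum>(A', B')\<in>{(A, B)}. vertex_creation q q' A' * vertex_annihilation t t' B')"
    unfolding vertex_def mseries_mult_def
  proof (rule sum.mono_neutral_right)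
    show "\<forall>p\<in>{(A', B'). A' + B' = A + B} - {(A, B)}. (case p of (A', B') \<Rightarrow> vertex_creation q q' A' * vertex_annihilation t t' B') = 0"
    proof (rule ballI, rule ccontr)
      fix p assume p: "p \<in> {(A', B'). A' + B' = A + B} - {(A, B)}"
        and nz: "(case p of (A', B') \<Rightarrow> vertex_creation q q' A' * vertex_annihilation t t' B') \<noteq> 0"
      obtain A' B' where AB: "p = (A', B')" by (cases p)
      from nz AB have "\<And>i. i \<in># A' \<Longrightarrow> i < 0" "\<And>i. i \<in># B' \<Longrightarrow> i > 0"
        using c0 a0 by auto
      with genpart_split_unique[of A B A' B'] A B p AB show False by auto
    qed
  qed (auto simp: finite_sum_pairs)
  also have "\<dots> = vertex_creation q q' A * vertex_annihilation t t' B" by simp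
  also have "vertex_creation q q' A = fls_const (exp_coeff ?u A) * fls_X_intpow (- \<Sum>\<^sub># A)"
    unfolding vertex_creation_def mseries_exp_linear
    by (rule exp_coeff_monomial) (use A in \<open>simp add: Let_def\<close>)
  also have "vertex_annihilation t t' B = fls_const (exp_coeff ?w B) * fls_X_intpow (- \<Sum>\<^sub># B)"
    unfolding vertex_annihilation_def mseries_exp_linear
    by (rule exp_coeff_monomial) (use B in \<open>simp add: Let_def\<close>)
  also have "fls_const (exp_coeff ?u A) * fls_X_intpow (- \<Sum>\<^sub># A) * (fls_const (exp_coeff ?w B) * fls_X_intpow (- \<Sum>\<^sub># B)) =
    fls_const (exp_coeff ?u A * exp_coeff ?w B) * (fls_X_intpow (- \<Sum>\<^sub># A) * fls_X_intpow (- \<Sum>\<^sub># B))"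
    unfolding fls_const_mult_const[symmetric] by (simp only: mult_ac)
  finally show ?thesis
    by (simp only: vertex0_def fls_X_intpow_times_fls_X_intpow fls_mult_const_nth) auto
qed

lemma vertex0_zero:
  fixes q t q' t' :: "'b::field_char_0"
  assumes "0 \<in># lam"
  shows "vertex0 q t q' t' lam = 0"
proof -
  have "vertex q t q' t' lam = 0"
    unfolding vertex_def mseries_mult_def
  proof (rule sum.neutral, clarify)
    fix A B assume "lam = A + B"
    with assms consider "0 \<in># A" | "0 \<in># B" by auto
    then show "vertex_creation q q' A * vertex_annihilation t t' B = 0"
      unfolding vertex_creation_def vertex_annihilation_def mseries_exp_linear
      by cases (simp_all add: exp_coeff_eq_0[of 0])
  qed
  then show ?thesis by (simp add: vertex0_def)
qed

lemma genpart_neg_pos: "0 \<notin># lam \<Longrightarrow> lam = genpart_neg lam + genpart_pos lam"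
proof (rule multiset_eqI)
  fix i assume "0 \<notin># lam"
  then have "count lam 0 = 0" by (simp add: not_in_iff)
  then show "count lam i = count (genpart_neg lam + genpart_pos lam) i"
    by (cases "i = 0") (auto simp: genpart_neg_def genpart_pos_def)
qed

section \<open>The expansion of the vertex operator\<close>

text \<open>The coefficients of the exponents of \<open>V_0\<close> divided by \<open>X\<close>, for \<open>t = exp X\<close> and \<open>q = exp (\<alpha> X)\<close>:
  \<open>(t^k - 1) / (k X)\<close> at the creation operators, and \<open>t^(-k) (q^k - 1) / (k X)\<close> at the
  annihilation operators.\<close>

definition cfps :: "nat \<Rightarrow> 'a::field_char_0 fps" where
  "cfps k = Abs_fps (\<lambda>n. of_nat k ^ n / fact (Suc n))"

definition afps :: "'a::field_char_0 \<Rightarrow> nat \<Rightarrow> 'a fps" where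
  "afps \<alpha> k = Abs_fps (\<lambda>n. of_nat k ^ n * ((\<alpha> - 1) ^ Suc n - (- 1) ^ Suc n) / fact (Suc n))"

definition fexp :: "'a::field_char_0 \<Rightarrow> 'a fls" where
  "fexp a = fps_to_fls (fps_exp a)"

lemma fexp_mult: "fexp a * fexp b = fexp (a + b)"
  by (simp add: fexp_def fps_exp_add_mult fls_times_fps_to_fls)

lemma fexp_0 [simp]: "fexp 0 = 1"
  by (simp add: fexp_def)

lemma fexp_inverse: "inverse (fexp a) = fexp (- a)"
  by (rule inverse_unique) (simp add: fexp_mult)

lemma fexp_power: "fexp a ^ n = fexp (of_nat n * a)"
  by (simp add: fexp_def fps_to_fls_power[symmetric] fps_exp_power_mult)

lemma fexp_diff:
  assumes "k > 0"
  shows "(fexp (of_nat k * a) - fexp (of_nat k * b)) / of_nat k =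
    fps_to_fls (fps_X * Abs_fps (\<lambda>n. of_nat k ^ n * (a ^ Suc n - b ^ Suc n) / fact (Suc n)))"
proof -
  have "fps_exp (of_nat k * a) - fps_exp (of_nat k * b) =
    fps_X * Abs_fps (\<lambda>n. of_nat k ^ n * (a ^ Suc n - b ^ Suc n) / fact (Suc n)) * fps_const (of_nat k)"
  proof (rule fps_ext)
    fix n show "(fps_exp (of_nat k * a) - fps_exp (of_nat k * b)) $ n =
      (fps_X * Abs_fps (\<lambda>n. of_nat k ^ n * (a ^ Suc n - b ^ Suc n) / fact (Suc n)) * fps_const (of_nat k)) $ n"
      by (cases n) (simp_all add: power_mult_distrib algebra_simps diff_divide_distrib)
  qed
  moreover have "of_nat k \<noteq> (0 :: 'a fls)" using assms by simp
  ultimately show ?thesis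
    by (simp add: fexp_def divide_eq_eq fls_times_fps_to_fls fps_to_fls_of_nat fps_of_nat
      flip: fps_to_fls_minus)
qed

lemma fexp_cfps: "k > 0 \<Longrightarrow> (fexp 1 ^ k - 1 ^ k) / of_nat k = fps_to_fls (fps_X * cfps k)"
  using fexp_diff[of k 1 0] by (simp add: fexp_power cfps_def)

lemma fexp_afps: "k > 0 \<Longrightarrow> ((fexp \<alpha> * inverse (fexp 1)) ^ k - inverse (fexp 1) ^ k) / of_nat k =
    fps_to_fls (fps_X * afps \<alpha> k)"
  using fexp_diff[of k "\<alpha> - 1" "- 1"] by (simp add: fexp_inverse fexp_mult fexp_power afps_def)

text \<open>The series \<open>V_0\<close> that enters \<open>Bbar\<close>.\<close>

definition vertex_coeff :: "'a::field_char_0 \<Rightarrow> 'a fls opseries" where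
  "vertex_coeff \<alpha> = vertex0 (fexp 1) (inverse (fexp 1)) 1 (fexp \<alpha> * inverse (fexp 1))"

definition cfls :: "int \<Rightarrow> 'a::field_char_0 fls" where
  "cfls i = fps_to_fls (fps_X * cfps (nat (- i)))"

definition afls :: "'a::field_char_0 \<Rightarrow> int \<Rightarrow> 'a fls" where
  "afls \<alpha> i = fps_to_fls (fps_X * afps \<alpha> (nat i))"

lemma exp_coeff_cong: "(\<And>i. i \<in># M \<Longrightarrow> c i = c' i) \<Longrightarrow> exp_coeff c M = exp_coeff c' M"
  unfolding exp_coeff_def by (simp cong: image_mset_cong)

lemma vertex_coeff_split:
  assumes A: "\<And>i. i \<in># A \<Longrightarrow> i < 0" and B: "\<And>i. i \<in># B \<Longrightarrow> i > 0"
  shows "vertex_coeff \<alpha> (A + B) = (if \<Sum>\<^sub># (A + B) = 0 then exp_coeff cfls A * exp_coeff (afls \<alpha>) B else 0)"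
proof -
  have "exp_coeff (\<lambda>i. (fexp 1 ^ nat (- i) - 1 ^ nat (- i)) / of_nat (nat (- i))) A = (exp_coeff cfls A :: 'a fls)"
    by (rule exp_coeff_cong, subst fexp_cfps) (use A in \<open>auto simp: cfls_def\<close>)
  moreover have "exp_coeff (\<lambda>i. ((fexp \<alpha> * inverse (fexp 1)) ^ nat i - inverse (fexp 1) ^ nat i) / of_nat (nat i)) B = exp_coeff (afls \<alpha>) B"
    by (rule exp_coeff_cong, subst fexp_afps) (use B in \<open>auto simp: afls_def\<close>)
  ultimately show ?thesis
    unfolding vertex_coeff_def by (subst vertex0_split) (simp_all only: A B)
qed

lemma exp_coeff_fps_X:
  fixes g :: "'v \<Rightarrow> 'a::field_char_0 fls"
  assumes "\<And>i. i \<in># M \<Longrightarrow> \<exists>f. g i = fps_to_fls (fps_X * f)"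
  shows "\<exists>f. exp_coeff g M = fps_to_fls (fps_X ^ size M * f)"
proof -
  have "\<exists>f. (\<Prod>i\<in>#M. g i) = fps_to_fls (fps_X ^ size M * f)"
    using assms
  proof (induction M)
    case empty
    show ?case by (intro exI[of _ 1]) simp
  next
    case (add i M)
    then obtain f h where "(\<Prod>i\<in>#M. g i) = fps_to_fls (fps_X ^ size M * f)" "g i = fps_to_fls (fps_X * h)"
      by (metis union_single_eq_member insert_iff set_mset_add_mset_insert)
    then show ?case
      by (intro exI[of _ "f * h"]) (simp add: fls_times_fps_to_fls mult_ac)
  qed
  then obtain f where f: "(\<Prod>i\<in>#M. g i) = fps_to_fls (fps_X ^ size M * f)" by blast
  have "exp_coeff g M = fps_to_fls (fps_X ^ size M * (f * fps_const (1 / of_nat (multi_fact M))))"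
  proof -
    have "fps_to_fls (fps_X ^ size M * f) = fps_to_fls (fps_X ^ size M * (f * fps_const (1 / of_nat (multi_fact M)) * of_nat (multi_fact M)))"
      by (simp add: fps_of_nat[symmetric] mult.assoc)
    also have "\<dots> = fps_to_fls (fps_X ^ size M * (f * fps_const (1 / of_nat (multi_fact M)))) * of_nat (multi_fact M)"
      by (simp only: mult.assoc[symmetric] fls_times_fps_to_fls[of _ "of_nat (multi_fact M)"] fps_to_fls_of_nat)
    finally show ?thesis by (simp add: exp_coeff_def f divide_eq_eq)
  qed
  then show ?thesis by blast
qed

text \<open>Every factor of a monomial contributes a factor \<open>X\<close>. A nonempty balanced monomial has at least
  two factors, and for more than four it does not contribute to order \<open>X^4\<close>.\<close>

lemma vertex_coeff_fps:
  assumes "lam \<noteq> {#}"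
  shows "\<exists>f. vertex_coeff \<alpha> lam = fps_to_fls (fps_X ^ 2 * f) \<and> (size lam > 4 \<longrightarrow> (\<forall>k\<le>2. f $ k = 0))"
proof (cases "0 \<in># lam \<or> \<Sum>\<^sub># lam \<noteq> 0")
  case True
  then have "vertex_coeff \<alpha> lam = 0"
  proof
    assume "0 \<in># lam" then show ?thesis by (simp add: vertex_coeff_def vertex0_zero)
  next
    assume s: "\<Sum>\<^sub># lam \<noteq> 0"
    show ?thesis
    proof (cases "0 \<in># lam")
      case False
      have "vertex_coeff \<alpha> (genpart_neg lam + genpart_pos lam) = 0"
        using s genpart_neg_pos[OF False] by (subst vertex_coeff_split) (auto simp: genpart_neg_def genpart_pos_def)
      then show ?thesis using genpart_neg_pos[OF False] by simp
    qed (simp add: vertex_coeff_def vertex0_zero)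
  qed
  then show ?thesis by (intro exI[of _ 0]) simp
next
  case False
  let ?A = "genpart_neg lam" and ?B = "genpart_pos lam"
  have lam: "lam = ?A + ?B" using False by (intro genpart_neg_pos) simp
  have "size lam \<noteq> 1"
  proof
    assume "size lam = 1"
    then obtain i where "lam = {#i#}" by (metis size_1_singleton_mset)
    with False show False by simp
  qed
  moreover have "size lam \<noteq> 0" using assms by simp
  ultimately have sz: "size lam = 2 + (size lam - 2)" by linarith
  obtain f where f: "exp_coeff cfls ?A = (fps_to_fls (fps_X ^ size ?A * f) :: 'a fls)"
    using exp_coeff_fps_X[of ?A cfls] by (auto simp: cfls_def)
  obtain h where h: "exp_coeff (afls \<alpha>) ?B = fps_to_fls (fps_X ^ size ?B * h)"
    using exp_coeff_fps_X[of ?B "afls \<alpha>"] by (auto simp: afls_def)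
  have "vertex_coeff \<alpha> (?A + ?B) = exp_coeff cfls ?A * exp_coeff (afls \<alpha>) ?B"
    using False lam by (subst vertex_coeff_split) (auto simp: genpart_neg_def genpart_pos_def)
  also have "\<dots> = fps_to_fls (fps_X ^ (size ?A + size ?B) * (f * h))"
    by (simp add: f h power_add mult_ac flip: fls_times_fps_to_fls)
  also have "size ?A + size ?B = size lam" by (metis lam size_union)
  also have "fps_X ^ size lam = fps_X ^ 2 * (fps_X ^ (size lam - 2) :: 'a fps)"
    by (subst sz) (simp only: power_add)
  finally have "vertex_coeff \<alpha> lam = fps_to_fls (fps_X ^ 2 * (fps_X ^ (size lam - 2) * (f * h)))"
    using lam by (simp only: mult.assoc)
  moreover have "(fps_X ^ (size lam - 2) * (f * h)) $ k = 0" if "size lam > 4" "k \<le> 2" for k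
    using that by (simp add: fps_X_power_mult_nth)
  ultimately show ?thesis by blast
qed

text \<open>The denominator \<open>(1 - q) (1 - 1/t)\<close> divided by \<open>- X^2\<close>.\<close>

definition Bbar_denom :: "'a::field_char_0 \<Rightarrow> 'a fps" where
  "Bbar_denom \<alpha> = Abs_fps (\<lambda>n. \<alpha> ^ Suc n / fact (Suc n)) * Abs_fps (\<lambda>n. (- 1) ^ n / fact (Suc n))"

lemma Bbar_denom_fexp: "(1 - fexp \<alpha>) * (1 - inverse (fexp 1)) = - fps_to_fls (fps_X ^ 2 * Bbar_denom \<alpha>)"
proof -
  have 1: "fexp a - 1 = fps_to_fls (fps_X * Abs_fps (\<lambda>n. a ^ Suc n / fact (Suc n)))" for a :: 'a
    using fexp_diff[of 1 a 0] by simp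
  have "(1 - fexp \<alpha>) * (1 - inverse (fexp 1)) = (fexp \<alpha> - 1) * (fexp (- 1) - 1)"
    by (simp add: fexp_inverse algebra_simps)
  also have "\<dots> = fps_to_fls (fps_X ^ 2 * (Abs_fps (\<lambda>n. \<alpha> ^ Suc n / fact (Suc n)) * Abs_fps (\<lambda>n. (- 1) ^ Suc n / fact (Suc n))))"
    unfolding 1 by (simp add: power2_eq_square mult_ac flip: fls_times_fps_to_fls)
  also have "Abs_fps (\<lambda>n. (- 1) ^ Suc n / fact (Suc n)) = - Abs_fps (\<lambda>n. (- 1) ^ n / fact (Suc n) :: 'a)"
    by (rule fps_ext) simp
  finally show ?thesis by (simp add: Bbar_denom_def)
qed

lemma fps_mult_nth_012:
  fixes f g :: "'a::comm_ring_1 fps"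
  shows "(f * g) $ 0 = f $ 0 * g $ 0"
    "(f * g) $ Suc 0 = f $ 0 * g $ Suc 0 + f $ Suc 0 * g $ 0"
    "(f * g) $ 2 = f $ 0 * g $ 2 + f $ Suc 0 * g $ Suc 0 + f $ 2 * g $ 0"
  by (simp_all add: fps_mult_nth numeral_2_eq_2)

lemma Bbar_denom_nth:
  "Bbar_denom \<alpha> $ 0 = \<alpha>" "Bbar_denom \<alpha> $ Suc 0 = \<alpha> * (\<alpha> - 1) / 2"
  "Bbar_denom \<alpha> $ 2 = \<alpha> * (\<alpha>\<^sup>2 / 6 - \<alpha> / 4 + 1 / 6)"
  by (simp_all add: Bbar_denom_def fps_mult_nth_012 fact_numeral numeral_2_eq_2[symmetric] numeral_3_eq_3[symmetric]
    power2_eq_square power3_eq_cube field_simps)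

lemma cfps_nth: "cfps k $ 0 = 1" "cfps k $ Suc 0 = of_nat k / 2" "cfps k $ 2 = of_nat k ^ 2 / 6"
  by (simp_all add: cfps_def fact_numeral numeral_2_eq_2[symmetric])

lemma afps_nth: "afps \<alpha> k $ 0 = \<alpha>" "afps \<alpha> k $ Suc 0 = of_nat k * (\<alpha>\<^sup>2 - 2 * \<alpha>) / 2"
  "afps \<alpha> k $ 2 = of_nat k ^ 2 * (\<alpha> ^ 3 - 3 * \<alpha>\<^sup>2 + 3 * \<alpha>) / 6"
  by (simp_all add: afps_def fact_numeral numeral_2_eq_2[symmetric] power2_eq_square power3_eq_cube algebra_simps)

text \<open>Comparing coefficients in \<open>V_0 = X^2 * Bbar_denom * Bbar\<close>, away from the constant term, to the orders two,
  three and four. The values of \<open>Bbar\<close> are power series because \<open>\<alpha> \<noteq> 0\<close> makes the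
  denominator a unit.\<close>

lemma Bbar_coeff_vertex_coeff:
  assumes \<alpha>: "\<alpha> \<noteq> 0" and ne: "lam \<noteq> {#}"
  shows "fls_nth (vertex_coeff \<alpha> lam) 2 = \<alpha> * Bbar_coeff 0 \<alpha> lam"
    and "fls_nth (vertex_coeff \<alpha> lam) 3 = \<alpha> * Bbar_coeff 1 \<alpha> lam + \<alpha> * (\<alpha> - 1) / 2 * Bbar_coeff 0 \<alpha> lam"
    and "fls_nth (vertex_coeff \<alpha> lam) 4 = \<alpha> * Bbar_coeff 2 \<alpha> lam + \<alpha> * (\<alpha> - 1) / 2 * Bbar_coeff 1 \<alpha> lam
      + \<alpha> * (\<alpha>\<^sup>2 / 6 - \<alpha> / 4 + 1 / 6) * Bbar_coeff 0 \<alpha> lam"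
    and "k \<le> 2 \<Longrightarrow> size lam > 4 \<Longrightarrow> Bbar_coeff k \<alpha> lam = 0"
    and "vertex_coeff \<alpha> lam = 0 \<Longrightarrow> Bbar_coeff k \<alpha> lam = 0"
proof -
  obtain f where f: "vertex_coeff \<alpha> lam = fps_to_fls (fps_X ^ 2 * f)" "size lam > 4 \<longrightarrow> (\<forall>k\<le>2. f $ k = 0)"
    using vertex_coeff_fps[OF ne] by blast
  let ?U = "Bbar_denom \<alpha>"
  define h where "h = f * inverse ?U"
  have U: "?U $ 0 \<noteq> 0" using \<alpha> by (simp add: Bbar_denom_nth)
  then have hf: "?U * h = f"
    unfolding h_def by (metis inverse_mult_eq_1' mult.left_commute mult.right_neutral)
  have U0: "fps_to_fls (fps_X ^ 2 * ?U) \<noteq> 0" using U by auto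
  have "Bbar (fexp \<alpha>) (fexp 1) lam = 1 / ((1 - fexp \<alpha>) * (1 - inverse (fexp 1))) * (0 - vertex_coeff \<alpha> lam)"
    using ne by (simp add: Bbar_def vertex_coeff_def mseries_one_def)
  also have "\<dots> = vertex_coeff \<alpha> lam / fps_to_fls (fps_X ^ 2 * ?U)"
    by (simp add: Bbar_denom_fexp)
  also have "\<dots> = fps_to_fls h"
    using U0 by (simp add: f divide_eq_eq hf[symmetric] mult_ac flip: fls_times_fps_to_fls)
  finally have B: "Bbar_coeff k \<alpha> lam = h $ k" for k
    by (simp add: Bbar_coeff_def fexp_def)
  have v: "fls_nth (vertex_coeff \<alpha> lam) (int n) = (if n < 2 then 0 else f $ (n - 2))" for n
    by (simp add: f fps_X_power_mult_nth)
  show "fls_nth (vertex_coeff \<alpha> lam) 2 = \<alpha> * Bbar_coeff 0 \<alpha> lam"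
    using v[of 2] by (simp add: B fps_mult_nth_012 Bbar_denom_nth flip: hf)
  show "fls_nth (vertex_coeff \<alpha> lam) 3 = \<alpha> * Bbar_coeff 1 \<alpha> lam + \<alpha> * (\<alpha> - 1) / 2 * Bbar_coeff 0 \<alpha> lam"
    using v[of 3] by (simp add: B fps_mult_nth_012 Bbar_denom_nth flip: hf)
  show "fls_nth (vertex_coeff \<alpha> lam) 4 = \<alpha> * Bbar_coeff 2 \<alpha> lam + \<alpha> * (\<alpha> - 1) / 2 * Bbar_coeff 1 \<alpha> lam
      + \<alpha> * (\<alpha>\<^sup>2 / 6 - \<alpha> / 4 + 1 / 6) * Bbar_coeff 0 \<alpha> lam"
    using v[of 4] by (simp add: B fps_mult_nth_012 Bbar_denom_nth flip: hf)
  show "Bbar_coeff k \<alpha> lam = 0" if "k \<le> 2" "size lam > 4"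
    unfolding B h_def fps_mult_nth by (rule sum.neutral) (use that f(2) in auto)
  show "Bbar_coeff k \<alpha> lam = 0" if "vertex_coeff \<alpha> lam = 0"
  proof -
    have "f = 0" using that f(1) by (auto simp: fps_to_fls_eq_0_iff)
    then show ?thesis by (simp add: B h_def)
  qed
qed

lemma Bbar_coeff_empty: "Bbar_coeff k \<alpha> {#} = 0"
proof -
  have "vertex_coeff \<alpha> ({#} + {#}) = 1" by (subst vertex_coeff_split) simp_all
  then show ?thesis by (simp add: Bbar_coeff_def Bbar_def mseries_one_def vertex_coeff_def fexp_def)
qed

section \<open>Operators of series\<close>

lemma heisenberg_cr: "n > 0 \<Longrightarrow> heisenberg (- int n) = cr n"
  by (rule ext) (simp add: heisenberg_def cr_def)

lemma heisenberg_an: "n > 0 \<Longrightarrow> heisenberg (int n) = an n"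
  by (rule ext) (simp add: heisenberg_def an_def)

lemma heisenberg_cases:
  obtains "i = 0" | n where "n > 0" "i = - int n" | n where "n > 0" "i = int n"
proof (cases i "0 :: int" rule: linorder_cases)
  case less
  then have "nat (- i) > 0" "i = - int (nat (- i))" by auto
  then show ?thesis by (rule that(2))
next
  case greater
  then have "nat i > 0" "i = int (nat i)" by auto
  then show ?thesis by (rule that(3))
qed (use that in simp)

lemma heisenberg_zero [simp]: "heisenberg i 0 = 0"
  by (cases i rule: heisenberg_cases) (simp_all add: heisenberg_cr heisenberg_an heisenberg_def[of 0])

lemma heisenberg_add: "heisenberg i (v + w) = heisenberg i v + heisenberg i w"
  by (cases i rule: heisenberg_cases) (simp_all add: heisenberg_cr heisenberg_an heisenberg_def[of 0] cr_add an_add)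

lemma heisenberg_scale: "heisenberg i (scale c v) = scale c (heisenberg i v)"
  by (cases i rule: heisenberg_cases) (simp_all add: heisenberg_cr heisenberg_an heisenberg_def[of 0] cr_scale an_scale)

lemma heisenberg_commute_neg: "i < 0 \<Longrightarrow> j < 0 \<Longrightarrow> heisenberg i (heisenberg j v) = heisenberg j (heisenberg i v)"
  by (simp add: heisenberg_def creation_commute)

lemma heisenberg_commute_pos: "i > 0 \<Longrightarrow> j > 0 \<Longrightarrow> heisenberg i (heisenberg j v) = heisenberg j (heisenberg i v)"
  by (simp add: heisenberg_def annihilation_commute)

lemma heisenberg_deg_le:
  assumes "deg_le d v"
  shows "deg_le (d - i) (heisenberg i v)"
proof (cases i rule: heisenberg_cases)
  case (2 n)
  then show ?thesis using deg_le_cr[of n d v] assms by (simp add: heisenberg_cr)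
next
  case (3 n)
  then show ?thesis using deg_le_an[of n d v] assms by (simp add: heisenberg_an)
qed (simp add: heisenberg_def)

lemma heisenberg_monomial_empty [simp]: "heisenberg_monomial {#} v = v"
  by (simp add: heisenberg_monomial_def)

lemma heisenberg_monomial_zero [simp]: "heisenberg_monomial lam 0 = 0"
proof -
  have "foldr heisenberg is 0 = 0" for "is" by (induction "is") simp_all
  then show ?thesis by (simp add: heisenberg_monomial_def)
qed

lemma heisenberg_monomial_add_neg:
  fixes v :: "'a::comm_ring_1 fock"
  assumes "i < 0"
  shows "heisenberg_monomial (add_mset i lam) v = heisenberg i (heisenberg_monomial lam v)"
proof -
  have comm: "heisenberg j (heisenberg i w) = heisenberg i (heisenberg j w)" if "\<not> i \<le> j" for j and w :: "'a fock"
    by (rule heisenberg_commute_neg) (use that assms in auto)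
  have "foldr heisenberg (insort i is) v = heisenberg i (foldr heisenberg is v)" for "is"
    by (induction "is") (auto simp: comm)
  then show ?thesis by (simp add: heisenberg_monomial_def sorted_list_of_multiset_insert)
qed

text \<open>Sorting puts the indices in increasing order; operators with indices of the same sign commute,
  so the order among them is immaterial.\<close>

lemma heisenberg_monomial_add_pos:
  assumes "i > 0" "\<And>j. j \<in># lam \<Longrightarrow> j > 0"
  shows "heisenberg_monomial (add_mset i lam) v = heisenberg i (heisenberg_monomial lam v)"
proof -
  have "foldr heisenberg (insort i is) v = heisenberg i (foldr heisenberg is v)" if "\<forall>j\<in>set is. j > 0" for "is"
    using that by (induction "is") (use assms(1) heisenberg_commute_pos[of _ i] in auto)
  then show ?thesis
    using assms(2) by (simp add: heisenberg_monomial_def sorted_list_of_multiset_insert)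
qed

lemma heisenberg_monomial_union_neg:
  assumes "\<And>i. i \<in># A \<Longrightarrow> i < 0"
  shows "heisenberg_monomial (A + B) v = heisenberg_monomial A (heisenberg_monomial B v)"
  using assms by (induction A) (simp_all add: heisenberg_monomial_add_neg)

lemma heisenberg_monomial_contains_0:
  assumes "0 \<in># lam"
  shows "heisenberg_monomial lam v = 0"
proof -
  have "foldr heisenberg is v = 0" if "0 \<in> set is" for "is"
    using that
  proof (induction "is")
    case (Cons i "is")
    then show ?case
      by (cases "0 \<in> set is") (auto simp: heisenberg_def[of 0])
  qed simp
  then show ?thesis using assms by (simp add: heisenberg_monomial_def)
qed

text \<open>Annihilation lowers the degree by the total index, so only finitely many positive parts can act
  nontrivially on a given vector.\<close>

lemma heisenberg_monomial_pos_deg_le: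
  assumes "\<And>j. j \<in># B \<Longrightarrow> j > 0" "deg_le d v"
  shows "deg_le (d - \<Sum>\<^sub># B) (heisenberg_monomial B v)"
  using assms
proof (induction B)
  case (add i B)
  have "deg_le (d - \<Sum>\<^sub># B - i) (heisenberg i (heisenberg_monomial B v))"
    by (rule heisenberg_deg_le) (use add in auto)
  then show ?case using add.prems by (simp add: heisenberg_monomial_add_pos algebra_simps)
qed simp

definition msets :: "'v set \<Rightarrow> nat \<Rightarrow> 'v multiset set" where
  "msets T n = {M. set_mset M \<subseteq> T \<and> size M = n}"

lemma finite_msets: "finite T \<Longrightarrow> finite (msets T n)"
proof (rule finite_subset)
  show "msets T n \<subseteq> mset ` {xs. set xs \<subseteq> T \<and> length xs = n}"
  proof
    fix M assume M: "M \<in> msets T n"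
    obtain xs where xs: "M = mset xs" by (metis ex_mset)
    with M have "set xs \<subseteq> T" "length xs = n" by (auto simp: msets_def)
    with xs show "M \<in> mset ` {xs. set xs \<subseteq> T \<and> length xs = n}" by blast
  qed
  show "finite T \<Longrightarrow> finite (mset ` {xs. set xs \<subseteq> T \<and> length xs = n})"
    by (simp add: finite_lists_length_eq)
qed

lemma msets_0: "msets T 0 = {{#}}"
  by (auto simp: msets_def)

text \<open>Summation over multisets with the exponential weights is summation over tuples divided by
  the number of orderings. One entry is split off at a time, using
  \<open>n w(M) = \<Sum> c_i w(M - {i})\<close> for the weight of a multiset of size \<open>n\<close>.\<close>

lemma sum_msets_Suc:
  fixes g :: "'v \<Rightarrow> 'r::field_char_0" and \<Psi> :: "'r \<Rightarrow> 'v multiset \<Rightarrow> 'c::ab_group_add"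
  assumes T: "finite T" and add: "\<And>x y M. \<Psi> (x + y) M = \<Psi> x M + \<Psi> y M"
  shows "(\<Sum>M\<in>msets T (Suc n). \<Psi> (exp_coeff g M) M) =
    (\<Sum>i\<in>T. \<Sum>M\<in>msets T n. \<Psi> (g i * exp_coeff g M / of_nat (Suc n)) (add_mset i M))"
proof -
  have zero: "\<Psi> 0 M = 0" for M using add[of 0 0 M] by simp
  have sums: "\<Psi> (sum f S) M = (\<Sum>x\<in>S. \<Psi> (f x) M)" for f :: "'v \<Rightarrow> 'r" and S M
    by (induction S rule: infinite_finite_induct) (simp_all add: zero add)
  have "(\<Sum>M\<in>msets T (Suc n). \<Psi> (exp_coeff g M) M) =
    (\<Sum>M\<in>msets T (Suc n). \<Sum>i\<in>set_mset M. \<Psi> (g i * exp_coeff g (M - {#i#}) / of_nat (Suc n)) M)"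
  proof (rule sum.cong[OF refl])
    fix M assume "M \<in> msets T (Suc n)"
    then have "of_nat (Suc n) * exp_coeff g M = (\<Sum>i\<in>set_mset M. g i * exp_coeff g (M - {#i#}))"
      using exp_coeff_size[of M g] by (simp add: msets_def)
    then have "exp_coeff g M = (\<Sum>i\<in>set_mset M. g i * exp_coeff g (M - {#i#})) / of_nat (Suc n)"
      by (metis nonzero_mult_div_cancel_left of_nat_neq_0)
    then have "exp_coeff g M = (\<Sum>i\<in>set_mset M. g i * exp_coeff g (M - {#i#}) / of_nat (Suc n))"
      by (simp only: sum_divide_distrib)
    then show "\<Psi> (exp_coeff g M) M = (\<Sum>i\<in>set_mset M. \<Psi> (g i * exp_coeff g (M - {#i#}) / of_nat (Suc n)) M)"
      using sums[of "\<lambda>i. g i * exp_coeff g (M - {#i#}) / of_nat (Suc n)" "set_mset M" M] by simp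
  qed
  also have "\<dots> = (\<Sum>(M, i)\<in>Sigma (msets T (Suc n)) set_mset. \<Psi> (g i * exp_coeff g (M - {#i#}) / of_nat (Suc n)) M)"
    by (rule sum.Sigma) (simp_all add: finite_msets T)
  also have "\<dots> = (\<Sum>(i, M)\<in>T \<times> msets T n. \<Psi> (g i * exp_coeff g M / of_nat (Suc n)) (add_mset i M))"
    by (rule sum.reindex_bij_witness[of _ "\<lambda>(i, M). (add_mset i M, i)" "\<lambda>(M, i). (i, M - {#i#})"])
      (auto simp: msets_def size_Diff_singleton dest: in_diffD)
  also have "\<dots> = (\<Sum>i\<in>T. \<Sum>M\<in>msets T n. \<Psi> (g i * exp_coeff g M / of_nat (Suc n)) (add_mset i M))"
    by (simp add: sum.cartesian_product)
  finally show ?thesis .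
qed

context
  fixes T :: "'v set" and g :: "'v \<Rightarrow> 'r::field_char_0" and \<Psi> :: "'r \<Rightarrow> 'v multiset \<Rightarrow> 'c::ab_group_add"
  assumes T: "finite T" and add: "\<And>x y M. \<Psi> (x + y) M = \<Psi> x M + \<Psi> y M"
begin

lemma sum_msets_1: "(\<Sum>M\<in>msets T 1. \<Psi> (exp_coeff g M) M) = (\<Sum>i\<in>T. \<Psi> (g i) {#i#})"
  using sum_msets_Suc[of T \<Psi> g 0, OF T add] by (simp add: msets_0)

lemma sum_msets_2: "(\<Sum>M\<in>msets T 2. \<Psi> (exp_coeff g M) M) = (\<Sum>i\<in>T. \<Sum>j\<in>T. \<Psi> (g i * g j / 2) {#i, j#})"
proof -
  have "(\<Sum>M\<in>msets T 1. \<Psi> (g i * exp_coeff g M / 2) (add_mset i M)) = (\<Sum>j\<in>T. \<Psi> (g i * g j / 2) {#i, j#})" for i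
    using sum_msets_Suc[of T "\<lambda>x M. \<Psi> (g i * x / 2) (add_mset i M)" g 0, OF T]
    by (simp add: msets_0 add algebra_simps add_divide_distrib)
  then show ?thesis
    using sum_msets_Suc[of T \<Psi> g 1, OF T add] by (simp add: numeral_2_eq_2)
qed

lemma sum_msets_3: "(\<Sum>M\<in>msets T 3. \<Psi> (exp_coeff g M) M) =
  (\<Sum>i\<in>T. \<Sum>j\<in>T. \<Sum>k\<in>T. \<Psi> (g i * g j * g k / 6) {#i, j, k#})"
proof -
  have 1: "(\<Sum>M\<in>msets T 1. \<Psi> (g i * (g j * exp_coeff g M / 2) / 3) (add_mset i (add_mset j M))) =
      (\<Sum>k\<in>T. \<Psi> (g i * g j * g k / 6) {#i, j, k#})" for i j
    using sum_msets_Suc[of T "\<lambda>x M. \<Psi> (g i * (g j * x / 2) / 3) (add_mset i (add_mset j M))" g 0, OF T]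
    by (simp add: msets_0 add algebra_simps add_divide_distrib)
  have 2: "(\<Sum>M\<in>msets T 2. \<Psi> (g i * exp_coeff g M / 3) (add_mset i M)) =
      (\<Sum>j\<in>T. \<Sum>M\<in>msets T 1. \<Psi> (g i * (g j * exp_coeff g M / 2) / 3) (add_mset i (add_mset j M)))" for i
    using sum_msets_Suc[of T "\<lambda>x M. \<Psi> (g i * x / 3) (add_mset i M)" g 1, OF T]
    by (simp add: add algebra_simps add_divide_distrib numeral_2_eq_2)
  have three: "Suc 2 = 3" by simp
  show ?thesis
    using sum_msets_Suc[of T \<Psi> g 2, OF T add] by (simp only: three of_nat_numeral 2 1)
qed

end

definition negs :: "nat \<Rightarrow> int set" where "negs d = (\<lambda>a. - int a) ` {1..d}"
definition poss :: "nat \<Rightarrow> int set" where "poss d = int ` {1..d}"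

lemma finite_negs [simp]: "finite (negs d)" and finite_poss [simp]: "finite (poss d)"
  by (simp_all add: negs_def poss_def)

lemma negs_neg: "A \<in> msets (negs d) p \<Longrightarrow> i \<in># A \<Longrightarrow> i < 0"
  by (force simp: msets_def negs_def)

lemma poss_pos: "B \<in> msets (poss d) p \<Longrightarrow> i \<in># B \<Longrightarrow> i > 0"
  by (force simp: msets_def poss_def)

lemma sum_negs: "(\<Sum>i\<in>negs d. F i) = (\<Sum>a=1..d. F (- int a))"
  unfolding negs_def by (subst sum.reindex) (auto simp: inj_on_def)

lemma sum_poss: "(\<Sum>i\<in>poss d. F i) = (\<Sum>a=1..d. F (int a))"
  unfolding poss_def by (subst sum.reindex) (auto simp: inj_on_def)

text \<open>The finite set of generalized partitions that can contribute on vectors of degree at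
  most \<open>d\<close>, for series supported in length at most 4.\<close>

definition sizes :: "(nat \<times> nat) set" where
  "sizes = {(1, 1), (1, 2), (2, 1), (1, 3), (2, 2), (3, 1)}"

lemma sizesI: "m \<noteq> 0 \<Longrightarrow> n \<noteq> 0 \<Longrightarrow> m + n \<le> 4 \<Longrightarrow> (m, n) \<in> sizes"
  unfolding sizes_def insert_iff prod.inject empty_iff by presburger

definition genparts :: "nat \<Rightarrow> int multiset set" where
  "genparts d = {A + B | A B p q. (p, q) \<in> sizes \<and> A \<in> msets (negs d) p \<and> B \<in> msets (poss d) q}"

lemma sum_genparts:
  fixes F :: "int multiset \<Rightarrow> 'c::comm_monoid_add"
  shows "(\<Sum>lam\<in>genparts d. F lam) = (\<Sum>(p, q)\<in>sizes. \<Sum>A\<in>msets (negs d) p. \<Sum>B\<in>msets (poss d) q. F (A + B))"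
proof -
  let ?I = "Sigma sizes (\<lambda>(p, q). msets (negs d) p \<times> msets (poss d) q)"
  have fin: "finite sizes" by (simp add: sizes_def)
  have "genparts d = (\<lambda>(_, A, B). A + B) ` ?I"
    by (auto simp: genparts_def image_iff split: prod.splits) blast
  moreover have "inj_on (\<lambda>(_, A, B). A + B) ?I"
  proof (rule inj_onI)
    fix x y assume x: "x \<in> ?I" and y: "y \<in> ?I"
      and xy: "(case x of (_, A, B) \<Rightarrow> A + B) = (case y of (_, A, B) \<Rightarrow> A + B)"
    obtain p q A B where x': "x = ((p, q), A, B)" by (metis surj_pair)
    obtain p' q' A' B' where y': "y = ((p', q'), A', B')" by (metis surj_pair)
    have A: "A \<in> msets (negs d) p" "A' \<in> msets (negs d) p'" and B: "B \<in> msets (poss d) q" "B' \<in> msets (poss d) q'"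
      and eq: "A + B = A' + B'"
      using x y xy by (auto simp: x' y')
    have "A = A' \<and> B = B'"
      by (rule genpart_split_unique[OF eq]) (use A B negs_neg poss_pos in blast)+
    with A B show "x = y" by (auto simp: msets_def x' y')
  qed
  ultimately have "(\<Sum>lam\<in>genparts d. F lam) = (\<Sum>(x, A, B)\<in>?I. F (A + B))"
    by (simp add: sum.reindex case_prod_unfold)
  also have "\<dots> = (\<Sum>x\<in>sizes. \<Sum>(A, B)\<in>(case x of (p, q) \<Rightarrow> msets (negs d) p \<times> msets (poss d) q). F (A + B))"
    by (subst sum.Sigma) (auto simp: fin finite_msets split: prod.splits)
  also have "\<dots> = (\<Sum>(p, q)\<in>sizes. \<Sum>A\<in>msets (negs d) p. \<Sum>B\<in>msets (poss d) q. F (A + B))"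
    by (intro sum.cong refl) (auto simp: sum.cartesian_product split: prod.splits)
  finally show ?thesis .
qed

lemma finite_genparts: "finite (genparts d)"
proof -
  have "genparts d \<subseteq> (\<Union>(p, q)\<in>sizes. \<Union>A\<in>msets (negs d) p. (\<lambda>B. A + B) ` msets (poss d) q)"
    by (auto simp: genparts_def)
  then show ?thesis
    by (rule finite_subset) (auto simp: sizes_def finite_msets)
qed

lemma op_of_series_genparts:
  fixes v :: "'a::field fock"
  assumes d: "deg_le (int d) v"
    and c: "\<And>lam. c lam \<noteq> 0 \<Longrightarrow> lam \<noteq> {#} \<and> \<Sum>\<^sub># lam = 0 \<and> size lam \<le> 4"
  shows "op_of_series c v = (\<Sum>lam\<in>genparts d. scale (c lam) (heisenberg_monomial lam v))"
  unfolding op_of_series_def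
proof (rule sum.mono_neutral_left[OF finite_genparts])
  show "{lam. scale (c lam) (heisenberg_monomial lam v) \<noteq> 0} \<subseteq> genparts d"
  proof clarify
    fix lam assume nz: "scale (c lam) (heisenberg_monomial lam v) \<noteq> 0"
    let ?A = "genpart_neg lam" and ?B = "genpart_pos lam"
    have "0 \<notin># lam" using nz heisenberg_monomial_contains_0[of lam v] by auto
    then have lam: "lam = ?A + ?B" by (rule genpart_neg_pos)
    from nz have "c lam \<noteq> 0" by auto
    from c[OF this] have ne: "lam \<noteq> {#}" and s: "\<Sum>\<^sub># lam = 0" and sz: "size lam \<le> 4" by auto
    have A: "i < 0" if "i \<in># ?A" for i using that by (simp add: genpart_neg_def)
    have B: "i > 0" if "i \<in># ?B" for i using that by (simp add: genpart_pos_def)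
    have sumAB: "\<Sum>\<^sub># ?A + \<Sum>\<^sub># ?B = 0" using s lam by (metis sum_mset.union)
    have "heisenberg_monomial ?A (heisenberg_monomial ?B v) \<noteq> 0"
      using nz lam heisenberg_monomial_union_neg[of ?A ?B v] A by auto
    then have "heisenberg_monomial ?B v \<noteq> 0" by auto
    then have le: "\<Sum>\<^sub># ?B \<le> int d"
      using deg_le_neg[OF heisenberg_monomial_pos_deg_le[of ?B, OF B d]] by force
    have bound: "0 \<le> \<Sum>\<^sub># X \<and> (\<forall>i\<in>#X. i \<le> \<Sum>\<^sub># X) \<and> (X \<noteq> {#} \<longrightarrow> \<Sum>\<^sub># X > 0)" if "\<And>i. i \<in># X \<Longrightarrow> i > 0" for X :: "int multiset"
      using that by (induction X) (auto, force+)
      \<comment> \<open>The negative parts have the same total, up to sign, as the positive ones, and so the same bound.\<close>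
  let ?A' = "image_mset uminus ?A"
    have sA': "\<Sum>\<^sub># ?A' = \<Sum>\<^sub># ?B"
    proof -
      have "\<Sum>\<^sub># (image_mset uminus X) = - \<Sum>\<^sub># X" for X :: "int multiset"
        by (induction X) simp_all
      with sumAB show ?thesis by simp
    qed
    have bA: "0 \<le> \<Sum>\<^sub># ?A' \<and> (\<forall>i\<in>#?A'. i \<le> \<Sum>\<^sub># ?A') \<and> (?A' \<noteq> {#} \<longrightarrow> \<Sum>\<^sub># ?A' > 0)"
      by (rule bound) (use A in auto)
    have bB: "0 \<le> \<Sum>\<^sub># ?B \<and> (\<forall>i\<in>#?B. i \<le> \<Sum>\<^sub># ?B) \<and> (?B \<noteq> {#} \<longrightarrow> \<Sum>\<^sub># ?B > 0)"
      by (rule bound) (use B in auto)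
    have neA: "?A \<noteq> {#}" and neB: "?B \<noteq> {#}"
      using bA bB sA' ne lam by auto
    have "set_mset ?A \<subseteq> negs d"
    proof
      fix i assume i: "i \<in># ?A"
      then have "- i \<le> int d" using bA sA' le by force
      with A[OF i] show "i \<in> negs d"
        unfolding negs_def by (intro image_eqI[of _ _ "nat (- i)"]) auto
    qed
    moreover have "set_mset ?B \<subseteq> poss d"
    proof
      fix i assume i: "i \<in># ?B"
      then have "i \<le> int d" using bB le by force
      with B[OF i] show "i \<in> poss d"
        unfolding poss_def by (intro image_eqI[of _ _ "nat i"]) auto
    qed
    moreover have "(size ?A, size ?B) \<in> sizes"
    proof -
      have "size ?A \<noteq> 0" "size ?B \<noteq> 0" using neA neB by auto
      moreover have "size ?A + size ?B \<le> 4" using sz lam by (metis size_union)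
      ultimately show ?thesis by (rule sizesI)
    qed
    ultimately show "lam \<in> genparts d"
      unfolding genparts_def msets_def using lam by blast
  qed
qed simp

lemma fls_nth_divide_numeral: "fls_nth (x / numeral w) n = fls_nth x n / numeral w"
  for x :: "'a::field_char_0 fls"
proof -
  have "x = fls_const (numeral w) * (x / numeral w)" by simp
  then have "fls_nth x n = numeral w * fls_nth (x / numeral w) n"
    by (metis fls_mult_const_nth(1))
  then show ?thesis by simp
qed

lemma fls_nth_X_power: "fls_nth (fps_to_fls (fps_X ^ p * f)) (int m) = (if m < p then 0 else f $ (m - p))"
  for f :: "'a::comm_ring_1 fps"
  by (simp add: fps_X_power_mult_nth)

lemma heisenberg_monomial_add_an:
  assumes "n > 0" "\<forall>j\<in>#lam. j > 0"
  shows "heisenberg_monomial (add_mset (int n) lam) v = an n (heisenberg_monomial lam v)"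
  using heisenberg_monomial_add_pos[of "int n" lam v] assms by (simp add: heisenberg_an)

text \<open>The contribution of one generalized partition to the coefficient of \<open>X^m\<close>, additive in
  the weight \<open>x\<close> as the summation over tuples requires. The condition on the sum selects \<open>z^0\<close>.\<close>

definition weighted :: "nat \<Rightarrow> 'a::field_char_0 fock \<Rightarrow> 'a fls \<Rightarrow> int multiset \<Rightarrow> 'a fock" where
  "weighted m v x lam = (if \<Sum>\<^sub># lam = 0 then scale (fls_nth x (int m)) (heisenberg_monomial lam v) else 0)"

lemma weighted_add: "weighted m v (x + y) lam = weighted m v x lam + weighted m v y lam"
  by (simp add: weighted_def scale_add_left)

text \<open>The monomials of \<open>V_0\<close> with \<open>p\<close> creation and \<open>q\<close> annihilation operators, at order \<open>X^m\<close>.\<close>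

definition vertex_part :: "nat \<Rightarrow> 'a::field_char_0 \<Rightarrow> nat \<Rightarrow> 'a fock \<Rightarrow> nat \<Rightarrow> nat \<Rightarrow> 'a fock" where
  "vertex_part m \<alpha> d v p q = (\<Sum>A\<in>msets (negs d) p. \<Sum>B\<in>msets (poss d) q.
     weighted m v (exp_coeff cfls A * exp_coeff (afls \<alpha>) B) (A + B))"

lemma sum_vertex_coeff_genparts:
  "(\<Sum>lam\<in>genparts d. scale (fls_nth (vertex_coeff \<alpha> lam) (int m)) (heisenberg_monomial lam v)) =
    vertex_part m \<alpha> d v 1 1 + vertex_part m \<alpha> d v 1 2 + vertex_part m \<alpha> d v 2 1
    + vertex_part m \<alpha> d v 1 3 + vertex_part m \<alpha> d v 2 2 + vertex_part m \<alpha> d v 3 1"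
proof -
  have "scale (fls_nth (vertex_coeff \<alpha> (A + B)) (int m)) (heisenberg_monomial (A + B) v) =
      weighted m v (exp_coeff cfls A * exp_coeff (afls \<alpha>) B) (A + B)"
    if "A \<in> msets (negs d) p" "B \<in> msets (poss d) q" for A B p q
    by (subst vertex_coeff_split) (use that negs_neg poss_pos in \<open>auto simp: weighted_def\<close>)
  then have "(\<Sum>lam\<in>genparts d. scale (fls_nth (vertex_coeff \<alpha> lam) (int m)) (heisenberg_monomial lam v)) =
      (\<Sum>(p, q)\<in>sizes. vertex_part m \<alpha> d v p q)"
    unfolding sum_genparts vertex_part_def by (auto intro!: sum.cong)
  then show ?thesis by (simp add: sizes_def add_ac)
qed

lemma weighted_eq:
  assumes "x = fps_to_fls (fps_X ^ p * f) / numeral w" "heisenberg_monomial L v = u" "\<Sum>\<^sub># L = 0 \<longleftrightarrow> Q"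
  shows "weighted m v x L = (if Q then scale ((if m < p then 0 else f $ (m - p)) / numeral w) u else 0)"
  using assms by (simp only: weighted_def fls_nth_X_power fls_nth_divide_numeral)

context
  fixes m :: nat and \<alpha> :: "'a::field_char_0" and d :: nat and v :: "'a fock"
begin

lemma weighted_left_add:
  "(\<Sum>B\<in>S. weighted m v ((x + y) * g B) (A + B)) = (\<Sum>B\<in>S. weighted m v (x * g B) (A + B)) + (\<Sum>B\<in>S. weighted m v (y * g B) (A + B))"
  by (simp add: distrib_right weighted_add sum.distrib)

lemma weighted_right_add: "weighted m v (z * (x + y)) L = weighted m v (z * x) L + weighted m v (z * y) L"
  by (simp add: distrib_left weighted_add)

lemmas left_1 = sum_msets_1[of "negs d" "\<lambda>x A. \<Sum>B\<in>msets (poss d) q. weighted m v (x * exp_coeff (afls \<alpha>) B) (A + B)" cfls for q,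
    OF finite_negs weighted_left_add]
lemmas left_2 = sum_msets_2[of "negs d" "\<lambda>x A. \<Sum>B\<in>msets (poss d) q. weighted m v (x * exp_coeff (afls \<alpha>) B) (A + B)" cfls for q,
    OF finite_negs weighted_left_add]
lemmas left_3 = sum_msets_3[of "negs d" "\<lambda>x A. \<Sum>B\<in>msets (poss d) q. weighted m v (x * exp_coeff (afls \<alpha>) B) (A + B)" cfls for q,
    OF finite_negs weighted_left_add]
lemmas right_1 = sum_msets_1[of "poss d" "\<lambda>x B. weighted m v (z * x) (A + B)" "afls \<alpha>" for z A, OF finite_poss weighted_right_add]
lemmas right_2 = sum_msets_2[of "poss d" "\<lambda>x B. weighted m v (z * x) (A + B)" "afls \<alpha>" for z A, OF finite_poss weighted_right_add]
lemmas right_3 = sum_msets_3[of "poss d" "\<lambda>x B. weighted m v (z * x) (A + B)" "afls \<alpha>" for z A, OF finite_poss weighted_right_add]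

text \<open>The division by \<open>Numeral1\<close> brings the formula into the form of \<open>weighted_eq\<close>; for more operators
  the divisor is the number of orderings.\<close>

lemma vertex_part_11: "vertex_part m \<alpha> d v 1 1 = (\<Sum>a=1..d. \<Sum>b=1..d.
    if a = b then scale ((if m < 2 then 0 else (cfps a * afps \<alpha> b) $ (m - 2)) / Numeral1) (cr a (an b v)) else 0)"
  unfolding vertex_part_def left_1 unfolding right_1 sum_negs sum_poss
proof (intro sum.cong refl weighted_eq)
  fix a b assume i: "a \<in> {1..d}" "b \<in> {1..d}"
  show "cfls (- int a) * afls \<alpha> (int b) = fps_to_fls (fps_X ^ 2 * (cfps a * afps \<alpha> b)) / Numeral1"
    by (simp add: cfls_def afls_def power2_eq_square mult_ac flip: fls_times_fps_to_fls)
  show "heisenberg_monomial ({#- int a#} + {#int b#}) v = cr a (an b v)"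
    by (subst heisenberg_monomial_union_neg)
      (use i in \<open>auto simp: heisenberg_monomial_add_neg heisenberg_monomial_add_an heisenberg_cr\<close>)
  show "\<Sum>\<^sub># ({#- int a#} + {#int b#}) = 0 \<longleftrightarrow> a = b" by auto
qed

lemma vertex_part_21: "vertex_part m \<alpha> d v 2 1 = (\<Sum>a=1..d. \<Sum>b=1..d. \<Sum>c=1..d.
    if a + b = c then scale ((if m < 3 then 0 else (cfps a * cfps b * afps \<alpha> c) $ (m - 3)) / 2) (cr a (cr b (an c v))) else 0)"
  unfolding vertex_part_def left_2 unfolding right_1 sum_negs sum_poss
proof (intro sum.cong refl weighted_eq)
  fix a b c assume i: "a \<in> {1..d}" "b \<in> {1..d}" "c \<in> {1..d}"
  have "cfls (- int a) * cfls (- int b) * afls \<alpha> (int c) = fps_to_fls (fps_X ^ 3 * (cfps a * cfps b * afps \<alpha> c))"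
    by (simp add: cfls_def afls_def power3_eq_cube mult_ac flip: fls_times_fps_to_fls)
  then show "cfls (- int a) * cfls (- int b) / 2 * afls \<alpha> (int c) = fps_to_fls (fps_X ^ 3 * (cfps a * cfps b * afps \<alpha> c)) / 2"
    by simp
  show "heisenberg_monomial ({#- int a, - int b#} + {#int c#}) v = cr a (cr b (an c v))"
    by (subst heisenberg_monomial_union_neg)
      (use i in \<open>auto simp: heisenberg_monomial_add_neg heisenberg_monomial_add_an heisenberg_cr\<close>)
  show "\<Sum>\<^sub># ({#- int a, - int b#} + {#int c#}) = 0 \<longleftrightarrow> a + b = c" by auto
qed

lemma vertex_part_12: "vertex_part m \<alpha> d v 1 2 = (\<Sum>a=1..d. \<Sum>b=1..d. \<Sum>c=1..d.
    if a = b + c then scale ((if m < 3 then 0 else (cfps a * afps \<alpha> b * afps \<alpha> c) $ (m - 3)) / 2) (cr a (an b (an c v))) else 0)"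
  unfolding vertex_part_def left_1 unfolding right_2 sum_negs sum_poss
proof (intro sum.cong refl weighted_eq)
  fix a b c assume i: "a \<in> {1..d}" "b \<in> {1..d}" "c \<in> {1..d}"
  have "cfls (- int a) * afls \<alpha> (int b) * afls \<alpha> (int c) = fps_to_fls (fps_X ^ 3 * (cfps a * afps \<alpha> b * afps \<alpha> c))"
    by (simp add: cfls_def afls_def power3_eq_cube mult_ac flip: fls_times_fps_to_fls)
  then show "cfls (- int a) * (afls \<alpha> (int b) * afls \<alpha> (int c) / 2) = fps_to_fls (fps_X ^ 3 * (cfps a * afps \<alpha> b * afps \<alpha> c)) / 2"
    by (simp add: mult.assoc)
  show "heisenberg_monomial ({#- int a#} + {#int b, int c#}) v = cr a (an b (an c v))"
    by (subst heisenberg_monomial_union_neg)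
      (use i in \<open>auto simp: heisenberg_monomial_add_neg heisenberg_monomial_add_an heisenberg_cr\<close>)
  show "\<Sum>\<^sub># ({#- int a#} + {#int b, int c#}) = 0 \<longleftrightarrow> a = b + c" by auto
qed

lemma vertex_part_31: "vertex_part m \<alpha> d v 3 1 = (\<Sum>a=1..d. \<Sum>b=1..d. \<Sum>c=1..d. \<Sum>e=1..d.
    if a + b + c = e then scale ((if m < 4 then 0 else (cfps a * cfps b * (cfps c * afps \<alpha> e)) $ (m - 4)) / 6) (cr a (cr b (cr c (an e v)))) else 0)"
  unfolding vertex_part_def left_3 unfolding right_1 sum_negs sum_poss
proof (intro sum.cong refl weighted_eq)
  fix a b c e assume i: "a \<in> {1..d}" "b \<in> {1..d}" "c \<in> {1..d}" "e \<in> {1..d}"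
  have "cfls (- int a) * cfls (- int b) * cfls (- int c) * afls \<alpha> (int e) = fps_to_fls (fps_X ^ 4 * (cfps a * cfps b * (cfps c * afps \<alpha> e)))"
    by (simp add: cfls_def afls_def power4_eq_xxxx mult_ac flip: fls_times_fps_to_fls)
  then show "cfls (- int a) * cfls (- int b) * cfls (- int c) / 6 * afls \<alpha> (int e) = fps_to_fls (fps_X ^ 4 * (cfps a * cfps b * (cfps c * afps \<alpha> e))) / 6"
    by simp
  show "heisenberg_monomial ({#- int a, - int b, - int c#} + {#int e#}) v = cr a (cr b (cr c (an e v)))"
    by (subst heisenberg_monomial_union_neg)
      (use i in \<open>auto simp: heisenberg_monomial_add_neg heisenberg_monomial_add_an heisenberg_cr\<close>)
  show "\<Sum>\<^sub># ({#- int a, - int b, - int c#} + {#int e#}) = 0 \<longleftrightarrow> a + b + c = e" by auto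
qed

lemma vertex_part_22: "vertex_part m \<alpha> d v 2 2 = (\<Sum>a=1..d. \<Sum>b=1..d. \<Sum>c=1..d. \<Sum>e=1..d.
    if a + b = c + e then scale ((if m < 4 then 0 else (cfps a * cfps b * (afps \<alpha> c * afps \<alpha> e)) $ (m - 4)) / 4) (cr a (cr b (an c (an e v)))) else 0)"
  unfolding vertex_part_def left_2 unfolding right_2 sum_negs sum_poss
proof (intro sum.cong refl weighted_eq)
  fix a b c e assume i: "a \<in> {1..d}" "b \<in> {1..d}" "c \<in> {1..d}" "e \<in> {1..d}"
  have "cfls (- int a) * cfls (- int b) * (afls \<alpha> (int c) * afls \<alpha> (int e)) = fps_to_fls (fps_X ^ 4 * (cfps a * cfps b * (afps \<alpha> c * afps \<alpha> e)))"
    by (simp add: cfls_def afls_def power4_eq_xxxx mult_ac flip: fls_times_fps_to_fls)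
  then show "cfls (- int a) * cfls (- int b) / 2 * (afls \<alpha> (int c) * afls \<alpha> (int e) / 2) = fps_to_fls (fps_X ^ 4 * (cfps a * cfps b * (afps \<alpha> c * afps \<alpha> e))) / 4"
    by simp
  show "heisenberg_monomial ({#- int a, - int b#} + {#int c, int e#}) v = cr a (cr b (an c (an e v)))"
    by (subst heisenberg_monomial_union_neg)
      (use i in \<open>auto simp: heisenberg_monomial_add_neg heisenberg_monomial_add_an heisenberg_cr\<close>)
  show "\<Sum>\<^sub># ({#- int a, - int b#} + {#int c, int e#}) = 0 \<longleftrightarrow> a + b = c + e" by auto
qed

lemma vertex_part_13: "vertex_part m \<alpha> d v 1 3 = (\<Sum>a=1..d. \<Sum>b=1..d. \<Sum>c=1..d. \<Sum>e=1..d.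
    if a = b + c + e then scale ((if m < 4 then 0 else (cfps a * afps \<alpha> b * (afps \<alpha> c * afps \<alpha> e)) $ (m - 4)) / 6) (cr a (an b (an c (an e v)))) else 0)"
  unfolding vertex_part_def left_1 unfolding right_3 sum_negs sum_poss
proof (intro sum.cong refl weighted_eq)
  fix a b c e assume i: "a \<in> {1..d}" "b \<in> {1..d}" "c \<in> {1..d}" "e \<in> {1..d}"
  have "cfls (- int a) * (afls \<alpha> (int b) * afls \<alpha> (int c) * afls \<alpha> (int e)) = fps_to_fls (fps_X ^ 4 * (cfps a * afps \<alpha> b * (afps \<alpha> c * afps \<alpha> e)))"
    by (simp add: cfls_def afls_def power4_eq_xxxx mult_ac flip: fls_times_fps_to_fls)
  then show "cfls (- int a) * (afls \<alpha> (int b) * afls \<alpha> (int c) * afls \<alpha> (int e) / 6) = fps_to_fls (fps_X ^ 4 * (cfps a * afps \<alpha> b * (afps \<alpha> c * afps \<alpha> e))) / 6"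
    by simp
  show "heisenberg_monomial ({#- int a#} + {#int b, int c, int e#}) v = cr a (an b (an c (an e v)))"
    by (subst heisenberg_monomial_union_neg)
      (use i in \<open>auto simp: heisenberg_monomial_add_neg heisenberg_monomial_add_an heisenberg_cr\<close>)
  show "\<Sum>\<^sub># ({#- int a#} + {#int b, int c, int e#}) = 0 \<longleftrightarrow> a = b + c + e" by auto
qed

end

lemma vertex_part_2:
  fixes v :: "'a::field_char_0 fock"
  shows "vertex_part 2 \<alpha> d v 1 1 = scale \<alpha> (normal11 d 0 v)"
    "vertex_part 2 \<alpha> d v 2 1 = 0" "vertex_part 2 \<alpha> d v 1 2 = 0"
    "vertex_part 2 \<alpha> d v 3 1 = 0" "vertex_part 2 \<alpha> d v 2 2 = 0" "vertex_part 2 \<alpha> d v 1 3 = 0"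
proof -
  show "vertex_part 2 \<alpha> d v 1 1 = scale \<alpha> (normal11 d 0 v)"
    unfolding vertex_part_11 normal11_def scale_sum
    by (intro sum.cong refl, subst sum_collapse) (simp_all add: fps_mult_nth_012 cfps_nth afps_nth)
qed (unfold vertex_part_21 vertex_part_12 vertex_part_31 vertex_part_22 vertex_part_13, (intro sum.neutral ballI, simp)+)

lemma vertex_part_3:
  fixes v :: "'a::field_char_0 fock"
  shows "vertex_part 3 \<alpha> d v 1 1 = scale (\<alpha> * (\<alpha> - 1) / 2) (normal11 d 1 v)"
    "vertex_part 3 \<alpha> d v 2 1 = scale (\<alpha> / 2) (normal21 d 0 v)" "vertex_part 3 \<alpha> d v 1 2 = scale (\<alpha>\<^sup>2 / 2) (normal12 d 0 v)"
    "vertex_part 3 \<alpha> d v 3 1 = 0" "vertex_part 3 \<alpha> d v 2 2 = 0" "vertex_part 3 \<alpha> d v 1 3 = 0"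
proof -
  show "vertex_part 3 \<alpha> d v 1 1 = scale (\<alpha> * (\<alpha> - 1) / 2) (normal11 d 1 v)"
    unfolding vertex_part_11 normal11_def scale_sum scale_scale
    by (intro sum.cong refl, subst sum_collapse)
      (simp_all add: fps_mult_nth_012 cfps_nth afps_nth field_simps power2_eq_square)
  show "vertex_part 3 \<alpha> d v 2 1 = scale (\<alpha> / 2) (normal21 d 0 v)"
    unfolding vertex_part_21 normal21_def fock_linear
    by (intro sum.cong refl) (simp add: fps_mult_nth_012 cfps_nth afps_nth)
  show "vertex_part 3 \<alpha> d v 1 2 = scale (\<alpha>\<^sup>2 / 2) (normal12 d 0 v)"
    unfolding vertex_part_12 normal12_def fock_linear
    by (intro sum.cong refl) (simp add: fps_mult_nth_012 cfps_nth afps_nth power2_eq_square)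
qed (unfold vertex_part_31 vertex_part_22 vertex_part_13, (intro sum.neutral ballI, simp)+)

text \<open>The weights of the cubic terms are functions of the total index alone, because the
  second coefficients of \<^const>\<open>cfps\<close> and \<^const>\<open>afps\<close> are linear in the index.\<close>

lemma vertex_part_4:
  fixes v :: "'a::field_char_0 fock"
  shows "vertex_part 4 \<alpha> d v 1 1 = scale (\<alpha> * (\<alpha>\<^sup>2 / 6 - \<alpha> / 4 + 1 / 6)) (normal11 d 2 v)"
    "vertex_part 4 \<alpha> d v 2 1 = scale (\<alpha> * (\<alpha> - 1) / 4) (normal21 d 1 v)"
    "vertex_part 4 \<alpha> d v 1 2 = scale (\<alpha>\<^sup>2 * (\<alpha> - 1) / 4) (normal12 d 1 v)"
    "vertex_part 4 \<alpha> d v 3 1 = scale (\<alpha> / 6) (normal31 d v)"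
    "vertex_part 4 \<alpha> d v 2 2 = scale (\<alpha>\<^sup>2 / 4) (normal22 d v)"
    "vertex_part 4 \<alpha> d v 1 3 = scale (\<alpha> ^ 3 / 6) (normal13 d v)"
proof -
  show "vertex_part 4 \<alpha> d v 1 1 = scale (\<alpha> * (\<alpha>\<^sup>2 / 6 - \<alpha> / 4 + 1 / 6)) (normal11 d 2 v)"
    unfolding vertex_part_11 normal11_def scale_sum scale_scale
    by (intro sum.cong refl, subst sum_collapse)
      (simp_all add: fps_mult_nth_012 cfps_nth afps_nth field_simps power2_eq_square power3_eq_cube)
  show "vertex_part 4 \<alpha> d v 2 1 = scale (\<alpha> * (\<alpha> - 1) / 4) (normal21 d 1 v)"
    unfolding vertex_part_21 normal21_def fock_linear
    by (intro sum.cong refl) (auto simp: fps_mult_nth_012 cfps_nth afps_nth field_simps power2_eq_square)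
  show "vertex_part 4 \<alpha> d v 1 2 = scale (\<alpha>\<^sup>2 * (\<alpha> - 1) / 4) (normal12 d 1 v)"
    unfolding vertex_part_12 normal12_def fock_linear
  proof (intro sum.cong refl)
    fix a b c :: nat
    have "(cfps (b + c) * afps \<alpha> b * afps \<alpha> c) $ Suc 0 / 2 = \<alpha>\<^sup>2 * (\<alpha> - 1) / 4 * of_nat (b + c)"
      by (simp add: fps_mult_nth_012 cfps_nth afps_nth field_simps power2_eq_square)
    moreover have "(4::nat) - 3 = Suc 0" "\<not> 4 < (3::nat)" by simp_all
    ultimately show "(if a = b + c then scale ((if 4 < (3::nat) then 0 else (cfps a * afps \<alpha> b * afps \<alpha> c) $ (4 - 3)) / 2) (cr a (an b (an c v))) else 0) =
      (if a = b + c then scale (\<alpha>\<^sup>2 * (\<alpha> - 1) / 4 * of_nat a ^ 1) (cr a (an b (an c v))) else 0)"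
      by (cases "a = b + c") (simp_all only: if_True if_False power_one_right)
  qed
  show "vertex_part 4 \<alpha> d v 3 1 = scale (\<alpha> / 6) (normal31 d v)"
    unfolding vertex_part_31 normal31_def fock_linear
    by (intro sum.cong refl) (simp add: fps_mult_nth_012 cfps_nth afps_nth)
  show "vertex_part 4 \<alpha> d v 2 2 = scale (\<alpha>\<^sup>2 / 4) (normal22 d v)"
    unfolding vertex_part_22 normal22_def fock_linear
    by (intro sum.cong refl) (simp add: fps_mult_nth_012 cfps_nth afps_nth power2_eq_square)
  show "vertex_part 4 \<alpha> d v 1 3 = scale (\<alpha> ^ 3 / 6) (normal13 d v)"
    unfolding vertex_part_13 normal13_def fock_linear
    by (intro sum.cong refl) (simp add: fps_mult_nth_012 cfps_nth afps_nth power3_eq_cube mult_ac)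
qed

lemma vertex_coeff_nonzero:
  assumes "vertex_coeff \<alpha> lam \<noteq> 0"
  shows "\<Sum>\<^sub># lam = 0"
proof (cases "0 \<in># lam")
  case True
  then show ?thesis using assms by (simp add: vertex_coeff_def vertex0_zero)
next
  case False
  have "vertex_coeff \<alpha> (genpart_neg lam + genpart_pos lam) = (if \<Sum>\<^sub># (genpart_neg lam + genpart_pos lam) = 0
      then exp_coeff cfls (genpart_neg lam) * exp_coeff (afls \<alpha>) (genpart_pos lam) else 0)"
    by (rule vertex_coeff_split) (simp_all add: genpart_neg_def genpart_pos_def)
  with assms show ?thesis
    unfolding genpart_neg_pos[OF False, symmetric] by (metis (full_types))
qed

lemma Bbar_coeff_support:
  assumes "\<alpha> \<noteq> 0" "k \<le> 2" "Bbar_coeff k \<alpha> lam \<noteq> 0"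
  shows "lam \<noteq> {#} \<and> \<Sum>\<^sub># lam = 0 \<and> size lam \<le> 4"
proof -
  have ne: "lam \<noteq> {#}" using assms(3) Bbar_coeff_empty by metis
  then show ?thesis
    using Bbar_coeff_vertex_coeff(4,5)[OF assms(1) ne] assms(2,3) vertex_coeff_nonzero by (metis not_le)
qed

context
  fixes \<alpha> :: "'a::field_char_0" and d :: nat and v :: "'a fock"
  assumes \<alpha>: "\<alpha> \<noteq> 0" and v: "deg_le (int d) v"
begin

lemma op_Bbar_genparts: "k \<le> 2 \<Longrightarrow> op_of_series (Bbar_coeff k \<alpha>) v =
    (\<Sum>lam\<in>genparts d. scale (Bbar_coeff k \<alpha> lam) (heisenberg_monomial lam v))"
  by (rule op_of_series_genparts[OF v]) (rule Bbar_coeff_support[OF \<alpha>])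

lemma genparts_nonempty: "lam \<in> genparts d \<Longrightarrow> lam \<noteq> {#}"
  by (auto simp: genparts_def sizes_def msets_def)

lemma vertex_order_2: "scale \<alpha> (op_of_series (Bbar_coeff 0 \<alpha>) v) = scale \<alpha> (normal11 d 0 v)"
proof -
  have "scale \<alpha> (op_of_series (Bbar_coeff 0 \<alpha>) v) =
      (\<Sum>lam\<in>genparts d. scale (fls_nth (vertex_coeff \<alpha> lam) (int 2)) (heisenberg_monomial lam v))"
    unfolding op_Bbar_genparts[OF le0] scale_sum scale_scale
    by (intro sum.cong refl) (simp add: Bbar_coeff_vertex_coeff(1)[OF \<alpha> genparts_nonempty])
  then show ?thesis by (simp only: sum_vertex_coeff_genparts vertex_part_2) simp
qed

lemma vertex_order_3: "scale \<alpha> (op_of_series (Bbar_coeff 1 \<alpha>) v) + scale (\<alpha> * (\<alpha> - 1) / 2) (op_of_series (Bbar_coeff 0 \<alpha>) v) =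
  scale (\<alpha> * (\<alpha> - 1) / 2) (normal11 d 1 v) + scale (\<alpha> / 2) (normal21 d 0 v) + scale (\<alpha>\<^sup>2 / 2) (normal12 d 0 v)"
proof -
  have "scale \<alpha> (op_of_series (Bbar_coeff 1 \<alpha>) v) + scale (\<alpha> * (\<alpha> - 1) / 2) (op_of_series (Bbar_coeff 0 \<alpha>) v) =
      (\<Sum>lam\<in>genparts d. scale (fls_nth (vertex_coeff \<alpha> lam) (int 3)) (heisenberg_monomial lam v))"
    unfolding op_Bbar_genparts[OF le0] op_Bbar_genparts[OF one_le_numeral] scale_sum scale_scale sum.distrib[symmetric]
      scale_add_left[symmetric]
    by (intro sum.cong refl) (simp add: Bbar_coeff_vertex_coeff(2)[OF \<alpha> genparts_nonempty])
  then show ?thesis by (simp only: sum_vertex_coeff_genparts vertex_part_3) (simp add: algebra_simps)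
qed

lemma vertex_order_4: "scale \<alpha> (op_of_series (Bbar_coeff 2 \<alpha>) v) + scale (\<alpha> * (\<alpha> - 1) / 2) (op_of_series (Bbar_coeff 1 \<alpha>) v)
    + scale (\<alpha> * (\<alpha>\<^sup>2 / 6 - \<alpha> / 4 + 1 / 6)) (op_of_series (Bbar_coeff 0 \<alpha>) v) =
  scale (\<alpha> * (\<alpha>\<^sup>2 / 6 - \<alpha> / 4 + 1 / 6)) (normal11 d 2 v) + scale (\<alpha> * (\<alpha> - 1) / 4) (normal21 d 1 v)
    + scale (\<alpha>\<^sup>2 * (\<alpha> - 1) / 4) (normal12 d 1 v) + scale (\<alpha> / 6) (normal31 d v) + scale (\<alpha>\<^sup>2 / 4) (normal22 d v) + scale (\<alpha> ^ 3 / 6) (normal13 d v)"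
proof -
  have "scale \<alpha> (op_of_series (Bbar_coeff 2 \<alpha>) v) + scale (\<alpha> * (\<alpha> - 1) / 2) (op_of_series (Bbar_coeff 1 \<alpha>) v)
    + scale (\<alpha> * (\<alpha>\<^sup>2 / 6 - \<alpha> / 4 + 1 / 6)) (op_of_series (Bbar_coeff 0 \<alpha>) v) =
      (\<Sum>lam\<in>genparts d. scale (fls_nth (vertex_coeff \<alpha> lam) (int 4)) (heisenberg_monomial lam v))"
    unfolding op_Bbar_genparts[OF le0] op_Bbar_genparts[OF one_le_numeral] op_Bbar_genparts[OF order_refl]
      scale_sum scale_scale sum.distrib[symmetric] scale_add_left[symmetric]
    by (intro sum.cong refl) (simp add: Bbar_coeff_vertex_coeff(3)[OF \<alpha> genparts_nonempty])
  then show ?thesis by (simp only: sum_vertex_coeff_genparts vertex_part_4) (simp add: algebra_simps)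
qed

lemma op_Bbar_0: "op_of_series (Bbar_coeff 0 \<alpha>) v = ham \<alpha> d 0 v"
  using arg_cong[OF vertex_order_2, of "scale (1 / \<alpha>)"] \<alpha> by (simp add: scale_scale ham_0)

lemma op_Bbar_1: "scale 2 (op_of_series (Bbar_coeff 1 \<alpha>) v) = ham \<alpha> d 1 v - scale (\<alpha> - 1) (ham \<alpha> d 0 v)"
proof (rule poly_mapping_eqI)
  fix mu :: partition
  let ?l = "\<lambda>w. Poly_Mapping.lookup w mu"
  have "\<alpha> * ?l (op_of_series (Bbar_coeff 1 \<alpha>) v) + \<alpha> * (\<alpha> - 1) / 2 * ?l (normal11 d 0 v) =
    \<alpha> * (\<alpha> - 1) / 2 * ?l (normal11 d 1 v) + \<alpha> / 2 * ?l (normal21 d 0 v) + \<alpha>\<^sup>2 / 2 * ?l (normal12 d 0 v)"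
    using arg_cong[OF vertex_order_3, of ?l] by (simp add: lookup_add lookup_scale op_Bbar_0 ham_0)
  then have "2 * (\<alpha> * (2 * ?l (op_of_series (Bbar_coeff 1 \<alpha>) v))) =
    2 * (\<alpha> * ((\<alpha> - 1) * ?l (normal11 d 1 v) + ?l (normal21 d 0 v) + \<alpha> * ?l (normal12 d 0 v) - (\<alpha> - 1) * ?l (normal11 d 0 v)))"
    by (simp add: field_simps power2_eq_square)
  then have "\<alpha> * (2 * ?l (op_of_series (Bbar_coeff 1 \<alpha>) v)) =
    \<alpha> * ((\<alpha> - 1) * ?l (normal11 d 1 v) + ?l (normal21 d 0 v) + \<alpha> * ?l (normal12 d 0 v) - (\<alpha> - 1) * ?l (normal11 d 0 v))"
    by (rule mult_left_cancel[THEN iffD1, rotated]) simp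
  then have "2 * ?l (op_of_series (Bbar_coeff 1 \<alpha>) v) =
    (\<alpha> - 1) * ?l (normal11 d 1 v) + ?l (normal21 d 0 v) + \<alpha> * ?l (normal12 d 0 v) - (\<alpha> - 1) * ?l (normal11 d 0 v)"
    by (rule mult_left_cancel[OF \<alpha>, THEN iffD1])
  then show "?l (scale 2 (op_of_series (Bbar_coeff 1 \<alpha>) v)) = ?l (ham \<alpha> d 1 v - scale (\<alpha> - 1) (ham \<alpha> d 0 v))"
    by (simp add: lookup_scale lookup_minus lookup_add ham_0 ham_1[unfolded One_nat_def])
qed

text \<open>The quartic terms of \<open>H 2\<close> are six times those of \<open>B2\<close> up to \<^const>\<open>normal22_diag\<close>, which the square of the energy
  removes together with the surplus quadratic terms. Subtracting \<open>H 1\<close> corrects the weights of the cubic terms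
  from \<open>c\<close> to \<open>c - 1\<close>.\<close>

lemma op_Bbar_2: "scale 6 (op_of_series (Bbar_coeff 2 \<alpha>) v) = ham \<alpha> d 2 v + scale (\<alpha> / 2) (ham \<alpha> d 0 (ham \<alpha> d 0 v))
   - scale (3 / 2 * (\<alpha> - 1)) (ham \<alpha> d 1 v) + scale ((\<alpha>\<^sup>2 - 3 * \<alpha> + 1) / 2) (ham \<alpha> d 0 v)"
proof (rule poly_mapping_eqI)
  fix mu :: partition
  let ?l = "\<lambda>w. Poly_Mapping.lookup w mu"
  let ?B = "op_of_series (Bbar_coeff 2 \<alpha>) v"
  have h1: "?l (ham \<alpha> d 1 v) = (\<alpha> - 1) * ?l (normal11 d 1 v) + \<alpha> * ?l (normal12 d 0 v) + ?l (normal21 d 0 v)"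
    unfolding ham_1 by (simp add: lookup_add lookup_scale)
  have h2: "2 * ?l (ham \<alpha> d 2 v) = (2 * (\<alpha> - 1)\<^sup>2 + \<alpha>) * ?l (normal11 d 2 v) + 3 * (\<alpha> * (\<alpha> - 1)) * ?l (normal12 d 1 v)
    + 3 * (\<alpha> - 1) * ?l (normal21 d 1 v) + 2 * \<alpha>\<^sup>2 * ?l (normal13 d v) + 3 * \<alpha> * ?l (normal22 d v) + 2 * ?l (normal31 d v)
    - \<alpha> * ?l (normal22_diag d v) - \<alpha> * ?l (normal11 d 1 v)"
    using arg_cong[OF ham_2[OF v, of \<alpha>], of ?l] by (simp add: lookup_add lookup_scale algebra_simps)
  have b1: "2 * ?l (op_of_series (Bbar_coeff 1 \<alpha>) v) = ?l (ham \<alpha> d 1 v) - (\<alpha> - 1) * ?l (normal11 d 0 v)"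
    using arg_cong[OF op_Bbar_1, of ?l] by (simp add: lookup_minus lookup_scale ham_0)
  let ?R = "(\<alpha>\<^sup>2 - 3 / 2 * \<alpha> + 1) * (?l (normal11 d 2 v) - ?l (normal11 d 0 v)) + 3 / 2 * (\<alpha> - 1) * ?l (normal21 d 1 v)
    + 3 / 2 * \<alpha> * (\<alpha> - 1) * ?l (normal12 d 1 v) + ?l (normal31 d v) + 3 / 2 * \<alpha> * ?l (normal22 d v) + \<alpha>\<^sup>2 * ?l (normal13 d v)
    - 3 / 2 * (\<alpha> - 1) * (?l (ham \<alpha> d 1 v) - (\<alpha> - 1) * ?l (normal11 d 0 v))"
  let ?L = "\<alpha> * ?l ?B + \<alpha> * (\<alpha> - 1) / 4 * (2 * ?l (op_of_series (Bbar_coeff 1 \<alpha>) v))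
    + \<alpha> * (\<alpha>\<^sup>2 / 6 - \<alpha> / 4 + 1 / 6) * ?l (normal11 d 0 v)"
  let ?M = "\<alpha> * (\<alpha>\<^sup>2 / 6 - \<alpha> / 4 + 1 / 6) * ?l (normal11 d 2 v) + \<alpha> * (\<alpha> - 1) / 4 * ?l (normal21 d 1 v)
    + \<alpha>\<^sup>2 * (\<alpha> - 1) / 4 * ?l (normal12 d 1 v) + \<alpha> / 6 * ?l (normal31 d v) + \<alpha>\<^sup>2 / 4 * ?l (normal22 d v) + \<alpha> ^ 3 / 6 * ?l (normal13 d v)"
  have "?L = ?M"
    using arg_cong[OF vertex_order_4, of ?l] by (simp add: lookup_add lookup_scale op_Bbar_0 ham_0 mult.assoc)
  then have e4: "?L - ?M = 0" by simp
  have "\<alpha> * (6 * ?l ?B) - \<alpha> * ?R = 6 * (?L - ?M)"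
    unfolding b1 by (simp add: field_simps power2_eq_square power3_eq_cube)
  then have "\<alpha> * (6 * ?l ?B) = \<alpha> * ?R"
    unfolding e4 by simp
  then have B: "6 * ?l ?B = ?R"
    by (rule mult_left_cancel[OF \<alpha>, THEN iffD1])
  let ?T = "?l (ham \<alpha> d 2 v) + \<alpha> / 2 * (?l (normal22_diag d v) + ?l (normal11 d 1 v))
    - 3 / 2 * (\<alpha> - 1) * ?l (ham \<alpha> d 1 v) + (\<alpha>\<^sup>2 - 3 * \<alpha> + 1) / 2 * ?l (normal11 d 0 v)"
  have "2 * ?T = 2 * ?l (ham \<alpha> d 2 v) + \<alpha> * (?l (normal22_diag d v) + ?l (normal11 d 1 v))
    - 3 * (\<alpha> - 1) * ?l (ham \<alpha> d 1 v) + (\<alpha>\<^sup>2 - 3 * \<alpha> + 1) * ?l (normal11 d 0 v)"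
    by (simp add: field_simps)
  also have "\<dots> = 2 * ?R"
    unfolding h2 by (simp add: field_simps power2_eq_square)
  finally have "2 * (6 * ?l ?B) = 2 * ?T" by (simp only: B)
  then have "6 * ?l ?B = ?T"
    by (rule mult_left_cancel[THEN iffD1, rotated]) simp
  then show "?l (scale 6 ?B) = ?l (ham \<alpha> d 2 v + scale (\<alpha> / 2) (ham \<alpha> d 0 (ham \<alpha> d 0 v))
   - scale (3 / 2 * (\<alpha> - 1)) (ham \<alpha> d 1 v) + scale ((\<alpha>\<^sup>2 - 3 * \<alpha> + 1) / 2) (ham \<alpha> d 0 v))"
    unfolding ham_0_twice unfolding lookup_add lookup_minus lookup_scale ham_0 by simp
qed

end

section \<open>Twisting and linearity\<close>

lemma lookup_twist_length: "Poly_Mapping.lookup (twist_length s v) mu = s ^ size mu * Poly_Mapping.lookup v mu"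
proof -
  have "Poly_Mapping.lookup (twist_length s v) mu =
      (\<Sum>nu\<in>Poly_Mapping.keys v. if nu = mu then s ^ size mu * Poly_Mapping.lookup v mu else 0)"
    unfolding twist_length_def lookup_sum by (intro sum.cong refl) (auto simp: lookup_single when_def)
  also have "\<dots> = s ^ size mu * Poly_Mapping.lookup v mu"
    by (simp add: in_keys_iff)
  finally show ?thesis .
qed

lemma twist_length_scale: "twist_length s (scale c v) = scale c (twist_length s v)"
  by (rule poly_mapping_eqI) (simp add: lookup_twist_length lookup_scale mult_ac)

lemma twist_length_zero [simp]: "twist_length s 0 = 0"
  by (rule poly_mapping_eqI) (simp add: lookup_twist_length)

lemma twist_length_sum: "twist_length s (sum f A) = (\<Sum>x\<in>A. twist_length s (f x))"
  by (rule poly_mapping_eqI) (simp add: lookup_twist_length lookup_sum sum_distrib_left)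

lemma twist_length_eq_0_iff: "s \<noteq> 0 \<Longrightarrow> twist_length s v = 0 \<longleftrightarrow> v = 0" for s :: "'a::field"
  by (auto simp: poly_mapping_eq_iff fun_eq_iff lookup_twist_length)

lemma heisenberg_twist_length:
  fixes v :: "'a::field fock"
  assumes "s \<noteq> 0"
  shows "heisenberg i (twist_length s v) = scale (s powi sgn i) (twist_length s (heisenberg i v))"
proof (cases i rule: heisenberg_cases)
  case (2 n)
  have "cr n (twist_length s v) = scale (inverse s) (twist_length s (cr n v))"
  proof (rule poly_mapping_eqI)
    fix mu
    show "Poly_Mapping.lookup (cr n (twist_length s v)) mu =
      Poly_Mapping.lookup (scale (inverse s) (twist_length s (cr n v))) mu"
    proof (cases "pos_of_nat n \<in># mu")
      case True
      then obtain nu where "mu = add_mset (pos_of_nat n) nu" by (metis mset_add)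
      then show ?thesis using assms by (simp add: cr_def lookup_creation lookup_twist_length lookup_scale)
    qed (simp add: cr_def lookup_creation lookup_twist_length lookup_scale)
  qed
  then show ?thesis using 2 by (simp add: heisenberg_cr power_int_minus)
next
  case (3 n)
  have "an n (twist_length s v) = scale s (twist_length s (an n v))"
    by (rule poly_mapping_eqI) (simp add: an_def lookup_annihilation lookup_twist_length lookup_scale)
  then show ?thesis using 3 by (simp add: heisenberg_an)
qed (simp add: heisenberg_def)

lemma genpart_delta_sgn: "genpart_delta lam = - (\<Sum>i\<in>#lam. sgn i)"
  by (induction lam) (auto simp: genpart_delta_def genpart_neg_def genpart_pos_def sgn_if)

text \<open>Each creation operator raises the length by one and each annihilation operator lowers it.\<close>

lemma heisenberg_monomial_twist_length:
  fixes v :: "'a::field fock"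
  assumes "s \<noteq> 0"
  shows "scale (s powi genpart_delta lam) (heisenberg_monomial lam (twist_length s v)) = twist_length s (heisenberg_monomial lam v)"
proof -
  have "foldr heisenberg is (twist_length s v) = scale (s powi (\<Sum>i\<leftarrow>is. sgn i)) (twist_length s (foldr heisenberg is v))" for "is"
  proof (induction "is")
    case (Cons i "is")
    then show ?case
      using assms by (simp add: heisenberg_scale heisenberg_twist_length scale_scale power_int_add mult.commute)
  qed simp
  moreover have "(\<Sum>i\<leftarrow>sorted_list_of_multiset lam. sgn i) = (\<Sum>i\<in>#lam. sgn i)"
    by (metis mset_map mset_sorted_list_of_multiset sum_mset_sum_list)
  ultimately show ?thesis
    using assms by (simp add: heisenberg_monomial_def genpart_delta_sgn scale_scale power_int_minus)
qed

lemma op_of_series_twist_delta: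
  fixes v :: "'a::field fock"
  assumes "s \<noteq> 0"
  shows "op_of_series (twist_delta s c) (twist_length s v) = twist_length s (op_of_series c v)"
proof -
  have "scale (twist_delta s c lam) (heisenberg_monomial lam (twist_length s v)) =
      twist_length s (scale (c lam) (heisenberg_monomial lam v))" for lam
    unfolding twist_length_scale heisenberg_monomial_twist_length[OF assms, symmetric]
    by (simp add: scale_scale twist_delta_def mult.commute)
  then show ?thesis
    by (simp add: op_of_series_def twist_length_eq_0_iff[OF assms] twist_length_sum)
qed

lemma op_of_series_scale_series:
  fixes v :: "'a::field fock"
  assumes "a \<noteq> 0"
  shows "op_of_series (scale_series a c) v = scale a (op_of_series c v)"
proof -
  have "scale (scale_series a c lam) (heisenberg_monomial lam v) = scale a (scale (c lam) (heisenberg_monomial lam v))" for lam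
    by (simp add: scale_series_def scale_scale)
  then show ?thesis
    using assms by (simp add: op_of_series_def scale_sum scale_eq_0_iff)
qed

lemma heisenberg_monomial_add: "heisenberg_monomial lam (v + w) = heisenberg_monomial lam v + heisenberg_monomial lam w"
proof -
  have "foldr heisenberg is (v + w) = foldr heisenberg is v + foldr heisenberg is w" for "is"
    by (induction "is") (simp_all add: heisenberg_add)
  then show ?thesis by (simp add: heisenberg_monomial_def)
qed

lemma heisenberg_monomial_scale: "heisenberg_monomial lam (scale c v) = scale c (heisenberg_monomial lam v)"
proof -
  have "foldr heisenberg is (scale c v) = scale c (foldr heisenberg is v)" for "is"
    by (induction "is") (simp_all add: heisenberg_scale)
  then show ?thesis by (simp add: heisenberg_monomial_def)
qed

text \<open>The sum that defines the operator of a series ranges over different sets of generalized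
  partitions for different vectors; a common finite range exists once the degrees are bounded.\<close>

lemma op_of_series_linear:
  fixes g :: "'x \<Rightarrow> 'a::field fock"
  assumes c: "\<And>lam. c lam \<noteq> 0 \<Longrightarrow> lam \<noteq> {#} \<and> \<Sum>\<^sub># lam = 0 \<and> size lam \<le> 4"
    and "finite A"
  shows "op_of_series c (\<Sum>x\<in>A. scale (f x) (g x)) = (\<Sum>x\<in>A. scale (f x) (op_of_series c (g x)))"
  using \<open>finite A\<close>
proof induction
  case empty
  show ?case by (simp add: op_of_series_def)
next
  case (insert x A)
  let ?w = "\<Sum>x\<in>A. scale (f x) (g x)"
  obtain d e where "deg_le (int d) (g x)" "deg_le (int e) ?w"
    using deg_le_exists by metis
  then have d: "deg_le (int (max d e)) (g x)" "deg_le (int (max d e)) ?w"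
    by (auto elim: deg_le_mono)
  then have s: "deg_le (int (max d e)) (scale (f x) (g x) + ?w)"
    by (intro deg_le_add deg_le_scale)
  have op: "op_of_series c w = (\<Sum>lam\<in>genparts (max d e). scale (c lam) (heisenberg_monomial lam w))"
    if "deg_le (int (max d e)) w" for w :: "'a fock"
    by (rule op_of_series_genparts[OF that]) (rule c)
  have "op_of_series c (scale (f x) (g x) + ?w) = scale (f x) (op_of_series c (g x)) + op_of_series c ?w"
    unfolding op[OF s] op[OF d(1)] op[OF d(2)] heisenberg_monomial_add heisenberg_monomial_scale scale_sum sum.distrib[symmetric]
    by (intro sum.cong refl) (simp add: scale_add_right scale_scale mult.commute)
  with insert show ?case by simp
qed

section \<open>The Chern character operators\<close>

text \<open>The combinations of the \<open>H j\<close> that give \<open>B0\<close>, \<open>B1\<close>, \<open>B2\<close> are applied to the eigenvalues.\<close>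

lemma op_Bbar_jack:
  fixes P :: "partition \<Rightarrow> 'a::field_char_0 fock"
  assumes P: "is_jack_P \<alpha> P" and \<alpha>: "\<alpha> \<noteq> 0" and k: "k \<le> 2"
  shows "op_of_series (Bbar_coeff k \<alpha>) (P lam) = scale (content_sum \<alpha> k (parts lam) / fact k) (P lam)"
proof -
  \<comment> \<open>A degree bound fixes the truncation of the operators.\<close>
  obtain d where d: "deg_le (int d) (P lam)" using deg_le_exists by blast
  let ?e = "\<lambda>j. ham_eigenvalue \<alpha> j (mset (parts lam))"
  have ham: "ham \<alpha> d j (P lam) = scale (?e j) (P lam)" if "j \<le> 2" for j
    using ham_jack[OF P \<alpha> that d] by (simp add: mset_parts)
  have cancel: "v = scale (b / a) (P lam)" if "scale a v = scale b (P lam)" "a \<noteq> 0" for a b v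
    using arg_cong[OF that(1), of "scale (1 / a)"] that(2) by (simp add: scale_scale)
  note op = op_Bbar_0[OF \<alpha> d] op_Bbar_1[OF \<alpha> d] op_Bbar_2[OF \<alpha> d]
  have eigenvalue_1: "2 * content_sum \<alpha> 1 (parts lam) = ?e 1 - (\<alpha> - 1) * ?e 0"
    by (rule content_sum_1) (rule parts_antimono)
  have eigenvalue_2: "3 * content_sum \<alpha> 2 (parts lam) =
      ?e 2 + \<alpha> / 2 * ?e 0 ^ 2 - 3 / 2 * (\<alpha> - 1) * ?e 1 + (\<alpha> ^ 2 - 3 * \<alpha> + 1) / 2 * ?e 0"
    by (rule content_sum_2) (rule parts_antimono)
  consider "k = 0" | "k = 1" | "k = 2" using k by linarith
  then show ?thesis
  proof cases
    case 1
    then show ?thesis by (simp add: op ham content_sum_0[OF parts_antimono])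
  next
    case 2
    have "scale 2 (op_of_series (Bbar_coeff 1 \<alpha>) (P lam)) = scale (2 * content_sum \<alpha> 1 (parts lam)) (P lam)"
      unfolding op eigenvalue_1
      by (rule poly_mapping_eqI) (simp add: ham lookup_minus lookup_scale algebra_simps)
    from cancel[OF this] 2 show ?thesis by simp
  next
    case 3
    have "ham \<alpha> d 0 (scale c v) = scale c (ham \<alpha> d 0 v)" for c v
      by (simp add: ham_0 normal11_def fock_linear mult.commute)
    then have "scale 6 (op_of_series (Bbar_coeff 2 \<alpha>) (P lam)) = scale (3 * content_sum \<alpha> 2 (parts lam)) (P lam)"
      unfolding op eigenvalue_2
      by (intro poly_mapping_eqI) (simp add: ham lookup_add lookup_minus lookup_scale power2_eq_square algebra_simps)
    from cancel[OF this] 3 show ?thesis by (simp add: fact_numeral)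
  qed
qed

lemma coarm_eq: "(i, j) \<in> diagram lam \<Longrightarrow> coarm lam (i, j) = j"
proof -
  assume "(i, j) \<in> diagram lam"
  then have "{(i', j') \<in> diagram lam. i' = fst (i, j) \<and> j' < snd (i, j)} = Pair i ` {..<j}"
    by (auto simp: diagram_def)
  then show ?thesis by (simp add: coarm_def card_image inj_on_def)
qed

lemma coleg_eq: "(i, j) \<in> diagram lam \<Longrightarrow> coleg lam (i, j) = i"
proof -
  assume ij: "(i, j) \<in> diagram lam"
  have "j < parts lam ! i'" if "i' < i" for i'
    using ij parts_antimono[of i' i lam] that by (auto simp: diagram_def)
  then have "{(i', j') \<in> diagram lam. j' = snd (i, j) \<and> i' < fst (i, j)} = (\<lambda>i'. (i', j)) ` {..<i}"
    using ij by (auto simp: diagram_def)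
  then show ?thesis by (simp add: coleg_def card_image inj_on_def)
qed

lemma t1_nonzero: "t1 \<noteq> 0" and t2_nonzero: "t2 \<noteq> 0"
  by (simp_all add: t1_def t2_def Zero_fract_def eq_fract)

lemma chern_eigenvalue_content_sum:
  "chern_eigenvalue k lam = t2 ^ k * (content_sum (- t1 / t2) k (parts lam) / fact k)"
proof -
  have diagram: "diagram lam = Sigma {..<length (parts lam)} (\<lambda>i. {..<parts lam ! i})"
    by (auto simp: diagram_def)
  have "chern_eigenvalue k lam = (\<Sum>s\<in>diagram lam. t2 ^ k * ((- t1 / t2) * of_nat (snd s) - of_nat (fst s)) ^ k / fact k)"
    unfolding chern_eigenvalue_def
  proof (intro sum.cong refl)
    fix s assume s: "s \<in> diagram lam"
    obtain i j where ij: "s = (i, j)" by (cases s)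
    have "t2 * ((- t1 / t2) * of_nat j - of_nat i) = (- 1) * (of_nat j * t1 + of_nat i * t2)"
      using t2_nonzero by (simp add: field_simps)
    then have "t2 ^ k * ((- t1 / t2) * of_nat j - of_nat i) ^ k = (- 1) ^ k * (of_nat j * t1 + of_nat i * t2) ^ k"
      by (simp only: power_mult_distrib[symmetric])
    then show "(- 1) ^ k / fact k * (of_nat (coarm lam s) * t1 + of_nat (coleg lam s) * t2) ^ k =
        t2 ^ k * ((- t1 / t2) * of_nat (snd s) - of_nat (fst s)) ^ k / fact k"
      using s by (simp add: ij coarm_eq coleg_eq)
  qed
  also have "\<dots> = (\<Sum>i<length (parts lam). \<Sum>j<parts lam ! i. t2 ^ k * ((- t1 / t2) * of_nat j - of_nat i) ^ k / fact k)"
    unfolding diagram by (subst sum.Sigma) (auto simp: case_prod_unfold)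
  also have "\<dots> = t2 ^ k * (content_sum (- t1 / t2) k (parts lam) / fact k)"
    by (simp add: content_sum_def sum_distrib_left sum_divide_distrib)
  finally show ?thesis .
qed

lemma lookup_chern_operator: "Poly_Mapping.lookup (chern_operator k x) lam = chern_eigenvalue k lam * Poly_Mapping.lookup x lam"
proof -
  have "Poly_Mapping.lookup (chern_operator k x) lam =
      (\<Sum>mu\<in>Poly_Mapping.keys x. if mu = lam then chern_eigenvalue k lam * Poly_Mapping.lookup x lam else 0)"
    unfolding chern_operator_def lookup_sum by (intro sum.cong refl) (auto simp: lookup_single when_def)
  also have "\<dots> = chern_eigenvalue k lam * Poly_Mapping.lookup x lam"
    by (simp add: in_keys_iff)
  finally show ?thesis .
qed

lemma hilb_to_fock_chern_operator:
  "hilb_to_fock P (chern_operator k x) =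
    (\<Sum>lam\<in>Poly_Mapping.keys x. scale (Poly_Mapping.lookup x lam) (scale (chern_eigenvalue k lam) (fixed_point_class P lam)))"
proof -
  have "hilb_to_fock P (chern_operator k x) = (\<Sum>lam\<in>Poly_Mapping.keys x.
      scale (Poly_Mapping.lookup (chern_operator k x) lam) (fixed_point_class P lam))"
    unfolding hilb_to_fock_def
    by (rule sum.mono_neutral_left) (auto simp: in_keys_iff lookup_chern_operator)
  then show ?thesis by (simp add: lookup_chern_operator scale_scale mult.commute)
qed

theorem theorem1p2:
  fixes P :: "partition \<Rightarrow> ratfun fock" and k :: nat
  assumes "is_jack_P (- t1 / t2) P"
    and "k \<le> 2"
  shows "hilb_to_fock P \<circ> chern_operator k =
    op_of_series (scale_series (t2 ^ k) (twist_delta t1 (Bbar_coeff k (- t1 / t2)))) \<circ> hilb_to_fock P"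
proof
  fix x
  let ?\<alpha> = "- t1 / t2"
  let ?C = "scale_series (t2 ^ k) (twist_delta t1 (Bbar_coeff k ?\<alpha>))"
  have \<alpha>: "?\<alpha> \<noteq> 0" and t2k: "t2 ^ k \<noteq> 0"
    using t1_nonzero t2_nonzero by simp_all
  have supp: "lam \<noteq> {#} \<and> \<Sum>\<^sub># lam = 0 \<and> size lam \<le> 4" if "?C lam \<noteq> 0" for lam
    by (rule Bbar_coeff_support[OF \<alpha> assms(2)]) (use that in \<open>auto simp: scale_series_def twist_delta_def\<close>)
  have op_scale: "op_of_series ?C (scale a v) = scale a (op_of_series ?C v)" for a v
    using op_of_series_linear[of ?C "{()}" "\<lambda>_. a" "\<lambda>_. v"] supp by simp
  have "op_of_series ?C (fixed_point_class P lam) = scale (chern_eigenvalue k lam) (fixed_point_class P lam)" for lam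
    unfolding fixed_point_class_def jack_J_def twist_length_scale op_scale
    unfolding op_of_series_scale_series[OF t2k] op_of_series_twist_delta[OF t1_nonzero]
      op_Bbar_jack[OF assms(1) \<alpha> assms(2)] twist_length_scale scale_scale chern_eigenvalue_content_sum
    by (simp only: mult_ac)
  then have "op_of_series ?C (hilb_to_fock P x) =
     (\<Sum>lam\<in>Poly_Mapping.keys x. scale (Poly_Mapping.lookup x lam) (scale (chern_eigenvalue k lam) (fixed_point_class P lam)))"
    unfolding hilb_to_fock_def by (subst op_of_series_linear) (simp_all only: supp finite_keys simp_thms)
  then show "(hilb_to_fock P \<circ> chern_operator k) x = (op_of_series ?C \<circ> hilb_to_fock P) x"
    by (simp add: hilb_to_fock_chern_operator)
qed

end
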